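(* Fix $0<\alpha<\frac{\log 3}{4\log 2}$ and $\nu>0$. Suppose $u^0\in\dot H^s_{\mathcal M}$, where $\frac{\log 3}{2\log 2}-2\alpha<s\le\frac{\log 3}{2\log 2}$. Then there exists a unique (mild, smooth for positive times) solution $u\in C\big([0,T_{max});\dot H^s_{\mathcal M}\big)$ of the Fourier-restricted hypodissipative Navier--Stokes equation with initial data $u^0$, where $T_{max}$ is the maximal time of existence, and $$T_{max}\ge\frac{\nu^{\frac1\rho-1}}{\big(C_{s,\alpha}\|u^0\|_{\dot H^s}\big)^{\frac1\rho}},\qquad \rho=1-\frac{\frac{\log 3}{2\log 2}-s}{2\alpha},$$ where $C_{s,\alpha}>0$ is a constant independent of $u^0$ and $\nu$. Furthermore, if $T_{max}<+\infty$, then for all $0\le t<T_{max}$, $$\|u(\cdot,t)\|_{\dot H^s}\ge\frac{\nu^{1-\rho}}{C_{s,\alpha}(T_{max}-t)^\rho}.$$ For $s=\frac{\log 3}{2\log 2}$ we have $$T_{max}\ge\frac1{\mathcal C_*\|u^0\|_{\dot H^{\frac{\log 3}{2\log 2}}}},$$ where $\mathcal C_*>0$ is an absolute constant, and consequently, if $T_{max}<+\infty$, then $\|u(\cdot,t)\|_{\dot H^{\frac{\log 3}{2\log 2}}}\ge\frac{1}{\mathcal C_*(T_{max}-t)}$ for all $0\le t<T_{max}$. Furthermore, for all $0\le t<T_{max}$ the energy equality $$\tfrac12\|u(\cdot,t)\|_{L^2}^2+\nu\int_0^t\|u(\cdot,\tau)\|_{\dot H^\alpha}^2\,d\tau=\tfrac12\|u^0\|_{L^2}^2$$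 holds. Finally, $u\in C^\infty\big((0,T_{max})\times\mathbb T^3\big)$.
   Context: Function spaces: $\mathbb T^3=\mathbb R^3/\mathbb Z^3$, $\hat u(k)=\int_{\mathbb T^3}u(x)e^{-2\pi i k\cdot x}\,dx$ for $k\in\mathbb Z^3$. For $s\ge0$, $\dot H^s=\dot H^s(\mathbb T^3;\mathbb R^3)$ is the space of mean-zero $L^2$ vector fields with $\|u\|_{\dot H^s}^2=\sum_{k\ne0}(4\pi^2|k|^2)^s|\hat u(k)|^2<\infty$. $(-\Delta)^\alpha$ is the Fourier multiplier $(4\pi^2|k|^2)^\alpha$. Frequencies: let $\sigma=(1,1,1)$. For integers $m\ge0$ let $k^m=2^{2m}\sigma+3^m(1,0,-1)$, $h^m=2^{2m+1}\sigma+3^m(1,1,-2)$, $j^m=2^{2m+1}\sigma+3^m(2,-1,-1)$. For $v\in\mathbb R^3$, $\mathcal P[v]$ is the set of all vectors obtained by permuting the entries of $v$. Let $\mathcal M^+_{2m}=\mathcal P[k^m]$, $\mathcal M^+_{2m+1}=\mathcal P[h^m]\cup\mathcal P[j^m]$, $\mathcal M^+=\bigcup_{n\ge0}\mathcal M_n^+$, $\mathcal M=\mathcal M^+\cup(-\mathcal M^+)$. For $k\in\mathcal M$ let $P_k^\perp(\sigma)=\sigma-\frac{k\cdot\sigma}{|k|^2}k$ and $v^k=P_k^\perp(\sigma)/|P_k^\perp(\sigma)|$. Constraint space: $\dot H^s_{\mathcal M}$ is the set of $u\in\dot H^s(\mathbb T^3;\mathbb R^3)$ with $\operatorname{supp}\hat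 u\subset\mathcal M$ and $\hat u(k)\in\operatorname{span}\{v^k\}$ (complex multiples of $v^k$) for all $k\in\mathcal M$. The projection $\mathbb P_{\mathcal M}$ is given by $\widehat{\mathbb P_{\mathcal M}w}(k)=(v^k\cdot\hat w(k))v^k$ for $k\in\mathcal M$ and $0$ for $k\notin\mathcal M$; $(u\cdot\nabla)u=\nabla\cdot(u\otimes u)$ in the sense of distributions. Equation: the Fourier-restricted hypodissipative Navier--Stokes equation is $\partial_tu+\nu(-\Delta)^\alpha u+\mathbb P_{\mathcal M}((u\cdot\nabla)u)=0$. A solution $u\in C([0,T);\dot H^s_{\mathcal M})$ (with $s\ge0$, $s>\frac{\log3}{2\log2}-2\alpha$) is understood as a mild solution: for all $0<t<T$, $u(\cdot,t)=e^{-\nu t(-\Delta)^\alpha}u^0-\int_0^te^{-\nu(t-\tau)(-\Delta)^\alpha}\mathbb P_{\mathcal M}((u\cdot\nabla)u)(\cdot,\tau)\,d\tau$. *)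

theory Defs
  imports "HOL-Analysis.Analysis"
begin

text \<open>A function on the torus is a function on \<open>real^3\<close> that has period 1 in each coordinate;
  integrals over the torus are Lebesgue integrals over the closed unit cube. Elements of \<open>L\<^sup>2\<close>
  are represented by functions, so that equality in \<open>L\<^sup>2\<close> is equality almost everywhere.\<close>

abbreviation unit_cube :: "(real^3) set" where
  "unit_cube \<equiv> cbox 0 1"

definition periodic3 :: "(real^3 \<Rightarrow> 'b) \<Rightarrow> bool" where
  "periodic3 u \<longleftrightarrow> (\<forall>x i. u (x + axis i 1) = u x)"

definition L2_field :: "(real^3 \<Rightarrow> real^3) \<Rightarrow> bool" where
  "L2_field u \<longleftrightarrow> periodic3 u \<and> u \<in> borel_measurable lebesgue \<and>
     set_integrable lebesgue unit_cube (\<lambda>x. (norm (u x))\<^sup>2)"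

definition L2_norm :: "(real^3 \<Rightarrow> real^3) \<Rightarrow> real" where
  "L2_norm u = sqrt (LINT x:unit_cube|lebesgue. (norm (u x))\<^sup>2)"

definition ae_eq :: "(real^3 \<Rightarrow> real^3) \<Rightarrow> (real^3 \<Rightarrow> real^3) \<Rightarrow> bool" where
  "ae_eq u w \<longleftrightarrow> (AE x in lebesgue. u x = w x)"

definition rvec :: "int^3 \<Rightarrow> real^3" where
  "rvec k = (\<chi> i. real_of_int (k $ i))"

definition cvec :: "real^3 \<Rightarrow> complex^3" where
  "cvec v = (\<chi> i. complex_of_real (v $ i))"

definition fourier_coeff :: "(real^3 \<Rightarrow> real) \<Rightarrow> int^3 \<Rightarrow> complex" where
  "fourier_coeff f k =
     (LINT x:unit_cube|lebesgue. complex_of_real (f x) * exp (- 2 * pi * \<i> * complex_of_real (rvec k \<bullet> x)))"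

definition fhat :: "(real^3 \<Rightarrow> real^3) \<Rightarrow> int^3 \<Rightarrow> complex^3" where
  "fhat u k = (\<chi> i. fourier_coeff (\<lambda>x. u x $ i) k)"

text \<open>The symbol of \<open>(-\<Delta>)\<^sup>a\<close>, and also the weight in the norm of \<open>H\<^sup>a\<close>, where \<open>k = 0\<close> is excluded.\<close>

definition lap_symbol :: "real \<Rightarrow> int^3 \<Rightarrow> real" where
  "lap_symbol a k = (4 * pi\<^sup>2 * (norm (rvec k))\<^sup>2) powr a"

text \<open>Periodic vector valued distributions are represented by their families of Fourier
  coefficients, of type \<open>int^3 \<Rightarrow> complex^3\<close>.\<close>

definition coeff_in_Hs :: "real \<Rightarrow> (int^3 \<Rightarrow> complex^3) \<Rightarrow> bool" where
  "coeff_in_Hs s c \<longleftrightarrow> c 0 = 0 \<and> (\<lambda>k. lap_symbol s k * (norm (c k))\<^sup>2) summable_on {k. k \<noteq> 0}"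

definition coeff_Hs_norm :: "real \<Rightarrow> (int^3 \<Rightarrow> complex^3) \<Rightarrow> real" where
  "coeff_Hs_norm s c = sqrt (infsum (\<lambda>k. lap_symbol s k * (norm (c k))\<^sup>2) {k. k \<noteq> 0})"

definition Hs :: "real \<Rightarrow> (real^3 \<Rightarrow> real^3) set" where
  "Hs s = {u. L2_field u \<and> (LINT x:unit_cube|lebesgue. u x) = 0 \<and>
              (\<lambda>k. lap_symbol s k * (norm (fhat u k))\<^sup>2) summable_on {k. k \<noteq> 0}}"

definition Hs_norm :: "real \<Rightarrow> (real^3 \<Rightarrow> real^3) \<Rightarrow> real" where
  "Hs_norm s u = coeff_Hs_norm s (fhat u)"

definition sigma :: "int^3" where
  "sigma = vector [1, 1, 1]"

definition freq_k :: "nat \<Rightarrow> int^3" where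
  "freq_k m = 2 ^ (2 * m) *s sigma + 3 ^ m *s vector [1, 0, -1]"

definition freq_h :: "nat \<Rightarrow> int^3" where
  "freq_h m = 2 ^ (2 * m + 1) *s sigma + 3 ^ m *s vector [1, 1, -2]"

definition freq_j :: "nat \<Rightarrow> int^3" where
  "freq_j m = 2 ^ (2 * m + 1) *s sigma + 3 ^ m *s vector [2, -1, -1]"

definition perms :: "int^3 \<Rightarrow> (int^3) set" where
  "perms v = {\<chi> i. v $ p i | p. bij p}"

definition Mplus_level :: "nat \<Rightarrow> (int^3) set" where
  "Mplus_level n = (if even n then perms (freq_k (n div 2))
                    else perms (freq_h (n div 2)) \<union> perms (freq_j (n div 2)))"

definition Mplus :: "(int^3) set" where
  "Mplus = (\<Union>n. Mplus_level n)"

definition Mfreq :: "(int^3) set" where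
  "Mfreq = Mplus \<union> uminus ` Mplus"

definition perp_sigma :: "int^3 \<Rightarrow> real^3" where
  "perp_sigma k = rvec sigma - ((rvec k \<bullet> rvec sigma) / (norm (rvec k))\<^sup>2) *\<^sub>R rvec k"

definition vdir :: "int^3 \<Rightarrow> real^3" where
  "vdir k = perp_sigma k /\<^sub>R norm (perp_sigma k)"

definition HsM :: "real \<Rightarrow> (real^3 \<Rightarrow> real^3) set" where
  "HsM s = {u \<in> Hs s. (\<forall>k. k \<notin> Mfreq \<longrightarrow> fhat u k = 0) \<and>
                      (\<forall>k\<in>Mfreq. \<exists>c::complex. fhat u k = c *s cvec (vdir k))}"

definition proj_M :: "(int^3 \<Rightarrow> complex^3) \<Rightarrow> int^3 \<Rightarrow> complex^3" where
  "proj_M w k = (if k \<in> Mfreq then (\<Sum>i\<in>UNIV. cvec (vdir k) $ i * w k $ i) *s cvec (vdir k) else 0)"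

text \<open>The Fourier coefficients of the distributional divergence of \<open>u \<otimes> u\<close>: for \<open>u\<close> in \<open>L\<^sup>2\<close> the
  products \<open>u\<^sub>j u\<^sub>i\<close> are integrable, and the \<open>j\<close>-th derivative acts as multiplication by
  \<open>2 \<pi> \<i> k\<^sub>j\<close>.\<close>

definition advection_hat :: "(real^3 \<Rightarrow> real^3) \<Rightarrow> int^3 \<Rightarrow> complex^3" where
  "advection_hat u k =
     (\<chi> i. \<Sum>j\<in>UNIV. 2 * pi * \<i> * of_int (k $ j) * fourier_coeff (\<lambda>x. u x $ j * u x $ i) k)"

definition semigroup_hat :: "real \<Rightarrow> real \<Rightarrow> real \<Rightarrow> (int^3 \<Rightarrow> complex^3) \<Rightarrow> int^3 \<Rightarrow> complex^3" where
  "semigroup_hat \<nu> \<alpha> t c k = exp (- \<nu> * t * lap_symbol \<alpha> k) *\<^sub>R c k"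

text \<open>Bochner integrability in the separable Hilbert space \<open>H\<^sup>s\<close>. By Pettis' theorem strong
  measurability is measurability of every Fourier coefficient, and the Bochner integral is then
  computed coefficient by coefficient.\<close>

definition Hs_Bochner_integrable :: "real \<Rightarrow> real set \<Rightarrow> (real \<Rightarrow> int^3 \<Rightarrow> complex^3) \<Rightarrow> bool" where
  "Hs_Bochner_integrable s I F \<longleftrightarrow>
     (\<forall>\<tau>\<in>I. coeff_in_Hs s (F \<tau>)) \<and>
     (\<forall>k. set_borel_measurable lebesgue I (\<lambda>\<tau>. F \<tau> k)) \<and>
     set_integrable lebesgue I (\<lambda>\<tau>. coeff_Hs_norm s (F \<tau>))"

definition Hs_Bochner_integral :: "real set \<Rightarrow> (real \<Rightarrow> int^3 \<Rightarrow> complex^3) \<Rightarrow> int^3 \<Rightarrow> complex^3" where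
  "Hs_Bochner_integral I F k = (LINT \<tau>:I|lebesgue. F \<tau> k)"

definition time_interval :: "ereal \<Rightarrow> real set" where
  "time_interval T = {t. 0 \<le> t \<and> ereal t < T}"

definition continuous_HsM :: "real \<Rightarrow> ereal \<Rightarrow> (real \<Rightarrow> real^3 \<Rightarrow> real^3) \<Rightarrow> bool" where
  "continuous_HsM s T u \<longleftrightarrow>
     (\<forall>t\<in>time_interval T. u t \<in> HsM s) \<and>
     (\<forall>t\<in>time_interval T.
        ((\<lambda>\<tau>. Hs_norm s (\<lambda>x. u \<tau> x - u t x)) \<longlongrightarrow> 0) (at t within time_interval T))"

definition duhamel_integrand ::
  "real \<Rightarrow> real \<Rightarrow> (real \<Rightarrow> real^3 \<Rightarrow> real^3) \<Rightarrow> real \<Rightarrow> real \<Rightarrow> int^3 \<Rightarrow> complex^3" where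
  "duhamel_integrand \<nu> \<alpha> u t \<tau> = semigroup_hat \<nu> \<alpha> (t - \<tau>) (proj_M (advection_hat (u \<tau>)))"

text \<open>The integral is taken over the open interval because the integrand need not lie in \<open>H\<^sup>s\<close>
  at the end point \<open>\<tau> = t\<close>.\<close>

definition mild_solution ::
  "real \<Rightarrow> real \<Rightarrow> real \<Rightarrow> (real^3 \<Rightarrow> real^3) \<Rightarrow> ereal \<Rightarrow> (real \<Rightarrow> real^3 \<Rightarrow> real^3) \<Rightarrow> bool" where
  "mild_solution \<nu> \<alpha> s u0 T u \<longleftrightarrow>
     0 < T \<and> continuous_HsM s T u \<and> ae_eq (u 0) u0 \<and>
     (\<forall>t. 0 < t \<and> ereal t < T \<longrightarrow>
        Hs_Bochner_integrable s {0<..<t} (duhamel_integrand \<nu> \<alpha> u t) \<and>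
        (\<forall>k. fhat (u t) k = semigroup_hat \<nu> \<alpha> t (fhat u0) k
                            - Hs_Bochner_integral {0<..<t} (duhamel_integrand \<nu> \<alpha> u t) k))"

definition max_existence_time :: "real \<Rightarrow> real \<Rightarrow> real \<Rightarrow> (real^3 \<Rightarrow> real^3) \<Rightarrow> ereal" where
  "max_existence_time \<nu> \<alpha> s u0 = Sup {T. \<exists>u. mild_solution \<nu> \<alpha> s u0 T u}"

primrec Ck_on :: "nat \<Rightarrow> ('a::real_normed_vector \<Rightarrow> 'b::real_normed_vector) \<Rightarrow> 'a set \<Rightarrow> bool" where
  "Ck_on 0 f S \<longleftrightarrow> continuous_on S f"
| "Ck_on (Suc n) f S \<longleftrightarrow> (\<forall>x\<in>S. f differentiable (at x)) \<and>
     (\<forall>v. Ck_on n (\<lambda>x. frechet_derivative f (at x) v) S)"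

definition smooth_on :: "('a::real_normed_vector \<Rightarrow> 'b::real_normed_vector) \<Rightarrow> 'a set \<Rightarrow> bool" where
  "smooth_on f S \<longleftrightarrow> (\<forall>n. Ck_on n f S)"

definition crit_exp :: real where
  "crit_exp = ln 3 / (2 * ln 2)"

definition rho :: "real \<Rightarrow> real \<Rightarrow> real" where
  "rho \<alpha> s = 1 - (crit_exp - s) / (2 * \<alpha>)"

end

theory Submission
  imports Defs "HOL-Probability.Discrete_Topology"
begin

text \<open>If \<open>k \<in> M\<close> lies in level \<open>n\<close>, then \<open>k \<bullet> \<sigma> = \<plusminus>3 * 2^n\<close> and \<open>|k|\<^sup>2 = 3 * 4^n + 2 * 3^n\<close>. The first
  identity forces the frequencies of a triad to lie in levels \<open>n, n, n + 1\<close>, so that for fields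
  \<open>u\<close> with \<open>u^(k) = a\<^sub>k v\<^sup>k\<close> the equation is a system of ordinary differential equations in
  which every \<open>a\<^sub>k\<close> interacts with boundedly many others; the second one and the
  choice of \<open>v\<^sup>k\<close> bound the interaction coefficients by \<open>3^(n/2) \<approx> |k|^\<beta>\<close>, \<open>\<beta> = ln 3 / (2 ln 2)\<close>.

  Since \<open>M\<close> is lacunary and \<open>s > 0\<close>, all Fourier series involved converge absolutely. The system can
  therefore be solved by a contraction in the norm \<open>sup |k|^s |a\<^sub>k|\<close>, with an existence time that
  depends only on this norm, which is bounded by the \<open>H^s\<close> norm; the Duhamel term decays strictly faster than
  \<open>|k|^(-s)\<close>, which returns membership and continuity in \<open>H^s\<close>. Restarting yields the blowup rates.
  Iterating the gain \<open>s \<mapsto> 2 s - \<beta> + 2 \<alpha>\<close> of the Duhamel formula makes the coefficients decay rapidly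
  for positive times; this gives smoothness, and it justifies the energy balance for \<open>t > 0\<close>, which extends
  to \<open>t = 0\<close> by continuity in \<open>L\<^sup>2\<close>.\<close>

subsection \<open>Frequencies and triads\<close>

text \<open>The critical exponent comes from a cancellation. A frequency of level n is, up to sign,
  2^n * sigma plus an orthogonal remainder of length sqrt 2 * 3^(n/2). It is thus nearly parallel to
  sigma, and v^k, being orthogonal to it, meets sigma only at size (sqrt 3 / 2)^n. In the advection
  term the large part 2^n of a frequency is cut down to 3^(n/2), the size of its remainder. Every k
  has boundedly many partners, none of them much smaller than k, so a weighted supremum norm
  controls the quadratic term without any summation. Of the 2 * \<alpha> powers of |k| gained by the
  semigroup, 2 * \<alpha> * (1 - \<rho>) = \<beta> - s are spent to recover the weight s; the
  fraction \<rho> becomes the factor t^\<rho>. Spending only half of \<rho> on time leaves \<alpha>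
  * \<rho> powers of decay, enough for square summability. The other obstacle is the passage between
  fields and coefficients: fields are given almost everywhere and their products enter through
  integrals, so uniqueness of Fourier coefficients and the convolution formula must precede the
  reduction to the system.\<close>

definition freq_level :: "nat \<Rightarrow> (int^3) set" where
  "freq_level n = Mplus_level n \<union> uminus ` Mplus_level n"

text \<open>The symbol of the square root of the negative Laplacian, so that
  \<open>lap_symbol a k\<close> is \<open>wt k powr (2 * a)\<close>.\<close>

definition wt :: "int^3 \<Rightarrow> real" where
  "wt k = 2 * pi * norm (rvec k)"

definition partners :: "int^3 \<Rightarrow> (int^3) set" where
  "partners k = {l \<in> Mfreq. k - l \<in> Mfreq}"

text \<open>The factor of \<open>c l * d (k - l)\<close> in the \<open>vdir k\<close> component of
  the advection term: \<open>vdir l\<close> is the advecting direction, contracted with the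
  derivative 2 * pi * i * k, and \<open>vdir (k - l)\<close> is the advected one.\<close>

definition triad :: "int^3 \<Rightarrow> int^3 \<Rightarrow> complex" where
  "triad k l = 2 * pi * \<i> * of_real ((vdir l \<bullet> rvec k) * (vdir (k - l) \<bullet> vdir k))"

section \<open>Invariants and cardinality of a level\<close>

lemma rvec_add [simp]: "rvec (k + l) = rvec k + rvec l"
  by (simp add: rvec_def vec_eq_iff)

lemma rvec_diff [simp]: "rvec (k - l) = rvec k - rvec l"
  by (simp add: rvec_def vec_eq_iff)

lemma rvec_uminus [simp]: "rvec (- k) = - rvec k"
  by (simp add: rvec_def vec_eq_iff)

lemma rvec_0 [simp]: "rvec 0 = 0"
  by (simp add: rvec_def vec_eq_iff)

lemma rvec_sigma_inner_self: "rvec sigma \<bullet> rvec sigma = 3"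
  by (simp add: inner_vec_def sum_3 rvec_def sigma_def)

lemma perms_invariants:
  assumes "k \<in> perms v"
  shows "rvec k \<bullet> rvec sigma = rvec v \<bullet> rvec sigma" "rvec k \<bullet> rvec k = rvec v \<bullet> rvec v"
proof -
  obtain p :: "3 \<Rightarrow> 3" where p: "bij p" "k = (\<chi> i. v $ p i)"
    using assms by (auto simp: perms_def)
  have s: "rvec sigma $ i = 1" for i
    using exhaust_3 [of i] by (auto simp: rvec_def sigma_def)
  have r: "(\<Sum>i\<in>UNIV. f (p i)) = (\<Sum>i\<in>UNIV. f i)" for f :: "3 \<Rightarrow> real"
    using sum.reindex_bij_betw [OF p(1)] by blast
  show "rvec k \<bullet> rvec sigma = rvec v \<bullet> rvec sigma"
    using r [of "\<lambda>i. real_of_int (v $ i)"] by (simp add: inner_vec_def s) (simp add: rvec_def p(2))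
  show "rvec k \<bullet> rvec k = rvec v \<bullet> rvec v"
    using r [of "\<lambda>i. real_of_int (v $ i) * real_of_int (v $ i)"]
    by (simp add: inner_vec_def) (simp add: rvec_def p(2))
qed

text \<open>The vectors (1,0,-1), (1,1,-2) and (2,-1,-1) are orthogonal to sigma, with squared
  lengths 2, 6 and 6. Since 6 * 9^m = 2 * 3^(2m+1), odd levels obey the same formula as even ones,
  and parity disappears after \<open>Mplus_level_invariants\<close>.\<close>

lemma freq_invariants:
  "rvec (freq_k m) \<bullet> rvec sigma = 3 * 2 ^ (2 * m)"
  "rvec (freq_h m) \<bullet> rvec sigma = 3 * 2 ^ (2 * m + 1)"
  "rvec (freq_j m) \<bullet> rvec sigma = 3 * 2 ^ (2 * m + 1)"
  "rvec (freq_k m) \<bullet> rvec (freq_k m) = 3 * 4 ^ (2 * m) + 2 * 3 ^ (2 * m)"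
  "rvec (freq_h m) \<bullet> rvec (freq_h m) = 3 * 4 ^ (2 * m + 1) + 2 * 3 ^ (2 * m + 1)"
  "rvec (freq_j m) \<bullet> rvec (freq_j m) = 3 * 4 ^ (2 * m + 1) + 2 * 3 ^ (2 * m + 1)"
proof -
  have e: "(4::real) ^ n = (2 ^ n)\<^sup>2" for n
    by (simp add: power2_eq_square flip: power_mult_distrib)
  note d = inner_vec_def sum_3 rvec_def sigma_def freq_k_def freq_h_def freq_j_def e
  show "rvec (freq_k m) \<bullet> rvec sigma = 3 * 2 ^ (2 * m)"
    "rvec (freq_h m) \<bullet> rvec sigma = 3 * 2 ^ (2 * m + 1)"
    "rvec (freq_j m) \<bullet> rvec sigma = 3 * 2 ^ (2 * m + 1)"
    by (simp_all add: d)
  show "rvec (freq_k m) \<bullet> rvec (freq_k m) = 3 * 4 ^ (2 * m) + 2 * 3 ^ (2 * m)"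
    "rvec (freq_h m) \<bullet> rvec (freq_h m) = 3 * 4 ^ (2 * m + 1) + 2 * 3 ^ (2 * m + 1)"
    "rvec (freq_j m) \<bullet> rvec (freq_j m) = 3 * 4 ^ (2 * m + 1) + 2 * 3 ^ (2 * m + 1)"
    by (simp_all add: d) (simp_all add: power2_eq_square algebra_simps power_mult flip: power_mult_distrib)
qed

lemma Mplus_level_invariants:
  assumes "k \<in> Mplus_level n"
  shows "rvec k \<bullet> rvec sigma = 3 * 2 ^ n" "rvec k \<bullet> rvec k = 3 * 4 ^ n + 2 * 3 ^ n"
proof -
  have *: "rvec k \<bullet> rvec sigma = 3 * 2 ^ n \<and> rvec k \<bullet> rvec k = 3 * 4 ^ n + 2 * 3 ^ n"
  proof (cases "even n")
    case True
    then have "2 * (n div 2) = n" by simp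
    moreover have "k \<in> perms (freq_k (n div 2))"
      using assms True by (simp add: Mplus_level_def)
    ultimately show ?thesis
      using perms_invariants [of k "freq_k (n div 2)"] freq_invariants(1,4) [of "n div 2"] by simp
  next
    case False
    then have "2 * (n div 2) + 1 = n" by presburger
    moreover have "k \<in> perms (freq_h (n div 2)) \<or> k \<in> perms (freq_j (n div 2))"
      using assms False by (simp add: Mplus_level_def)
    ultimately show ?thesis
      using perms_invariants [of k "freq_h (n div 2)"] perms_invariants [of k "freq_j (n div 2)"]
        freq_invariants(2,3,5,6) [of "n div 2"] by metis
  qed
  then show "rvec k \<bullet> rvec sigma = 3 * 2 ^ n" "rvec k \<bullet> rvec k = 3 * 4 ^ n + 2 * 3 ^ n"
    by auto
qed

lemma freq_level_invariants:
  assumes "k \<in> freq_level n"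
  shows "rvec k \<bullet> rvec sigma = 3 * 2 ^ n \<or> rvec k \<bullet> rvec sigma = - (3 * 2 ^ n)"
    and "(norm (rvec k))\<^sup>2 = 3 * 4 ^ n + 2 * 3 ^ n"
  using assms Mplus_level_invariants [of k n] Mplus_level_invariants [of "- k" n]
  by (auto simp: freq_level_def power2_norm_eq_inner)

lemma Mfreq_eq_freq_level: "Mfreq = (\<Union>n. freq_level n)"
  by (auto simp: Mfreq_def freq_level_def Mplus_def)

lemma uminus_freq_level: "k \<in> freq_level n \<Longrightarrow> - k \<in> freq_level n"
  by (auto simp: freq_level_def)

lemma uminus_Mfreq_iff [simp]: "- k \<in> Mfreq \<longleftrightarrow> k \<in> Mfreq"
  using uminus_freq_level [of k] uminus_freq_level [of "- k"] by (auto simp: Mfreq_eq_freq_level)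

lemma freq_level_disjoint:
  assumes "k \<in> freq_level n" "k \<in> freq_level m" shows "n = m"
proof -
  have "\<bar>3 * 2 ^ n :: real\<bar> = \<bar>3 * 2 ^ m\<bar>"
    using freq_level_invariants(1) [OF assms(1)] freq_level_invariants(1) [OF assms(2)] by linarith
  then show ?thesis by simp
qed

text \<open>27 = 3^3 counts all self-maps of the index set instead of the six bijections; what
  matters is that the bound does not depend on \<open>v\<close>.\<close>

lemma perms_finite_card: "finite (perms v)" "card (perms v) \<le> 27"
proof -
  have e: "perms v = (\<lambda>p. \<chi> i. v $ p i) ` {p. bij p}"
    by (auto simp: perms_def)
  have f: "finite (UNIV :: (3 \<Rightarrow> 3) set)" by simp
  have "card (UNIV :: (3 \<Rightarrow> 3) set) = 27"
    using card_fun [where 'a=3 and 'b=3] by simp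
  moreover have "card {p :: 3 \<Rightarrow> 3. bij p} \<le> card (UNIV :: (3 \<Rightarrow> 3) set)"
    by (intro card_mono f) auto
  ultimately have "card {p :: 3 \<Rightarrow> 3. bij p} \<le> 27" by simp
  moreover have fin: "finite {p :: 3 \<Rightarrow> 3. bij p}" by (rule finite_subset [OF subset_UNIV f])
  ultimately show "finite (perms v)" "card (perms v) \<le> 27"
    unfolding e using card_image_le [OF fin, of "\<lambda>p. \<chi> i. v $ p i"] by auto
qed

text \<open>Two signs and at most two permutation orbits per sign give 108 = 2 * 2 * 27.\<close>

lemma freq_level_finite_card: "finite (freq_level n)" "card (freq_level n) \<le> 108"
proof -
  have p: "finite (Mplus_level n)" "card (Mplus_level n) \<le> 54"
    using perms_finite_card[of "freq_k (n div 2)"] perms_finite_card[of "freq_h (n div 2)"]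
      perms_finite_card[of "freq_j (n div 2)"]
      card_Un_le [of "perms (freq_h (n div 2))" "perms (freq_j (n div 2))"]
    unfolding Mplus_level_def by auto
  then show "finite (freq_level n)" by (simp add: freq_level_def)
  have "card (freq_level n) \<le> card (Mplus_level n) + card (uminus ` Mplus_level n)"
    unfolding freq_level_def by (rule card_Un_le)
  also have "card (uminus ` Mplus_level n) \<le> card (Mplus_level n)"
    using p(1) by (rule card_image_le)
  finally show "card (freq_level n) \<le> 108" using p(2) by simp
qed

lemma zero_notin_Mfreq [simp]: "0 \<notin> Mfreq"
proof
  assume "0 \<in> Mfreq"
  then obtain n where "0 \<in> freq_level n" by (auto simp: Mfreq_eq_freq_level)
  then show False using freq_level_invariants(1) by fastforce
qed

section \<open>Weights on the frequency set\<close>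

lemma countable_Mfreq: "countable Mfreq"
  unfolding Mfreq_eq_freq_level using freq_level_finite_card by (simp add: countable_finite)

lemma wt_nonneg [simp]: "wt k \<ge> 0"
  by (simp add: wt_def)

lemma wt_uminus [simp]: "wt (- k) = wt k"
  by (simp add: wt_def)

lemma wt_ge_power2:
  assumes "k \<in> freq_level n" shows "2 ^ n \<le> wt k"
proof -
  have "(2 ^ n)\<^sup>2 = (4::real) ^ n"
    by (simp add: power2_eq_square flip: power_mult_distrib)
  also have "\<dots> \<le> 3 * 4 ^ n + 2 * 3 ^ n"
    by (smt (verit) zero_le_power)
  finally have "(2 ^ n)\<^sup>2 \<le> (norm (rvec k))\<^sup>2"
    using freq_level_invariants(2) [OF assms] by simp
  then have "2 ^ n \<le> norm (rvec k)"
    by (rule power2_le_imp_le) simp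
  also have "\<dots> \<le> (2 * pi) * norm (rvec k)"
    using mult_right_mono [of 1 "2 * pi" "norm (rvec k)"] pi_gt3 by simp
  finally show ?thesis by (simp add: wt_def)
qed

lemma wt_ge_1: "k \<in> Mfreq \<Longrightarrow> 1 \<le> wt k"
  using wt_ge_power2 [of k] order_trans [OF one_le_power [of "2::real"], of _ "wt k"]
  by (auto simp: Mfreq_eq_freq_level)

text \<open>\<open>crit_exp\<close> is the exponent for which 2 powr \<open>crit_exp\<close> is sqrt
  3: it translates the growth 2^n of the frequencies into the growth sqrt 3^n of the interaction
  coefficients.\<close>

lemma sqrt3_power_le_wt:
  assumes "k \<in> freq_level n" shows "sqrt 3 ^ n \<le> wt k powr crit_exp"
proof -
  have "sqrt 3 ^ n = (2 ^ n) powr crit_exp"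
    by (simp add: crit_exp_def powr_def ln_realpow ln_sqrt exp_of_nat_mult [symmetric] flip: powr_realpow)
  also have "\<dots> \<le> wt k powr crit_exp"
    by (intro powr_mono2 wt_ge_power2 assms) (auto simp: crit_exp_def)
  finally show ?thesis .
qed

text \<open>If the exponents a and b differed, division by the smaller power would leave an odd
  number on the left and an even one on the right. The parity argument is carried out in the
  naturals.\<close>

lemma power2_sum_eq_power2:
  assumes "(2::real) ^ a + 2 ^ b = 2 ^ c"
  shows "a = b \<and> c = a + 1"
proof -
  have main: "a = b" if "a \<le> b" and e: "(2::nat) ^ a + 2 ^ b = 2 ^ c" for a b
  proof (rule ccontr)
    assume "a \<noteq> b"
    then have "a < b" using that(1) by simp
    then obtain d where d: "b = a + Suc d" by (auto dest: less_imp_Suc_add)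
    have "(2::nat) ^ a < 2 ^ c" unfolding e [symmetric] by simp
    then have "a < c" by simp
    then obtain f where f: "c = a + Suc f" by (auto dest: less_imp_Suc_add)
    have "(2::nat) ^ a * (1 + 2 * 2 ^ d) = 2 ^ a * (2 * 2 ^ f)"
      using e unfolding d f by (simp add: power_add algebra_simps)
    then have "1 + 2 * 2 ^ d = 2 * (2::nat) ^ f"
      by (subst (asm) mult_cancel1) simp
    then show False by presburger
  qed
  have n: "(2::nat) ^ a + 2 ^ b = 2 ^ c"
  proof -
    have "real (2 ^ a + 2 ^ b) = real (2 ^ c)" using assms by simp
    then show ?thesis by (simp only: of_nat_eq_iff)
  qed
  have ab: "a = b"
    using main [of a b] main [of b a] n by (cases "a \<le> b") (auto simp: add.commute)
  then have "(2::nat) ^ Suc a = 2 ^ c" using n by simp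
  then have "c = Suc a" by (subst (asm) power_inject_exp) auto
  with ab show ?thesis by simp
qed

text \<open>Each inner product with sigma is 3 or -3 times a power of two. In k = l + (k - l) the
  signs leave three ways to balance, and the alternatives name the frequency that sits one level
  above the other two.\<close>

lemma triad_levels:
  assumes "k \<in> freq_level n" "l \<in> freq_level p" "k - l \<in> freq_level q"
  shows "(n = p + 1 \<and> q = p) \<or> (p = n + 1 \<and> q = n) \<or> (q = n + 1 \<and> p = n)"
proof -
  have "rvec k \<bullet> rvec sigma = rvec l \<bullet> rvec sigma + rvec (k - l) \<bullet> rvec sigma"
    by (simp add: inner_diff_left)
  then have "(2::real) ^ p + 2 ^ q = 2 ^ n \<or> (2::real) ^ n + 2 ^ q = 2 ^ p \<or> (2::real) ^ n + 2 ^ p = 2 ^ q"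
    using freq_level_invariants(1) [OF assms(1)] freq_level_invariants(1) [OF assms(2)]
      freq_level_invariants(1) [OF assms(3)] zero_less_power [of "2::real" n]
      zero_less_power [of "2::real" p] zero_less_power [of "2::real" q] by argo
  then show ?thesis
    using power2_sum_eq_power2 [of p q n] power2_sum_eq_power2 [of n q p]
      power2_sum_eq_power2 [of n p q] by auto
qed

text \<open>For \<open>n = 0\<close> the truncated \<open>n - 1\<close> merely repeats level
  0.\<close>

lemma partners_subset_levels:
  assumes "k \<in> freq_level n" shows "partners k \<subseteq> freq_level (n - 1) \<union> freq_level n \<union> freq_level (n + 1)"
proof
  fix l assume "l \<in> partners k"
  then obtain p q where l: "l \<in> freq_level p" "k - l \<in> freq_level q"
    by (auto simp: partners_def Mfreq_eq_freq_level)
  have "p = n - 1 \<or> p = n \<or> p = n + 1" using triad_levels [OF assms l] by auto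
  then show "l \<in> freq_level (n - 1) \<union> freq_level n \<union> freq_level (n + 1)"
    using l(1) by blast
qed

text \<open>324 = 3 * 108, from three levels.\<close>

lemma partners_finite_card:
  assumes "k \<in> Mfreq" shows "finite (partners k)" "card (partners k) \<le> 324"
proof -
  obtain n where n: "k \<in> freq_level n" using assms by (auto simp: Mfreq_eq_freq_level)
  have f: "finite (freq_level (n - 1) \<union> freq_level n \<union> freq_level (n + 1))"
    by (simp add: freq_level_finite_card)
  then show "finite (partners k)" using partners_subset_levels [OF n] finite_subset by blast
  have "card (partners k) \<le> card (freq_level (n - 1) \<union> freq_level n \<union> freq_level (n + 1))"
    by (rule card_mono [OF f partners_subset_levels [OF n]])
  also have "\<dots> \<le> card (freq_level (n - 1)) + card (freq_level n) + card (freq_level (n + 1))"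
    by (meson add_mono card_Un_le le_refl order_trans)
  finally show "card (partners k) \<le> 324"
    using freq_level_finite_card(2) [of "n - 1"] freq_level_finite_card(2) [of n] freq_level_finite_card(2) [of "n + 1"]
    by linarith
qed

lemma partners_swap: "l \<in> partners k \<Longrightarrow> k - l \<in> partners k"
  by (simp add: partners_def)

lemma partners_uminus: "l \<in> partners k \<Longrightarrow> - l \<in> partners (- k)"
  by (simp add: partners_def) (metis uminus_Mfreq_iff minus_diff_eq minus_diff_commute diff_minus_eq_add uminus_add_conv_diff)

lemma partners_subset_Mfreq: "l \<in> partners k \<Longrightarrow> l \<in> Mfreq"
  by (simp add: partners_def)

text \<open>A partner is at most one level below k, and one level changes the squared length by a
  factor of at most 4. This lower bound for \<open>wt l\<close>, valid also for k - l by
  \<open>partners_swap\<close>, turns weights at the partners into a weight at k.\<close>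

lemma wt_partners_ge:
  assumes "k \<in> Mfreq" "l \<in> partners k" shows "wt k \<le> 2 * wt l"
proof -
  obtain n p q where l: "k \<in> freq_level n" "l \<in> freq_level p" "k - l \<in> freq_level q"
    using assms by (auto simp: partners_def Mfreq_eq_freq_level)
  have "n \<le> p + 1" using triad_levels [OF l] by auto
  then have "(4::real) ^ n \<le> 4 ^ (p + 1)" "(3::real) ^ n \<le> 3 ^ (p + 1)"
    by (simp_all add: power_increasing del: power_Suc)
  moreover have "3 * x + 2 * y \<le> 4 * (3 * a + 2 * b)" if "x \<le> a * 4" "y \<le> b * 3" "0 \<le> b" for x y a b :: real
    using that by (simp add: algebra_simps)
  from this [of "4 ^ n" "4 ^ p" "3 ^ n" "3 ^ p"]
  have "3 * (4::real) ^ n + 2 * 3 ^ n \<le> 4 * (3 * 4 ^ p + 2 * 3 ^ p)"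
    using calculation by (simp add: power_add)
  then have "(norm (rvec k))\<^sup>2 \<le> 4 * (norm (rvec l))\<^sup>2"
    unfolding freq_level_invariants(2) [OF l(1)] freq_level_invariants(2) [OF l(2)] .
  then have "norm (rvec k) \<le> 2 * norm (rvec l)"
    by (intro power2_le_imp_le [of "norm (rvec k)"]) (auto simp: power_mult_distrib)
  then show ?thesis by (simp add: wt_def)
qed

section \<open>Directions and the size of the interaction coefficients\<close>

lemma perp_sigma_uminus [simp]: "perp_sigma (- k) = perp_sigma k"
  by (simp add: perp_sigma_def)

lemma vdir_uminus [simp]: "vdir (- k) = vdir k"
  by (simp add: vdir_def)

text \<open>By Pythagoras the squared length is 3 minus the square of the component of sigma along
  k. The terms 9 * 4^n cancel and only the contribution of 3^n survives, so k turns parallel to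
  sigma as the level grows.\<close>

lemma perp_sigma_inner:
  assumes "k \<in> freq_level n"
  shows "perp_sigma k \<bullet> rvec k = 0" "perp_sigma k \<bullet> rvec sigma = (norm (perp_sigma k))\<^sup>2"
    "(norm (perp_sigma k))\<^sup>2 = 6 * 3 ^ n / (3 * 4 ^ n + 2 * 3 ^ n)"
proof -
  have k: "(norm (rvec k))\<^sup>2 = 3 * 4 ^ n + 2 * 3 ^ n" by (rule freq_level_invariants [OF assms])
  have pos: "(3 * 4 ^ n + 2 * 3 ^ n :: real) > 0" by (simp add: add_pos_pos)
  then have ne: "(norm (rvec k))\<^sup>2 \<noteq> 0" using k by simp
  show 1: "perp_sigma k \<bullet> rvec k = 0"
    using ne by (simp add: perp_sigma_def inner_diff_left inner_commute [of "rvec k" "rvec sigma"]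
        flip: power2_norm_eq_inner)
  have "(norm (perp_sigma k))\<^sup>2 = perp_sigma k \<bullet> (rvec sigma - ((rvec k \<bullet> rvec sigma) / (norm (rvec k))\<^sup>2) *\<^sub>R rvec k)"
    by (simp add: power2_norm_eq_inner perp_sigma_def)
  also have "\<dots> = perp_sigma k \<bullet> rvec sigma"
    by (simp add: inner_diff_right 1)
  finally show 2: "perp_sigma k \<bullet> rvec sigma = (norm (perp_sigma k))\<^sup>2" by simp
  have "perp_sigma k \<bullet> rvec sigma = 3 - (rvec k \<bullet> rvec sigma)\<^sup>2 / (norm (rvec k))\<^sup>2"
    by (simp add: perp_sigma_def inner_diff_left rvec_sigma_inner_self power2_eq_square)
  also have "(rvec k \<bullet> rvec sigma)\<^sup>2 = 9 * 4 ^ n"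
    using freq_level_invariants(1) [OF assms]
    by (auto simp: power2_eq_square simp flip: power_mult_distrib)
  also have "3 - 9 * 4 ^ n / (norm (rvec k))\<^sup>2 = 6 * 3 ^ n / (3 * 4 ^ n + 2 * 3 ^ n)"
    unfolding k using pos by (simp add: field_simps)
  finally show "(norm (perp_sigma k))\<^sup>2 = 6 * 3 ^ n / (3 * 4 ^ n + 2 * 3 ^ n)" using 2 by simp
qed

lemma perp_sigma_nonzero: "k \<in> Mfreq \<Longrightarrow> perp_sigma k \<noteq> 0"
proof -
  assume "k \<in> Mfreq"
  then obtain n where "k \<in> freq_level n" by (auto simp: Mfreq_eq_freq_level)
  then have "(norm (perp_sigma k))\<^sup>2 = 6 * 3 ^ n / (3 * 4 ^ n + 2 * 3 ^ n)"
    by (rule perp_sigma_inner)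
  also have "\<dots> > 0" by (simp add: add_pos_pos)
  finally show ?thesis by auto
qed

lemma norm_vdir: "k \<in> Mfreq \<Longrightarrow> norm (vdir k) = 1"
  using perp_sigma_nonzero by (simp add: vdir_def)

lemma vdir_orthogonal: "k \<in> Mfreq \<Longrightarrow> vdir k \<bullet> rvec k = 0"
  using perp_sigma_inner(1) by (auto simp: vdir_def Mfreq_eq_freq_level)

text \<open>The inner product is the length of \<open>perp_sigma k\<close>, of order (sqrt 3 / 2)^n:
  small enough to reduce the component 2^n of a frequency along sigma to sqrt 3^n.\<close>

lemma vdir_inner_sigma:
  assumes "k \<in> freq_level n"
  shows "\<bar>vdir k \<bullet> rvec sigma\<bar> \<le> sqrt 2 * (sqrt 3 / 2) ^ n"
proof -
  have "k \<in> Mfreq" using assms by (auto simp: Mfreq_eq_freq_level)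
  then have "\<bar>vdir k \<bullet> rvec sigma\<bar> = norm (perp_sigma k)"
    using perp_sigma_nonzero [of k]
    by (simp add: vdir_def perp_sigma_inner(2) [OF assms] power2_eq_square)
  also have "\<dots> \<le> sqrt 2 * (sqrt 3 / 2) ^ n"
  proof (rule power2_le_imp_le)
    have "(norm (perp_sigma k))\<^sup>2 = 6 * 3 ^ n / (3 * 4 ^ n + 2 * 3 ^ n)"
      by (rule perp_sigma_inner [OF assms])
    also have "\<dots> \<le> 6 * 3 ^ n / (3 * 4 ^ n)"
      by (intro divide_left_mono) (auto simp: add_pos_pos)
    also have "\<dots> = (sqrt 2 * (sqrt 3 / 2) ^ n)\<^sup>2"
    proof -
      have "((sqrt 3 / 2) ^ n)\<^sup>2 = ((sqrt 3 / 2)\<^sup>2) ^ n"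
        by (simp only: power_mult [symmetric] mult.commute)
      also have "(sqrt 3 / 2)\<^sup>2 = 3 / (4::real)"
        by (simp add: power_divide)
      finally show ?thesis by (simp add: power_mult_distrib power_divide)
    qed
    finally show "(norm (perp_sigma k))\<^sup>2 \<le> (sqrt 2 * (sqrt 3 / 2) ^ n)\<^sup>2" .
  qed simp
  finally show ?thesis .
qed

text \<open>Split m into c * sigma with |c| = 2^q and an orthogonal remainder d of length sqrt 2 *
  sqrt 3^q. The first part is damped by \<open>vdir_inner_sigma\<close> to order sqrt 3^p because q
  \<le> p + 1; the second is small by itself.\<close>

lemma vdir_inner_rvec:
  assumes "l \<in> freq_level p" "m \<in> freq_level q" "p \<le> n + 1" "q \<le> n + 1" "q \<le> p + 1"
  shows "\<bar>vdir l \<bullet> rvec m\<bar> \<le> 8 * sqrt 3 ^ n"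
proof -
  have l: "l \<in> Mfreq" using assms by (auto simp: Mfreq_eq_freq_level)
  define c where "c = (rvec m \<bullet> rvec sigma) / 3"
  define d where "d = rvec m - c *\<^sub>R rvec sigma"
  have c: "\<bar>c\<bar> = 2 ^ q"
    using freq_level_invariants(1) [OF assms(2)] by (auto simp: c_def)
  have "(norm d)\<^sup>2 = (norm (rvec m))\<^sup>2 - 3 * c\<^sup>2"
    unfolding power2_norm_eq_inner d_def
    by (simp add: inner_diff_left inner_diff_right rvec_sigma_inner_self c_def inner_commute power2_eq_square)
  also have "c\<^sup>2 = 4 ^ q"
    unfolding power2_abs [of c, symmetric] c by (simp add: power2_eq_square flip: power_mult_distrib)
  finally have "(norm d)\<^sup>2 = 2 * 3 ^ q" by (simp add: freq_level_invariants(2) [OF assms(2)])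
  then have "norm d = sqrt (2 * 3 ^ q)" by (metis norm_ge_zero real_sqrt_abs abs_of_nonneg)
  then have d: "norm d = sqrt 2 * sqrt 3 ^ q" by (simp add: real_sqrt_mult real_sqrt_power)
  have "vdir l \<bullet> rvec m = c * (vdir l \<bullet> rvec sigma) + vdir l \<bullet> d"
    by (simp add: d_def inner_diff_right)
  then have "\<bar>vdir l \<bullet> rvec m\<bar> \<le> \<bar>c\<bar> * \<bar>vdir l \<bullet> rvec sigma\<bar> + \<bar>vdir l \<bullet> d\<bar>"
    by (metis abs_mult abs_triangle_ineq)
  also have "\<dots> \<le> 2 ^ q * (sqrt 2 * (sqrt 3 / 2) ^ p) + norm d"
    using vdir_inner_sigma [OF assms(1)] Cauchy_Schwarz_ineq2 [of "vdir l" d] norm_vdir [OF l]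
    by (intro add_mono mult_mono) (auto simp: c)
  also have "\<dots> \<le> 2 ^ (p + 1) * (sqrt 2 * (sqrt 3 / 2) ^ p) + sqrt 2 * sqrt 3 ^ (n + 1)"
    unfolding d using assms
    by (intro add_mono mult_right_mono mult_left_mono power_increasing) auto
  also have "\<dots> = sqrt 2 * (2 * sqrt 3 ^ p) + sqrt 2 * sqrt 3 ^ (n + 1)"
    by (simp add: power_divide)
  also have "\<dots> \<le> sqrt 2 * (2 * sqrt 3 ^ (n + 1)) + sqrt 2 * sqrt 3 ^ (n + 1)"
    using assms by (intro add_mono mult_left_mono power_increasing) auto
  also have "\<dots> = (3 * sqrt 6) * sqrt 3 ^ n"
    by (simp add: algebra_simps) (simp flip: real_sqrt_mult)
  \<comment> \<open>The constant 8 rounds up 3 * sqrt 6, from 6 \<le> (8 / 3)^2.\<close>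
  also have "3 * sqrt 6 \<le> 3 * (8 / 3)"
    by (intro mult_left_mono real_le_lsqrt) (auto simp: power2_eq_square)
  finally show ?thesis by simp
qed

text \<open>A derivative costs only \<open>wt k powr crit_exp\<close> and not \<open>wt k\<close>:
  this estimate fixes the critical regularity. Because \<open>vdir l\<close> is orthogonal to l, the
  frequency k may be replaced by k - l in the advecting factor; 16 * pi is 2 * pi times the constant
  of \<open>vdir_inner_rvec\<close>.\<close>

lemma norm_triad_le:
  assumes "k \<in> Mfreq" "l \<in> partners k"
  shows "norm (triad k l) \<le> 16 * pi * wt k powr crit_exp"
proof -
  obtain n p q where l: "k \<in> freq_level n" "l \<in> freq_level p" "k - l \<in> freq_level q"
    using assms by (auto simp: partners_def Mfreq_eq_freq_level)
  have M: "l \<in> Mfreq" "k - l \<in> Mfreq" using assms by (auto simp: partners_def)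
  have "vdir l \<bullet> rvec k = vdir l \<bullet> rvec (k - l)"
    using vdir_orthogonal [OF M(1)] by (simp add: inner_diff_right)
  then have 1: "\<bar>vdir l \<bullet> rvec k\<bar> \<le> 8 * sqrt 3 ^ n"
    using vdir_inner_rvec [OF l(2,3), of n] triad_levels [OF l] by auto
  have 2: "\<bar>vdir (k - l) \<bullet> vdir k\<bar> \<le> 1"
    using Cauchy_Schwarz_ineq2 [of "vdir (k - l)" "vdir k"] by (simp add: norm_vdir M assms)
  have "norm (triad k l) = 2 * pi * (\<bar>vdir l \<bullet> rvec k\<bar> * \<bar>vdir (k - l) \<bullet> vdir k\<bar>)"
    by (simp add: triad_def norm_mult)
  also have "\<dots> \<le> 2 * pi * (8 * sqrt 3 ^ n * 1)"
    using 1 2 by (intro mult_left_mono mult_mono) auto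
  also have "\<dots> \<le> 2 * pi * (8 * wt k powr crit_exp * 1)"
    using sqrt3_power_le_wt [OF l(1)] by (intro mult_left_mono mult_right_mono) auto
  finally show ?thesis by simp
qed

text \<open>Level n carries at most 108 frequencies of weight at least 2^n, so a geometric series
  majorizes the sum for every positive \<delta>. Hence any gain of decay, however small, upgrades a
  bound on the coefficients to summability.\<close>

lemma summable_on_wt_powr:
  assumes "\<delta> > 0" shows "(\<lambda>k. wt k powr (- \<delta>)) summable_on Mfreq"
proof (rule nonneg_bdd_above_summable_on)
  define r :: real where "r = 2 powr (- \<delta>)"
  have r: "0 < r" "r < 1" using assms by (auto simp: r_def powr_less_one)
  have lev: "wt k powr (- \<delta>) \<le> r ^ n" if "k \<in> freq_level n" for k n
  proof -
    have "wt k powr (- \<delta>) \<le> (2 ^ n) powr (- \<delta>)"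
      using wt_ge_power2 [OF that] assms by (intro powr_mono2') auto
    also have "\<dots> = r ^ n"
      unfolding r_def by (simp add: powr_powr mult.commute flip: powr_realpow)
    finally show ?thesis .
  qed
  show "bdd_above (sum (\<lambda>k. wt k powr (- \<delta>)) ` {F. F \<subseteq> Mfreq \<and> finite F})"
  proof (rule bdd_aboveI2)
    fix F assume "F \<in> {F. F \<subseteq> Mfreq \<and> finite F}"
    then have F: "F \<subseteq> Mfreq" "finite F" by auto
    then have "\<forall>k\<in>F. \<exists>n. k \<in> freq_level n" by (auto simp: Mfreq_eq_freq_level)
    then obtain L where L: "\<And>k. k \<in> F \<Longrightarrow> k \<in> freq_level (L k)" by metis
    obtain N where N: "\<And>k. k \<in> F \<Longrightarrow> L k < N"
      using F(2) finite_nat_set_iff_bounded [of "L ` F"] by auto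
    have "(\<Sum>k\<in>F. wt k powr (- \<delta>)) \<le> (\<Sum>k\<in>(\<Union>n<N. freq_level n). wt k powr (- \<delta>))"
      using L N by (intro sum_mono2) (auto simp: freq_level_finite_card)
    also have "\<dots> = (\<Sum>n<N. \<Sum>k\<in>freq_level n. wt k powr (- \<delta>))"
      using freq_level_disjoint by (intro sum.UNION_disjoint) (auto simp: freq_level_finite_card)
    also have "\<dots> \<le> (\<Sum>n<N. \<Sum>k\<in>freq_level n. r ^ n)"
      using lev by (intro sum_mono) auto
    also have "\<dots> \<le> (\<Sum>n<N. 108 * r ^ n)"
      using freq_level_finite_card(2) r by (intro sum_mono) (auto intro!: mult_right_mono)
    also have "\<dots> = 108 * (\<Sum>n<N. r ^ n)" by (simp add: sum_distrib_left)
    also have "\<dots> \<le> 108 * (\<Sum>n. r ^ n)"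
      using r by (intro mult_left_mono sum_le_suminf summable_geometric) auto
    finally show "(\<Sum>k\<in>F. wt k powr (- \<delta>)) \<le> 108 * (\<Sum>n. r ^ n)" .
  qed
qed simp

subsection \<open>The coefficient system\<close>

text \<open>The quadratic term as a bilinear form in the advecting family \<open>c\<close> and the
  advected family \<open>d\<close>. Keeping the arguments apart serves differences of solutions and
  derivatives in time; values off \<open>Mfreq\<close> never enter.\<close>

definition triad_form :: "(int^3 \<Rightarrow> complex) \<Rightarrow> (int^3 \<Rightarrow> complex) \<Rightarrow> int^3 \<Rightarrow> complex" where
  "triad_form c d k = (\<Sum>l\<in>partners k. triad k l * c l * d (k - l))"

lemma triad_form_cong:
  assumes "\<And>l. l \<in> Mfreq \<Longrightarrow> c l = c' l" "\<And>l. l \<in> Mfreq \<Longrightarrow> d l = d' l"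
  shows "triad_form c d k = triad_form c' d' k"
  unfolding triad_form_def using assms by (intro sum.cong) (auto simp: partners_def)

lemma triad_form_diff: "triad_form c c k - triad_form d d k = triad_form (\<lambda>l. c l - d l) c k + triad_form d (\<lambda>l. c l - d l) k"
  unfolding triad_form_def by (simp add: algebra_simps flip: sum_subtractf sum.distrib)

lemma continuous_on_triad_form [continuous_intros]:
  assumes "k \<in> Mfreq" "\<And>l. l \<in> Mfreq \<Longrightarrow> continuous_on S (\<lambda>t. c t l)"
    "\<And>l. l \<in> Mfreq \<Longrightarrow> continuous_on S (\<lambda>t. d t l)"
  shows "continuous_on S (\<lambda>t. triad_form (c t) (d t) k)"
  unfolding triad_form_def using assms by (intro continuous_intros) (auto simp: partners_def)

text \<open>Transfers a weighted bound from a partner l to k; the loss 2 powr r comes from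
  \<open>wt_partners_ge\<close>.\<close>

lemma powr_partners_le:
  assumes "k \<in> Mfreq" "l \<in> partners k" "0 \<le> r" "wt l powr r * x \<le> R" "0 \<le> x"
  shows "x \<le> 2 powr r * wt k powr (- r) * R"
proof -
  have pos: "0 < wt l" "0 < wt k"
    using assms partners_subset_Mfreq wt_ge_1 by (meson less_le_trans zero_less_one)+
  have R: "0 \<le> R" using assms(4,5) by (metis mult_nonneg_nonneg order_trans powr_ge_zero)
  have "wt l powr r * x \<le> R" by fact
  then have "x \<le> R * wt l powr (- r)"
    using pos by (simp add: powr_minus field_simps)
  also have "\<dots> \<le> R * (wt k / 2) powr (- r)"
    using wt_partners_ge [OF assms(1,2)] pos assms(3) R by (intro mult_left_mono powr_mono2') auto
  also have "(wt k / 2) powr (- r) = 2 powr r * wt k powr (- r)"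
    using pos by (simp add: powr_divide powr_minus field_simps)
  finally show ?thesis by (simp add: mult_ac)
qed

text \<open>At most 324 terms, each with a coefficient of size 16 * pi *
  \<open>wt k powr crit_exp\<close>, give 5184 = 324 * 16. The powers of \<open>wt k\<close> add up,
  since all weights can be taken at k.\<close>

lemma norm_triad_form_le:
  assumes k: "k \<in> Mfreq" and r: "0 \<le> r" "0 \<le> s"
    and c: "\<And>l. l \<in> Mfreq \<Longrightarrow> wt l powr r * norm (c l) \<le> R"
    and d: "\<And>l. l \<in> Mfreq \<Longrightarrow> wt l powr s * norm (d l) \<le> S"
  shows "norm (triad_form c d k) \<le> 5184 * pi * 2 powr (r + s) * R * S * wt k powr (crit_exp - r - s)"
proof -
  have R: "0 \<le> R" "0 \<le> S"
    using c [OF k] d [OF k] by (meson mult_nonneg_nonneg norm_ge_zero order_trans powr_ge_zero)+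
  have w: "0 < wt k" using wt_ge_1 [OF k] by simp
  have "norm (triad_form c d k) \<le> (\<Sum>l\<in>partners k. norm (triad k l * c l * d (k - l)))"
    unfolding triad_form_def by (rule norm_sum)
  also have "\<dots> \<le> of_nat (card (partners k)) * (16 * pi * wt k powr crit_exp * (2 powr r * wt k powr (- r) * R) * (2 powr s * wt k powr (- s) * S))"
  proof (rule sum_bounded_above)
    fix l assume l: "l \<in> partners k"
    have "norm (c l) \<le> 2 powr r * wt k powr (- r) * R"
      using c partners_subset_Mfreq l by (intro powr_partners_le [OF k l]) (auto simp: r)
    moreover have "norm (d (k - l)) \<le> 2 powr s * wt k powr (- s) * S"
      using d [OF partners_subset_Mfreq [OF partners_swap [OF l]]] by (intro powr_partners_le [OF k partners_swap [OF l]]) (auto simp: r)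
    ultimately show "norm (triad k l * c l * d (k - l)) \<le> 16 * pi * wt k powr crit_exp * (2 powr r * wt k powr (- r) * R) * (2 powr s * wt k powr (- s) * S)"
      unfolding norm_mult using norm_triad_le [OF k l] R
      by (intro mult_mono) auto
  qed
  also have "\<dots> \<le> 324 * (16 * pi * wt k powr crit_exp * (2 powr r * wt k powr (- r) * R) * (2 powr s * wt k powr (- s) * S))"
    using partners_finite_card(2) [OF k] R by (intro mult_right_mono) auto
  also have "\<dots> = 5184 * pi * 2 powr (r + s) * R * S * wt k powr (crit_exp - r - s)"
    using w by (simp add: powr_add powr_diff powr_minus field_simps)
  finally show ?thesis .
qed

text \<open>Interpolates between the bounds x and 1 for the left side. With x =
  \<open>mu k * t\<close> it trades part of the smoothing 1 / \<open>mu k\<close> of the integrated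
  kernel for a power of t.\<close>

lemma one_minus_exp_le_powr:
  fixes x :: real
  assumes "0 \<le> x" "0 < r" "r \<le> 1" shows "1 - exp (- x) \<le> x powr r"
proof (cases "x \<le> 1")
  case True
  have "1 - exp (- x) \<le> x" using exp_ge_add_one_self [of "- x"] by linarith
  also have "x \<le> x powr r"
    using True assms powr_mono' [of r 1 x] by (cases "x = 0") auto
  finally show ?thesis .
next
  case False
  then have "1 \<le> x powr r" using assms by (simp add: ge_one_powr_ge_zero)
  then show ?thesis using exp_gt_zero [of "- x"] by linarith
qed

lemma exp_kernel_has_integral:
  fixes \<mu> t :: real assumes "\<mu> > 0" "0 \<le> t"
  shows "((\<lambda>\<tau>. exp (- \<mu> * (t - \<tau>))) has_integral (1 - exp (- \<mu> * t)) / \<mu>) {0..t}"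
proof -
  have "((\<lambda>\<tau>. exp (- \<mu> * (t - \<tau>))) has_integral exp (- \<mu> * (t - t)) / \<mu> - exp (- \<mu> * (t - 0)) / \<mu>) {0..t}"
    using assms by (intro fundamental_theorem_of_calculus)
      (auto intro!: derivative_eq_intros simp flip: has_real_derivative_iff_has_vector_derivative)
  then show ?thesis by (simp add: diff_divide_distrib)
qed

lemma exp_kernel_integral_le:
  fixes f :: "real \<Rightarrow> complex"
  assumes "\<mu> > 0" "0 \<le> t" "continuous_on {0..t} f" "\<And>\<tau>. \<tau> \<in> {0..t} \<Longrightarrow> norm (f \<tau>) \<le> F"
  shows "norm (integral {0..t} (\<lambda>\<tau>. exp (- \<mu> * (t - \<tau>)) *\<^sub>R f \<tau>)) \<le> F * ((1 - exp (- \<mu> * t)) / \<mu>)"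
proof -
  have 1: "((\<lambda>\<tau>. F * exp (- \<mu> * (t - \<tau>))) has_integral F * ((1 - exp (- \<mu> * t)) / \<mu>)) {0..t}"
    using exp_kernel_has_integral [OF assms(1,2)] by (rule has_integral_mult_right)
  have "norm (integral {0..t} (\<lambda>\<tau>. exp (- \<mu> * (t - \<tau>)) *\<^sub>R f \<tau>)) \<le> integral {0..t} (\<lambda>\<tau>. F * exp (- \<mu> * (t - \<tau>)))"
    using assms 1
    by (intro integral_norm_bound_integral integrable_continuous_interval continuous_intros)
      (auto simp: integrable_on_def mult.commute intro!: mult_left_mono)
  then show ?thesis unfolding integral_unique [OF 1] .
qed

lemma variation_of_constants:
  fixes y f :: "real \<Rightarrow> complex"
  assumes "0 \<le> t" and y: "\<And>\<tau>. \<tau> \<in> {0..t} \<Longrightarrow> (y has_vector_derivative (- \<mu> *\<^sub>R y \<tau> - f \<tau>)) (at \<tau> within {0..t})"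
  shows "((\<lambda>\<tau>. exp (- \<mu> * (t - \<tau>)) *\<^sub>R f \<tau>) has_integral (exp (- \<mu> * t) *\<^sub>R y 0 - y t)) {0..t}"
proof -
  have "((\<lambda>\<tau>. - (exp (- \<mu> * (t - \<tau>)) *\<^sub>R f \<tau>)) has_integral
      exp (- \<mu> * (t - t)) *\<^sub>R y t - exp (- \<mu> * (t - 0)) *\<^sub>R y 0) {0..t}"
  proof (rule fundamental_theorem_of_calculus [OF \<open>0 \<le> t\<close>])
    fix \<tau> assume "\<tau> \<in> {0..t}"
    then show "((\<lambda>\<tau>. exp (- \<mu> * (t - \<tau>)) *\<^sub>R y \<tau>) has_vector_derivative - (exp (- \<mu> * (t - \<tau>)) *\<^sub>R f \<tau>)) (at \<tau> within {0..t})"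
      by (auto intro!: derivative_eq_intros y simp: scaleR_conv_of_real algebra_simps)
  qed
  from has_integral_neg [OF this] show ?thesis by simp
qed

text \<open>Converse of \<open>variation_of_constants\<close>: together they make the mild and the
  differential formulation equivalent for each mode.\<close>

lemma duhamel_has_derivative:
  fixes f :: "real \<Rightarrow> complex"
  assumes "continuous_on {0..T} f" "t \<in> {0..T}"
  shows "((\<lambda>t. exp (- \<mu> * t) *\<^sub>R y0 - integral {0..t} (\<lambda>\<tau>. exp (- \<mu> * (t - \<tau>)) *\<^sub>R f \<tau>)) has_vector_derivative
     - \<mu> *\<^sub>R (exp (- \<mu> * t) *\<^sub>R y0 - integral {0..t} (\<lambda>\<tau>. exp (- \<mu> * (t - \<tau>)) *\<^sub>R f \<tau>)) - f t) (at t within {0..T})"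
proof -
  \<comment> \<open>Factoring out exp (- \<mu> * t) leaves t only in the upper limit, so that the
    product rule and the fundamental theorem apply.\<close>
  have eq: "integral {0..t} (\<lambda>\<tau>. exp (- \<mu> * (t - \<tau>)) *\<^sub>R f \<tau>) = exp (- \<mu> * t) *\<^sub>R integral {0..t} (\<lambda>\<tau>. exp (\<mu> * \<tau>) *\<^sub>R f \<tau>)" for t
    by (subst integral_cmul [symmetric]) (simp add: algebra_simps flip: exp_add)
  have "((\<lambda>t. exp (- \<mu> * t) *\<^sub>R y0 - exp (- \<mu> * t) *\<^sub>R integral {0..t} (\<lambda>\<tau>. exp (\<mu> * \<tau>) *\<^sub>R f \<tau>)) has_vector_derivative
     - \<mu> *\<^sub>R (exp (- \<mu> * t) *\<^sub>R y0 - exp (- \<mu> * t) *\<^sub>R integral {0..t} (\<lambda>\<tau>. exp (\<mu> * \<tau>) *\<^sub>R f \<tau>)) - f t) (at t within {0..T})"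
    using assms
    by (auto intro!: derivative_eq_intros integral_has_vector_derivative continuous_intros simp: algebra_simps scaleR_conv_of_real)
      (simp add: algebra_simps flip: exp_add of_real_mult exp_of_real)
  then show ?thesis unfolding eq .
qed

lemma crit_exp_bounds: "0 < crit_exp" "crit_exp \<le> 1"
proof -
  have "ln 3 \<le> ln (2 ^ 2 :: real)" by (subst ln_le_cancel_iff) auto
  also have "\<dots> = 2 * ln 2" by (subst ln_realpow) auto
  finally show "crit_exp \<le> 1" by (simp add: crit_exp_def)
  show "0 < crit_exp" by (simp add: crit_exp_def)
qed

text \<open>5184 * 4 * pi: the factor 2 powr (s + s) in \<open>norm_triad_form_le\<close> is at most
  4 because s \<le> \<open>crit_exp\<close> \<le> 1. The constant depends on neither s nor \<alpha>,
  which makes the constant of the critical case absolute.\<close>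

definition triad_const :: real where "triad_const = 20736 * pi"

lemma triad_const_pos: "triad_const > 0" by (simp add: triad_const_def)

text \<open>The upper bound on \<alpha> in the theorem is represented here by \<open>0 < s\<close>,
  which follows from it and \<open>crit_exp - 2 * \<alpha> < s\<close>.\<close>

locale hypodissipative =
  fixes \<nu> \<alpha> s :: real
  assumes nu: "\<nu> > 0" and alpha: "0 < \<alpha>" and s: "0 < s" "crit_exp - 2 * \<alpha> < s" "s \<le> crit_exp"
begin

definition mu :: "int^3 \<Rightarrow> real" where "mu k = \<nu> * wt k powr (2 * \<alpha>)"

abbreviation "\<rho> \<equiv> rho \<alpha> s"

text \<open>Every mode solves its equation classically, one-sided at time 0, and the weighted
  supremum is bounded on compact time intervals. This last clause is the a priori information behind
  uniqueness; continuity in the H^s norm is not asked for and is recovered later for data in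
  H^s.\<close>

definition coeff_sol :: "ereal \<Rightarrow> (int^3 \<Rightarrow> complex) \<Rightarrow> (real \<Rightarrow> int^3 \<Rightarrow> complex) \<Rightarrow> bool" where
  "coeff_sol T a0 a \<longleftrightarrow>
     (\<forall>k\<in>Mfreq. a 0 k = a0 k) \<and>
     (\<forall>k\<in>Mfreq. \<forall>t\<in>time_interval T.
        ((\<lambda>t. a t k) has_vector_derivative (- mu k *\<^sub>R a t k - triad_form (a t) (a t) k)) (at t within time_interval T)) \<and>
     (\<forall>t1\<in>time_interval T. \<exists>R. \<forall>t\<in>{0..t1}. \<forall>k\<in>Mfreq. wt k powr s * norm (a t k) \<le> R)"

section \<open>Power counting with the exponent \<rho>\<close>

lemma rho_bounds: "0 < \<rho>" "\<rho> \<le> 1"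
  using alpha s by (auto simp: rho_def field_simps)

text \<open>The exponent \<rho> is the fraction of the dissipation that remains after the regularity
  deficit \<open>crit_exp - s\<close> has been paid; it equals 1 for s =
  \<open>crit_exp\<close>.\<close>

lemma rho_exponent: "2 * \<alpha> * (1 - \<rho>) = crit_exp - s"
  using alpha by (simp add: rho_def)

lemma mu_pos: "k \<in> Mfreq \<Longrightarrow> mu k > 0"
  using nu wt_ge_1 [of k] by (simp add: mu_def)

lemma mu_powr:
  assumes "k \<in> Mfreq"
  shows "mu k powr (\<rho> - 1) = \<nu> powr (\<rho> - 1) * wt k powr (s - crit_exp)"
proof -
  have "2 * \<alpha> * (\<rho> - 1) = s - crit_exp" using rho_exponent by (simp add: algebra_simps)
  then show ?thesis using nu wt_ge_1 [OF assms] by (simp add: mu_def powr_mult powr_powr)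
qed

lemma norm_triad_form_le_s:
  assumes k: "k \<in> Mfreq"
    and c: "\<And>l. l \<in> Mfreq \<Longrightarrow> wt l powr s * norm (c l) \<le> R"
    and d: "\<And>l. l \<in> Mfreq \<Longrightarrow> wt l powr s * norm (d l) \<le> S"
  shows "norm (triad_form c d k) \<le> triad_const * R * S * wt k powr (crit_exp - s - s)"
proof -
  have R: "0 \<le> R" "0 \<le> S"
    using c [OF k] d [OF k] by (meson mult_nonneg_nonneg norm_ge_zero order_trans powr_ge_zero)+
  have "2 powr (s + s) \<le> 2 powr (2::real)"
    using s crit_exp_bounds by (intro powr_mono) auto
  then have 2: "2 powr (s + s) \<le> (4::real)" by simp
  have "norm (triad_form c d k) \<le> 5184 * pi * 2 powr (s + s) * R * S * wt k powr (crit_exp - s - s)"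
    using s by (intro norm_triad_form_le c d k) auto
  also have "\<dots> \<le> 5184 * pi * 4 * R * S * wt k powr (crit_exp - s - s)"
    using 2 R by (intro mult_right_mono mult_left_mono) auto
  finally show ?thesis by (simp add: triad_const_def)
qed

text \<open>The forcing has order \<open>crit_exp - s - s\<close> in \<open>wt k\<close>, and the
  kernel contributes \<open>mu k powr (\<rho> - 1)\<close>, that is order
  \<open>s - crit_exp\<close>. The sum is exactly -s, so the weight s is reproduced without loss and
  a positive power of t is left over.\<close>

lemma duhamel_bound:
  fixes f :: "real \<Rightarrow> complex"
  assumes k: "k \<in> Mfreq" and "0 \<le> t" "continuous_on {0..t} f" "0 \<le> F"
    and f: "\<And>\<tau>. \<tau> \<in> {0..t} \<Longrightarrow> norm (f \<tau>) \<le> F * wt k powr (crit_exp - s - s)"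
  shows "wt k powr s * norm (integral {0..t} (\<lambda>\<tau>. exp (- mu k * (t - \<tau>)) *\<^sub>R f \<tau>)) \<le> F * t powr \<rho> * \<nu> powr (\<rho> - 1)"
proof -
  have w: "0 < wt k" using wt_ge_1 [OF k] by simp
  have "(1 - exp (- mu k * t)) / mu k \<le> (mu k * t) powr \<rho> / mu k"
    using mu_pos [OF k] one_minus_exp_le_powr [of "mu k * t" \<rho>] rho_bounds \<open>0 \<le> t\<close>
    by (intro divide_right_mono) auto
  also have "\<dots> = t powr \<rho> * mu k powr (\<rho> - 1)"
    using mu_pos [OF k] \<open>0 \<le> t\<close> by (simp add: powr_mult powr_diff)
  finally have 1: "(1 - exp (- mu k * t)) / mu k \<le> t powr \<rho> * (\<nu> powr (\<rho> - 1) * wt k powr (s - crit_exp))"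
    unfolding mu_powr [OF k] .
  have "norm (integral {0..t} (\<lambda>\<tau>. exp (- mu k * (t - \<tau>)) *\<^sub>R f \<tau>)) \<le> F * wt k powr (crit_exp - s - s) * ((1 - exp (- mu k * t)) / mu k)"
    by (intro exp_kernel_integral_le mu_pos assms)
  also have "\<dots> \<le> F * wt k powr (crit_exp - s - s) * (t powr \<rho> * (\<nu> powr (\<rho> - 1) * wt k powr (s - crit_exp)))"
    using 1 \<open>0 \<le> F\<close> by (intro mult_left_mono) auto
  also have "\<dots> = F * t powr \<rho> * \<nu> powr (\<rho> - 1) * wt k powr (- s)"
    by (simp flip: powr_add)
  finally show ?thesis
    using w mult_left_mono [of _ _ "wt k powr s"] by (fastforce simp: powr_minus field_simps)
qed

section \<open>Uniqueness for the coefficient system\<close>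

lemma time_interval_initial: "t1 \<in> time_interval T \<Longrightarrow> {0..t1} \<subseteq> time_interval T"
  by (auto simp: time_interval_def) (meson ereal_less_eq(3) le_less_trans)

lemma coeff_sol_continuous:
  assumes "coeff_sol T a0 a" "k \<in> Mfreq" shows "continuous_on (time_interval T) (\<lambda>t. a t k)"
  using assms unfolding coeff_sol_def by (auto intro!: continuous_on_vector_derivative)

lemma coeff_sol_duhamel:
  assumes "coeff_sol T a0 a" "k \<in> Mfreq" "t \<in> time_interval T"
  shows "((\<lambda>\<tau>. exp (- mu k * (t - \<tau>)) *\<^sub>R triad_form (a \<tau>) (a \<tau>) k) has_integral (exp (- mu k * t) *\<^sub>R a0 k - a t k)) {0..t}"
proof -
  have "0 \<le> t" using assms by (simp add: time_interval_def)
  moreover have "((\<lambda>t. a t k) has_vector_derivative (- mu k *\<^sub>R a \<tau> k - triad_form (a \<tau>) (a \<tau>) k)) (at \<tau> within {0..t})"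
    if "\<tau> \<in> {0..t}" for \<tau>
    using assms that time_interval_initial [OF assms(3)] unfolding coeff_sol_def
    by (meson has_vector_derivative_within_subset subsetD)
  moreover have "a 0 k = a0 k" using assms by (simp add: coeff_sol_def)
  ultimately show ?thesis
    using variation_of_constants [of t "\<lambda>t. a t k" "mu k" "\<lambda>\<tau>. triad_form (a \<tau>) (a \<tau>) k"] by simp
qed

text \<open>Allowing growth \<open>exp (L * t)\<close> gains the factor \<open>L powr (- \<rho>)\<close>, so that uniqueness holds on the whole
  interval at once, without iterating over short time steps.\<close>

lemma coeff_sol_difference_contracts:
  assumes a: "coeff_sol T a0 a" "coeff_sol T a0 b" and t1: "t1 \<in> time_interval T"
    and R: "\<And>t k. t \<in> {0..t1} \<Longrightarrow> k \<in> Mfreq \<Longrightarrow> wt k powr s * norm (a t k) \<le> R"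
           "\<And>t k. t \<in> {0..t1} \<Longrightarrow> k \<in> Mfreq \<Longrightarrow> wt k powr s * norm (b t k) \<le> R"
    and L: "L > 0" "4 * triad_const * R * \<nu> powr (\<rho> - 1) \<le> L powr \<rho>"
    and D: "\<And>t k. t \<in> {0..t1} \<Longrightarrow> k \<in> Mfreq \<Longrightarrow> wt k powr s * norm (a t k - b t k) \<le> D * exp (L * t)"
    and t: "t \<in> {0..t1}" and k: "k \<in> Mfreq"
  shows "wt k powr s * norm (a t k - b t k) \<le> D / 2 * exp (L * t)"
proof -
  have tT: "t \<in> time_interval T" using t t1 time_interval_initial by blast
  have t0: "0 \<le> t" using t by simp
  have w: "0 < wt k" using wt_ge_1 [OF k] by simp
  have m: "0 < mu k" by (rule mu_pos [OF k])
  have R0: "0 \<le> R" using R(1) [OF t k] by (meson mult_nonneg_nonneg norm_ge_zero order_trans powr_ge_zero)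
  have "0 \<le> D * exp (L * t)" using D [OF t k] by (meson mult_nonneg_nonneg norm_ge_zero order_trans powr_ge_zero)
  then have D0: "0 \<le> D" by (simp add: zero_le_mult_iff)
  have "((\<lambda>\<tau>. exp (- mu k * (t - \<tau>)) *\<^sub>R triad_form (a \<tau>) (a \<tau>) k - exp (- mu k * (t - \<tau>)) *\<^sub>R triad_form (b \<tau>) (b \<tau>) k) has_integral
     (exp (- mu k * t) *\<^sub>R a0 k - a t k) - (exp (- mu k * t) *\<^sub>R a0 k - b t k)) {0..t}"
    by (intro has_integral_diff coeff_sol_duhamel [OF _ k tT] a)
  then have I: "((\<lambda>\<tau>. exp (- mu k * (t - \<tau>)) *\<^sub>R (triad_form (a \<tau>) (a \<tau>) k - triad_form (b \<tau>) (b \<tau>) k)) has_integral (b t k - a t k)) {0..t}"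
    by (simp add: scaleR_diff_right)
  define E where "E = 2 * triad_const * R * D * wt k powr (crit_exp - s - s)"
  have E0: "0 \<le> E" using R0 D0 triad_const_pos by (simp add: E_def)
  \<comment> \<open>The factor exp (L * \<tau>) in the bound of the difference equals exp (L * t) *
    exp (- L * (t - \<tau>)), which raises the rate of the kernel from \<open>mu k\<close> to
    \<open>mu k + L\<close>.\<close>
  have J: "((\<lambda>\<tau>. E * exp (L * t) * exp (- (mu k + L) * (t - \<tau>))) has_integral E * exp (L * t) * ((1 - exp (- (mu k + L) * t)) / (mu k + L))) {0..t}"
    using m L t0 by (intro has_integral_mult_right exp_kernel_has_integral) auto
  have "norm (exp (- mu k * (t - \<tau>)) *\<^sub>R (triad_form (a \<tau>) (a \<tau>) k - triad_form (b \<tau>) (b \<tau>) k)) \<le> E * exp (L * t) * exp (- (mu k + L) * (t - \<tau>))"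
    if "\<tau> \<in> {0..t}" for \<tau>
  proof -
    have \<tau>: "\<tau> \<in> {0..t1}" using that t by auto
    have "norm (triad_form (a \<tau>) (a \<tau>) k - triad_form (b \<tau>) (b \<tau>) k) \<le> norm (triad_form (\<lambda>l. a \<tau> l - b \<tau> l) (a \<tau>) k) + norm (triad_form (b \<tau>) (\<lambda>l. a \<tau> l - b \<tau> l) k)"
      unfolding triad_form_diff by (rule norm_triangle_ineq)
    also have "\<dots> \<le> triad_const * (D * exp (L * \<tau>)) * R * wt k powr (crit_exp - s - s) + triad_const * R * (D * exp (L * \<tau>)) * wt k powr (crit_exp - s - s)"
      using \<tau> by (intro add_mono norm_triad_form_le_s k R D)
    also have "\<dots> = E * exp (L * \<tau>)" by (simp add: E_def)
    finally have "norm (exp (- mu k * (t - \<tau>)) *\<^sub>R (triad_form (a \<tau>) (a \<tau>) k - triad_form (b \<tau>) (b \<tau>) k)) \<le> exp (- mu k * (t - \<tau>)) * (E * exp (L * \<tau>))"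
      by simp
    also have "\<dots> = E * exp (L * t) * exp (- (mu k + L) * (t - \<tau>))"
      by (simp add: algebra_simps flip: exp_add)
    finally show ?thesis .
  qed
  then have "norm (b t k - a t k) \<le> E * exp (L * t) * ((1 - exp (- (mu k + L) * t)) / (mu k + L))"
    using has_integral_norm_bound_integral_component I J integral_norm_bound_integral [of _ "{0..t}"]
    by (smt (verit, best) has_integral_iff)
  also have "\<dots> \<le> E * exp (L * t) * (1 / (mu k + L))"
    using m L E0 by (intro mult_left_mono divide_right_mono) auto
  \<comment> \<open>The first factor is estimated through \<open>mu k\<close> and pays for the
    weight, the second through L and supplies the smallness.\<close>
  also have "1 / (mu k + L) = (mu k + L) powr (\<rho> - 1) * (mu k + L) powr (- \<rho>)"
    using m L powr_minus_divide [of "mu k + L" 1] by (simp flip: powr_add)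
  also have "\<dots> \<le> mu k powr (\<rho> - 1) * L powr (- \<rho>)"
    using m L rho_bounds by (intro mult_mono powr_mono2') auto
  also have "E * exp (L * t) * (mu k powr (\<rho> - 1) * L powr (- \<rho>)) =
      (2 * triad_const * R * \<nu> powr (\<rho> - 1)) * L powr (- \<rho>) * D * exp (L * t) * wt k powr (- s)"
    by (simp add: E_def mu_powr [OF k] flip: powr_add)
  also have "\<dots> \<le> (L powr \<rho> / 2) * L powr (- \<rho>) * D * exp (L * t) * wt k powr (- s)"
    using L D0 by (intro mult_right_mono) auto
  also have "\<dots> = D / 2 * exp (L * t) * wt k powr (- s)"
    using L by (simp add: powr_minus)
  finally have "norm (a t k - b t k) \<le> D / 2 * exp (L * t) * wt k powr (- s)"
    using E0 by (simp add: norm_minus_commute mult_left_mono)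
  then show ?thesis using w by (simp add: powr_minus field_simps)
qed

text \<open>The crude bound 2 * R * exp (L * t) for the difference can be halved arbitrarily often
  by \<open>coeff_sol_difference_contracts\<close>.\<close>

lemma coeff_sol_unique:
  assumes a: "coeff_sol T a0 a" "coeff_sol T a0 b" and t: "t \<in> time_interval T" and k: "k \<in> Mfreq"
  shows "a t k = b t k"
proof -
  obtain Ra Rb where Ra: "\<And>\<tau> k. \<tau> \<in> {0..t} \<Longrightarrow> k \<in> Mfreq \<Longrightarrow> wt k powr s * norm (a \<tau> k) \<le> Ra"
    and Rb: "\<And>\<tau> k. \<tau> \<in> {0..t} \<Longrightarrow> k \<in> Mfreq \<Longrightarrow> wt k powr s * norm (b \<tau> k) \<le> Rb"
    using a t unfolding coeff_sol_def by meson
  \<comment> \<open>The lower bound 1 makes L positive even when both solutions vanish.\<close>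
  define R where "R = max 1 (max Ra Rb)"
  have R: "\<And>\<tau> k. \<tau> \<in> {0..t} \<Longrightarrow> k \<in> Mfreq \<Longrightarrow> wt k powr s * norm (a \<tau> k) \<le> R"
    "\<And>\<tau> k. \<tau> \<in> {0..t} \<Longrightarrow> k \<in> Mfreq \<Longrightarrow> wt k powr s * norm (b \<tau> k) \<le> R" "R > 0"
    using Ra Rb by (fastforce simp: R_def)+
  \<comment> \<open>Chosen so that L powr \<rho> equals the constant that the contraction
    requires.\<close>
  define L where "L = (4 * triad_const * R * \<nu> powr (\<rho> - 1)) powr (1 / \<rho>)"
  have P: "4 * triad_const * R * \<nu> powr (\<rho> - 1) > 0" using triad_const_pos R(3) nu by simp
  then have L: "L > 0" "4 * triad_const * R * \<nu> powr (\<rho> - 1) \<le> L powr \<rho>"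
    using rho_bounds by (auto simp: L_def powr_powr)
  have main: "wt k powr s * norm (a \<tau> k - b \<tau> k) \<le> (2 * R / 2 ^ n) * exp (L * \<tau>)" if "\<tau> \<in> {0..t}" "k \<in> Mfreq" for n \<tau> k
    using that
  proof (induction n arbitrary: \<tau> k)
    case 0
    have "wt k powr s * norm (a \<tau> k - b \<tau> k) \<le> wt k powr s * (norm (a \<tau> k) + norm (b \<tau> k))"
      by (intro mult_left_mono norm_triangle_ineq4) auto
    also have "\<dots> \<le> 2 * R" using R(1,2) [OF 0] by (simp add: algebra_simps)
    also have "\<dots> \<le> 2 * R * exp (L * \<tau>)" using 0 R(3) L by simp
    finally show ?case by simp
  next
    case (Suc n)
    have "wt k powr s * norm (a \<tau> k - b \<tau> k) \<le> (2 * R / 2 ^ n) / 2 * exp (L * \<tau>)"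
      by (rule coeff_sol_difference_contracts [OF a t R(1,2) L Suc.IH Suc.prems])
    then show ?case by (simp add: mult_ac)
  qed
  have "(\<lambda>n. (2 * R / 2 ^ n) * exp (L * t)) \<longlonglongrightarrow> 0"
    using tendsto_mult_right [OF LIMSEQ_power_zero [of "1 / 2 :: real"], of "2 * R * exp (L * t)"] by (simp add: power_divide field_simps)
  then have "wt k powr s * norm (a t k - b t k) \<le> 0"
    by (rule LIMSEQ_le_const) (use main t k in \<open>auto simp: time_interval_def\<close>)
  then show ?thesis using wt_ge_1 [OF k] by (simp add: mult_le_0_iff)
qed

section \<open>Restriction, translation and continuation of solutions\<close>

lemma coeff_sol_restrict:
  assumes "coeff_sol T a0 a" "T' \<le> T" shows "coeff_sol T' a0 a"
proof -
  have sub: "time_interval T' \<subseteq> time_interval T" using assms(2) by (auto simp: time_interval_def)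
  then show ?thesis using assms(1) unfolding coeff_sol_def
    by (meson has_vector_derivative_within_subset subsetD)
qed

lemma coeff_sol_cong:
  assumes "coeff_sol T a0 a" "0 < T" "\<And>t k. t \<in> time_interval T \<Longrightarrow> k \<in> Mfreq \<Longrightarrow> b t k = a t k"
  shows "coeff_sol T a0 b"
  unfolding coeff_sol_def
proof (intro conjI ballI)
  fix k assume k: "k \<in> Mfreq"
  have "0 \<in> time_interval T" using assms(2) by (simp add: time_interval_def zero_ereal_def)
  then show "b 0 k = a0 k" using assms k by (simp add: coeff_sol_def)
  fix t assume t: "t \<in> time_interval T"
  have "((\<lambda>t. a t k) has_vector_derivative - mu k *\<^sub>R a t k - triad_form (a t) (a t) k) (at t within time_interval T)"
    using assms t k by (simp add: coeff_sol_def)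
  then have "((\<lambda>t. b t k) has_vector_derivative - mu k *\<^sub>R a t k - triad_form (a t) (a t) k) (at t within time_interval T)"
    by (rule has_vector_derivative_transform [OF t, rotated]) (use assms k in auto)
  moreover have "triad_form (b t) (b t) k = triad_form (a t) (a t) k" using assms t by (intro triad_form_cong) auto
  ultimately show "((\<lambda>t. b t k) has_vector_derivative - mu k *\<^sub>R b t k - triad_form (b t) (b t) k) (at t within time_interval T)"
    using assms t k by simp
next
  fix t1 assume t1: "t1 \<in> time_interval T"
  then obtain R where "\<forall>t\<in>{0..t1}. \<forall>k\<in>Mfreq. wt k powr s * norm (a t k) \<le> R" using assms(1) by (auto simp: coeff_sol_def)
  then show "\<exists>R. \<forall>t\<in>{0..t1}. \<forall>k\<in>Mfreq. wt k powr s * norm (b t k) \<le> R"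
    using assms(3) time_interval_initial [OF t1] by (intro exI [of _ R]) auto
qed

lemma coeff_sol_shift:
  assumes "coeff_sol T a0 a" "t0 \<in> time_interval T"
  shows "coeff_sol (T - ereal t0) (a t0) (\<lambda>t. a (t + t0))"
  unfolding coeff_sol_def
proof (intro conjI ballI)
  have mem: "t + t0 \<in> time_interval T" if "t \<in> time_interval (T - ereal t0)" for t
    using that assms(2) by (cases T) (auto simp: time_interval_def)
  fix k assume k: "k \<in> Mfreq"
  show "a (0 + t0) k = a t0 k" by simp
  fix t assume t: "t \<in> time_interval (T - ereal t0)"
  let ?d = "- mu k *\<^sub>R a (t + t0) k - triad_form (a (t + t0)) (a (t + t0)) k"
  have "((\<lambda>t. a t k) has_vector_derivative ?d) (at (t + t0) within time_interval T)"
    using assms mem [OF t] k by (simp add: coeff_sol_def)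
  then have "((\<lambda>t. a t k) has_vector_derivative ?d) (at (t + t0) within (\<lambda>t. t + t0) ` time_interval (T - ereal t0))"
    by (rule has_vector_derivative_within_subset) (use mem in auto)
  moreover have "((\<lambda>t. t + t0) has_vector_derivative 1) (at t within time_interval (T - ereal t0))"
    by (auto intro!: derivative_eq_intros)
  ultimately have "((\<lambda>t. a t k) \<circ> (\<lambda>t. t + t0) has_vector_derivative 1 *\<^sub>R ?d) (at t within time_interval (T - ereal t0))"
    by (intro vector_diff_chain_within)
  then show "((\<lambda>t. a (t + t0) k) has_vector_derivative ?d) (at t within time_interval (T - ereal t0))"
    by (simp add: o_def)
next
  fix t1 assume "t1 \<in> time_interval (T - ereal t0)"
  then have "t1 + t0 \<in> time_interval T"
    using assms(2) by (cases T) (auto simp: time_interval_def)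
  then obtain R where "\<forall>t\<in>{0..t1 + t0}. \<forall>k\<in>Mfreq. wt k powr s * norm (a t k) \<le> R"
    using assms(1) unfolding coeff_sol_def by meson
  then show "\<exists>R. \<forall>t\<in>{0..t1}. \<forall>k\<in>Mfreq. wt k powr s * norm (a (t + t0) k) \<le> R"
    using assms(2) by (intro exI [of _ R]) (auto simp: time_interval_def)
qed

text \<open>By uniqueness the second solution agrees with the translated first one on their common
  interval, which reaches beyond t0. The glued function thus coincides with \<open>a\<close> as long
  as both live and with the translate of \<open>b\<close> after t0, and no matching of derivatives
  at t0 has to be checked.\<close>

lemma coeff_sol_glue:
  assumes a: "coeff_sol T a0 a" and t0: "t0 \<in> time_interval T" and b: "coeff_sol T' (a t0) b" and "0 < T'"
  obtains c where "coeff_sol (ereal t0 + T') a0 c"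
proof -
  define c where "c t = (if t \<le> t0 then a t else b (t - t0))" for t
  have t0': "0 \<le> t0" "ereal t0 < T" using t0 by (auto simp: time_interval_def)
  define M where "M = min (T - ereal t0) T'"
  have agree: "a (t + t0) k = b t k" if "t \<in> time_interval M" "k \<in> Mfreq" for t k
    using coeff_sol_unique [OF coeff_sol_restrict [OF coeff_sol_shift [OF a t0], of M] coeff_sol_restrict [OF b, of M]] that
    by (auto simp: M_def)
  have ca: "c t k = a t k" if "t \<in> time_interval (min T (ereal t0 + T'))" "k \<in> Mfreq" for t k
  proof (cases "t \<le> t0")
    case False
    then have "t - t0 \<in> time_interval M"
      using that by (cases T; cases T') (auto simp: M_def time_interval_def min_def split: if_splits)
    then show ?thesis using False agree [of "t - t0" k] that by (simp add: c_def)
  qed (simp add: c_def)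
  have cb: "c t k = b (t - t0) k" if "t0 \<le> t" "k \<in> Mfreq" for t k
    using that b by (auto simp: c_def coeff_sol_def)
  let ?I = "time_interval (ereal t0 + T')"
  have "coeff_sol (ereal t0 + T') a0 c"
    unfolding coeff_sol_def
  proof (intro conjI ballI)
    fix k assume k: "k \<in> Mfreq"
    show "c 0 k = a0 k" using t0' a k by (simp add: c_def coeff_sol_def)
    fix t assume t: "t \<in> ?I"
    show "((\<lambda>t. c t k) has_vector_derivative - mu k *\<^sub>R c t k - triad_form (c t) (c t) k) (at t within ?I)"
    proof (cases "ereal t < T")
      case True
      let ?J = "time_interval (min T (ereal t0 + T'))"
      have tJ: "t \<in> ?J" using True t by (auto simp: time_interval_def)
      have "coeff_sol (min T (ereal t0 + T')) a0 c"
      proof (rule coeff_sol_cong [OF coeff_sol_restrict [OF a] _ ca])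
        show "0 < min T (ereal t0 + T')"
          using t0' \<open>0 < T'\<close> by (cases T; cases T') (auto simp: min_def zero_ereal_def)
      qed auto
      then have "((\<lambda>t. c t k) has_vector_derivative - mu k *\<^sub>R c t k - triad_form (c t) (c t) k) (at t within ?J)"
        using tJ k by (simp add: coeff_sol_def)
      moreover obtain r where "t < r" "ereal r < T"
        using True ereal_dense2 by fastforce
      then have "at t within ?J = at t within ?I"
        by (intro at_within_nhd [of t "{..<r}"]) (auto simp: time_interval_def intro: less_trans [of "ereal _" "ereal r"])
      ultimately show ?thesis by simp
    next
      case False
      then have tt: "t0 < t" using t0' by (metis ereal_less_eq(3) le_less_trans not_le)
      let ?J = "(\<lambda>t. t - t0) ` (?I \<inter> {t0<..})"
      have sub: "?J \<subseteq> time_interval T'"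
        by (cases T') (auto simp: time_interval_def)
      have tJ: "t - t0 \<in> time_interval T'" using sub t tt by auto
      let ?d = "- mu k *\<^sub>R b (t - t0) k - triad_form (b (t - t0)) (b (t - t0)) k"
      have "((\<lambda>t. b t k) has_vector_derivative ?d) (at (t - t0) within time_interval T')"
        using b tJ k by (simp add: coeff_sol_def)
      then have "((\<lambda>t. b t k) has_vector_derivative ?d) (at (t - t0) within ?J)"
        by (rule has_vector_derivative_within_subset [OF _ sub])
      moreover have "((\<lambda>t. t - t0) has_vector_derivative 1) (at t within ?I \<inter> {t0<..})"
        by (auto intro!: derivative_eq_intros)
      ultimately have "((\<lambda>t. b t k) \<circ> (\<lambda>t. t - t0) has_vector_derivative 1 *\<^sub>R ?d) (at t within ?I \<inter> {t0<..})"
        by (intro vector_diff_chain_within)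
      then have "((\<lambda>t. b (t - t0) k) has_vector_derivative ?d) (at t within ?I \<inter> {t0<..})"
        by (simp add: o_def)
      then have "((\<lambda>t. c t k) has_vector_derivative ?d) (at t within ?I \<inter> {t0<..})"
        using t tt cb k by (intro has_vector_derivative_transform [OF _ _ \<open>((\<lambda>t. b (t - t0) k) has_vector_derivative ?d) (at t within ?I \<inter> {t0<..})\<close>]) auto
      moreover have "at t within ?I \<inter> {t0<..} = at t within ?I"
        using tt by (intro at_within_nhd [of t "{t0<..}"]) auto
      moreover have "triad_form (c t) (c t) k = triad_form (b (t - t0)) (b (t - t0)) k"
        using tt cb by (intro triad_form_cong) auto
      moreover have "c t k = b (t - t0) k" using tt cb k by simp
      ultimately show ?thesis by simp
    qed
  next
    fix t1 assume t1: "t1 \<in> ?I"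
    obtain Ra where Ra: "\<forall>t\<in>{0..t0}. \<forall>k\<in>Mfreq. wt k powr s * norm (a t k) \<le> Ra"
      using a t0 unfolding coeff_sol_def by meson
    have "max 0 (t1 - t0) \<in> time_interval T'"
      using t1 \<open>0 < T'\<close> by (cases T') (auto simp: time_interval_def zero_ereal_def max_def)
    then obtain Rb where Rb: "\<forall>t\<in>{0..max 0 (t1 - t0)}. \<forall>k\<in>Mfreq. wt k powr s * norm (b t k) \<le> Rb"
      using b unfolding coeff_sol_def by meson
    show "\<exists>R. \<forall>t\<in>{0..t1}. \<forall>k\<in>Mfreq. wt k powr s * norm (c t k) \<le> R"
    proof (intro exI [of _ "max Ra Rb"] ballI)
      fix t k assume "t \<in> {0..t1}" "k \<in> Mfreq"
      then show "wt k powr s * norm (c t k) \<le> max Ra Rb"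
        using Ra [rule_format, of t k] Rb [rule_format, of "t - t0" k] by (auto simp: c_def)
    qed
  qed
  then show ?thesis using that by blast
qed

section \<open>Local existence by contraction\<close>

lemma continuous_on_discrete_snd:
  fixes g :: "real \<times> 'b discrete \<Rightarrow> complex"
  assumes "\<And>k. continuous_on UNIV (\<lambda>t. g (t, k))"
  shows "continuous_on UNIV g"
proof -
  \<comment> \<open>Slices over a single discrete point are open, so continuity may be checked slice
    by slice.\<close>
  have o: "open (UNIV \<times> {k} :: (real \<times> 'b discrete) set)" for k
    by (intro open_Times open_discrete) auto
  have "continuous_on (UNIV \<times> {k}) g" for k
    using assms [of k]
    by (intro continuous_on_eq [OF continuous_on_compose2 [of UNIV "\<lambda>t. g (t, k)" _ fst]])
      (auto intro!: continuous_intros)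
  then have "continuous_on (\<Union>k. UNIV \<times> {k}) g"
    using o by (intro continuous_on_open_UN) auto
  moreover have "(\<Union>k. UNIV \<times> {k}) = (UNIV :: (real \<times> 'b discrete) set)" by auto
  ultimately show ?thesis by simp
qed

text \<open>The unknown g (t, k) is the coefficient times \<open>wt k powr s\<close>, so that its
  supremum norm is the weighted norm. On the ball of radius 2 * A the Duhamel term is at most A / 2
  and Lipschitz with constant 1 / 2; the latter is what the factor 8 in the condition on T
  provides.\<close>

lemma local_existence:
  assumes A: "\<And>k. k \<in> Mfreq \<Longrightarrow> wt k powr s * norm (a0 k) \<le> A" "0 \<le> A"
    and T: "0 < T" "8 * triad_const * A * T powr \<rho> \<le> \<nu> powr (1 - \<rho>)"
  obtains a where "coeff_sol (ereal T) a0 a"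
proof -
  have small: "8 * triad_const * A * T powr \<rho> * \<nu> powr (\<rho> - 1) \<le> 1"
  proof -
    have "8 * triad_const * A * T powr \<rho> * \<nu> powr (\<rho> - 1) \<le> \<nu> powr (1 - \<rho>) * \<nu> powr (\<rho> - 1)"
      by (rule mult_right_mono [OF T(2)]) simp
    then show ?thesis using nu by (simp flip: powr_add)
  qed
  \<comment> \<open>Bounded continuous functions are only known to be complete over a metric domain, hence
    the type \<open>discrete\<close> for the frequencies.\<close>
  define cl where "cl t = max 0 (min T t)" for t :: real
  \<comment> \<open>Clamping time to [0, T] lets bounded continuous functions on the whole line play
    the role of functions on the interval.\<close>
  have cl: "cl t \<in> {0..T}" "t \<in> {0..T} \<Longrightarrow> cl t = t" for t using T by (auto simp: cl_def)
  have ccl: "continuous_on S cl" for S unfolding cl_def by (intro continuous_intros)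
  \<comment> \<open>\<open>\<A> g\<close> undoes the weight, \<open>\<D> g\<close> is the Duhamel
    integral and \<open>\<F> g\<close> the weighted right-hand side, set to 0 off
    \<open>Mfreq\<close> to stay bounded.\<close>
  define \<A> where "\<A> g t k = apply_bcontfun g (cl t, discrete k) /\<^sub>R (wt k powr s)"
    for g :: "(real \<times> (int^3) discrete) \<Rightarrow>\<^sub>C complex" and t k
  define \<D> where "\<D> g t k = integral {0..t} (\<lambda>\<tau>. exp (- mu k * (t - \<tau>)) *\<^sub>R triad_form (\<A> g \<tau>) (\<A> g \<tau>) k)" for g t k
  define \<F> where "\<F> g = (\<lambda>(t, d). let k = of_discrete d in
    if k \<in> Mfreq then wt k powr s *\<^sub>R (exp (- mu k * cl t) *\<^sub>R a0 k - \<D> g (cl t) k) else 0)" for g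
  have wA: "wt k powr s * norm (\<A> g t k) = norm (apply_bcontfun g (cl t, discrete k))" if "k \<in> Mfreq" for g t k
    using wt_ge_1 [OF that] by (simp add: \<A>_def)
  have contA: "continuous_on S (\<lambda>t. \<A> g t k)" for g k S
  proof -
    have "continuous_on S (\<lambda>t. apply_bcontfun g (cl t, discrete k))"
      by (rule continuous_on_compose2 [OF continuous_on_apply_bcontfun [of UNIV]]) (auto intro!: continuous_intros ccl)
    then show ?thesis unfolding \<A>_def by (intro continuous_intros)
  qed
  have contB: "continuous_on S (\<lambda>t. triad_form (\<A> g t) (\<A> g t) k)" if "k \<in> Mfreq" for g k S
    using that contA by (intro continuous_on_triad_form)
  have deriv: "((\<lambda>t. exp (- mu k * t) *\<^sub>R a0 k - \<D> g t k) has_vector_derivative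
      - mu k *\<^sub>R (exp (- mu k * t) *\<^sub>R a0 k - \<D> g t k) - triad_form (\<A> g t) (\<A> g t) k) (at t within {0..T})"
    if "k \<in> Mfreq" "t \<in> {0..T}" for g k t
    unfolding \<D>_def using that by (intro duhamel_has_derivative contB)
  have boundB: "norm (triad_form (\<A> g t) (\<A> g t) k) \<le> triad_const * R * R * wt k powr (crit_exp - s - s)"
    if "k \<in> Mfreq" "norm g \<le> R" for g t k R
    using that wA by (intro norm_triad_form_le_s) (auto intro: order_trans [OF norm_bounded])
  have boundD: "wt k powr s * norm (\<D> g t k) \<le> triad_const * R * R * T powr \<rho> * \<nu> powr (\<rho> - 1)"
    if k: "k \<in> Mfreq" and g: "norm g \<le> R" and t: "t \<in> {0..T}" for g t k R
  proof -
    have "wt k powr s * norm (\<D> g t k) \<le> (triad_const * R * R) * t powr \<rho> * \<nu> powr (\<rho> - 1)"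
      unfolding \<D>_def using t triad_const_pos
      by (intro duhamel_bound k contB boundB g) (auto simp: mult.assoc)
    also have "\<dots> \<le> (triad_const * R * R) * T powr \<rho> * \<nu> powr (\<rho> - 1)"
      using t triad_const_pos rho_bounds
      by (intro mult_right_mono mult_left_mono powr_mono2) (auto simp: mult.assoc)
    finally show ?thesis .
  qed
  have F_eq: "\<F> g (t, discrete k) = (if k \<in> Mfreq then wt k powr s *\<^sub>R (exp (- mu k * cl t) *\<^sub>R a0 k - \<D> g (cl t) k) else 0)" for g t k
    by (simp add: \<F>_def discrete_inverse)
  have boundF: "norm (\<F> g (t, discrete k)) \<le> A + triad_const * R * R * T powr \<rho> * \<nu> powr (\<rho> - 1)"
    if "norm g \<le> R" for g t k R
  proof (cases "k \<in> Mfreq")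
    case True
    have "norm (\<F> g (t, discrete k)) = wt k powr s * norm (exp (- mu k * cl t) *\<^sub>R a0 k - \<D> g (cl t) k)"
      using True by (simp add: F_eq)
    also have "\<dots> \<le> wt k powr s * (norm (exp (- mu k * cl t) *\<^sub>R a0 k) + norm (\<D> g (cl t) k))"
      by (intro mult_left_mono norm_triangle_ineq4) auto
    also have "norm (exp (- mu k * cl t) *\<^sub>R a0 k) \<le> norm (a0 k)"
      using cl mu_pos [OF True] by (auto intro!: mult_left_le_one_le)
    also have "wt k powr s * (norm (a0 k) + norm (\<D> g (cl t) k)) \<le> A + triad_const * R * R * T powr \<rho> * \<nu> powr (\<rho> - 1)"
      using A(1) [OF True] boundD [OF True that cl(1)] by (simp add: algebra_simps add_mono)
    finally show ?thesis by (simp add: mult_left_mono add_mono)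
  next
    case False
    have "0 \<le> triad_const * (R * R) * T powr \<rho> * \<nu> powr (\<rho> - 1)"
      using triad_const_pos by simp
    then show ?thesis using A False by (simp add: F_eq mult.assoc)
  qed
  have "\<F> g \<in> bcontfun" for g
    unfolding bcontfun_def mem_Collect_eq
  proof
    show "continuous_on UNIV (\<F> g)"
    proof (rule continuous_on_discrete_snd)
      fix d :: "(int^3) discrete"
      obtain k where d: "d = discrete k" by (rule discrete_cases)
      show "continuous_on UNIV (\<lambda>t. \<F> g (t, d))"
      proof (cases "k \<in> Mfreq")
        case True
        have "continuous_on {0..T} (\<lambda>t. exp (- mu k * t) *\<^sub>R a0 k - \<D> g t k)"
          using deriv [OF True] by (intro continuous_on_vector_derivative)
        then have "continuous_on UNIV (\<lambda>t. exp (- mu k * cl t) *\<^sub>R a0 k - \<D> g (cl t) k)"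
          by (rule continuous_on_compose2 [OF _ ccl]) (use cl in auto)
        then show ?thesis using True by (auto simp: F_eq d intro!: continuous_intros)
      qed (simp add: F_eq d)
    qed
    have "norm (\<F> g (t, d)) \<le> A + triad_const * norm g * norm g * T powr \<rho> * \<nu> powr (\<rho> - 1)" for t d
      using boundF [of g "norm g" t "of_discrete d"] by (simp add: of_discrete_inverse)
    then show "bounded (range (\<F> g))" by (intro boundedI) auto
  qed
  then have app: "apply_bcontfun (Bcontfun (\<F> g)) = \<F> g" for g
    by (simp add: Bcontfun_inverse)
  have "\<exists>!g\<in>cball (0 :: (real \<times> (int^3) discrete) \<Rightarrow>\<^sub>C complex) (2 * A). Bcontfun (\<F> g) = g"
  proof (rule Banach_fix [of _ "1/2"])
    show "complete (cball (0 :: (real \<times> (int^3) discrete) \<Rightarrow>\<^sub>C complex) (2 * A))"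
      by (simp add: complete_eq_closed)
    show "cball (0 :: (real \<times> (int^3) discrete) \<Rightarrow>\<^sub>C complex) (2 * A) \<noteq> {}" using A by simp
    show "(\<lambda>g. Bcontfun (\<F> g)) ` cball 0 (2 * A) \<subseteq> cball 0 (2 * A)"
    proof safe
      fix g :: "(real \<times> (int^3) discrete) \<Rightarrow>\<^sub>C complex" assume "g \<in> cball 0 (2 * A)"
      then have g: "norm g \<le> 2 * A" by simp
      have "triad_const * (2 * A) * (2 * A) * T powr \<rho> * \<nu> powr (\<rho> - 1) = (8 * triad_const * A * T powr \<rho> * \<nu> powr (\<rho> - 1)) * (A / 2)"
        by simp
      also have "\<dots> \<le> 1 * (A / 2)" using A by (intro mult_right_mono small) auto
      finally have "norm (\<F> g (t, d)) \<le> 2 * A" for t d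
        using boundF [OF g, of t "of_discrete d"] A by (simp add: of_discrete_inverse)
      then show "Bcontfun (\<F> g) \<in> cball 0 (2 * A)"
        by (auto simp: app intro!: norm_bound)
    qed
    show "\<And>g h. g \<in> cball 0 (2 * A) \<Longrightarrow> h \<in> cball 0 (2 * A) \<Longrightarrow> dist (Bcontfun (\<F> g)) (Bcontfun (\<F> h)) \<le> 1 / 2 * dist g h"
    proof (rule dist_bound, clarify)
      fix g h :: "(real \<times> (int^3) discrete) \<Rightarrow>\<^sub>C complex" and t and d :: "(int^3) discrete"
      assume "g \<in> cball 0 (2 * A)" "h \<in> cball 0 (2 * A)"
      then have g: "norm g \<le> 2 * A" and h: "norm h \<le> 2 * A" by auto
      obtain k where d: "d = discrete k" by (rule discrete_cases)
      show "dist (apply_bcontfun (Bcontfun (\<F> g)) (t, d)) (apply_bcontfun (Bcontfun (\<F> h)) (t, d)) \<le> 1 / 2 * dist g h"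
      proof (cases "k \<in> Mfreq")
        case k: True
        have D: "wt l powr s * norm (\<A> g \<tau> l - \<A> h \<tau> l) \<le> dist g h" if "l \<in> Mfreq" for \<tau> l
        proof -
          have "wt l powr s * norm (\<A> g \<tau> l - \<A> h \<tau> l) = dist (apply_bcontfun g (cl \<tau>, discrete l)) (apply_bcontfun h (cl \<tau>, discrete l))"
            using wt_ge_1 [OF that] by (simp add: \<A>_def dist_norm flip: scaleR_diff_right)
          then show ?thesis using dist_bounded by metis
        qed
        have bd: "norm (triad_form (\<A> g \<tau>) (\<A> g \<tau>) k - triad_form (\<A> h \<tau>) (\<A> h \<tau>) k) \<le> (4 * triad_const * A * dist g h) * wt k powr (crit_exp - s - s)" for \<tau>
        proof -
          have "norm (triad_form (\<A> g \<tau>) (\<A> g \<tau>) k - triad_form (\<A> h \<tau>) (\<A> h \<tau>) k) \<le>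
              norm (triad_form (\<lambda>l. \<A> g \<tau> l - \<A> h \<tau> l) (\<A> g \<tau>) k) + norm (triad_form (\<A> h \<tau>) (\<lambda>l. \<A> g \<tau> l - \<A> h \<tau> l) k)"
            unfolding triad_form_diff by (rule norm_triangle_ineq)
          also have "\<dots> \<le> triad_const * dist g h * (2 * A) * wt k powr (crit_exp - s - s) + triad_const * (2 * A) * dist g h * wt k powr (crit_exp - s - s)"
            using g h wA by (intro add_mono norm_triad_form_le_s k D) (auto intro: order_trans [OF norm_bounded])
          finally show ?thesis by (simp add: algebra_simps)
        qed
        have eq: "\<D> g t k - \<D> h t k = integral {0..t} (\<lambda>\<tau>. exp (- mu k * (t - \<tau>)) *\<^sub>R (triad_form (\<A> g \<tau>) (\<A> g \<tau>) k - triad_form (\<A> h \<tau>) (\<A> h \<tau>) k))" for t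
          unfolding \<D>_def scaleR_diff_right
          by (intro Henstock_Kurzweil_Integration.integral_diff [symmetric] integrable_continuous_interval continuous_intros contB k)
        have "dist (apply_bcontfun (Bcontfun (\<F> g)) (t, d)) (apply_bcontfun (Bcontfun (\<F> h)) (t, d)) = wt k powr s * norm (\<D> g (cl t) k - \<D> h (cl t) k)"
          using k by (simp add: app F_eq d dist_norm norm_minus_commute flip: scaleR_diff_right)
        also have "\<dots> \<le> (4 * triad_const * A * dist g h) * (cl t) powr \<rho> * \<nu> powr (\<rho> - 1)"
          unfolding eq using cl(1) triad_const_pos A
          by (intro duhamel_bound k bd continuous_intros contB) auto
        also have "\<dots> \<le> (4 * triad_const * A * dist g h) * T powr \<rho> * \<nu> powr (\<rho> - 1)"
          using cl(1) [of t] triad_const_pos A rho_bounds by (intro mult_right_mono mult_left_mono powr_mono2) auto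
        also have "\<dots> = (8 * triad_const * A * T powr \<rho> * \<nu> powr (\<rho> - 1)) * (dist g h / 2)" by simp
        also have "\<dots> \<le> 1 * (dist g h / 2)" by (intro mult_right_mono small) auto
        finally show ?thesis by simp
      qed (simp add: app F_eq d)
    qed
  qed auto
  then obtain g where g: "norm g \<le> 2 * A" "Bcontfun (\<F> g) = g" by auto
  \<comment> \<open>Without the weight, the fixed point equation is the Duhamel formula on [0, T],
    whose right-hand side \<open>deriv\<close> differentiates.\<close>
  have fixpt: "\<A> g t k = exp (- mu k * t) *\<^sub>R a0 k - \<D> g t k" if "k \<in> Mfreq" "t \<in> {0..T}" for t k
  proof -
    have "apply_bcontfun g (t, discrete k) = \<F> g (t, discrete k)" using app [of g] g(2) by simp
    then show ?thesis using that wt_ge_1 [OF that(1)] cl(2) by (simp add: \<A>_def F_eq)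
  qed
  have "coeff_sol (ereal T) a0 (\<A> g)"
    unfolding coeff_sol_def
  proof (intro conjI ballI)
    fix k assume k: "k \<in> Mfreq"
    show "\<A> g 0 k = a0 k" using fixpt [OF k, of 0] T by (simp add: \<D>_def)
    fix t assume "t \<in> time_interval (ereal T)"
    then have t: "t \<in> {0..T}" by (simp add: time_interval_def)
    have "((\<lambda>t. \<A> g t k) has_vector_derivative - mu k *\<^sub>R \<A> g t k - triad_form (\<A> g t) (\<A> g t) k) (at t within {0..T})"
      unfolding fixpt [OF k t]
      by (rule has_vector_derivative_transform [OF t _ deriv [OF k t]]) (simp add: fixpt k)
    then show "((\<lambda>t. \<A> g t k) has_vector_derivative - mu k *\<^sub>R \<A> g t k - triad_form (\<A> g t) (\<A> g t) k) (at t within time_interval (ereal T))"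
      by (rule has_vector_derivative_within_subset) (auto simp: time_interval_def)
  next
    fix t1 show "\<exists>R. \<forall>t\<in>{0..t1}. \<forall>k\<in>Mfreq. wt k powr s * norm (\<A> g t k) \<le> R"
      by (intro exI [of _ "norm g"]) (simp add: wA norm_bounded)
  qed
  then show ?thesis using that by blast
qed

end

subsection \<open>Fourier coefficients on the torus\<close>

abbreviation cube_measure :: "(real^3) measure" where
  "cube_measure \<equiv> lebesgue_on unit_cube"

definition torus_char :: "int^3 \<Rightarrow> real^3 \<Rightarrow> complex" where
  "torus_char k x = exp (2 * pi * \<i> * complex_of_real (rvec k \<bullet> x))"

lemma torus_char_0 [simp]: "torus_char 0 x = 1"
  by (simp add: torus_char_def)

lemma torus_char_add: "torus_char (k + l) x = torus_char k x * torus_char l x"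
  by (simp add: torus_char_def inner_add_left ring_distribs exp_add)

lemma torus_char_uminus: "torus_char (- k) x = cnj (torus_char k x)"
  by (simp add: torus_char_def exp_cnj)

lemma norm_torus_char [simp]: "norm (torus_char k x) = 1"
  by (simp add: torus_char_def)

lemma continuous_on_torus_char [continuous_intros]:
  "continuous_on S f \<Longrightarrow> continuous_on S (\<lambda>x. torus_char k (f x))"
  unfolding torus_char_def by (intro continuous_intros)

lemma periodic3_torus_char: "periodic3 (torus_char k)"
proof -
  have "torus_char k (x + axis i 1) = torus_char k x" for x i
  proof -
    have "rvec k \<bullet> axis i 1 = of_int (k $ i)" by (simp add: inner_axis rvec_def)
    moreover have "exp (2 * complex_of_real pi * \<i> * of_int (k $ i)) = 1"
      using exp_eq_1 [of "2 * complex_of_real pi * \<i> * of_int (k $ i)"] by simp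
    ultimately show ?thesis by (simp add: torus_char_def inner_add_right ring_distribs exp_add)
  qed
  then show ?thesis by (simp add: periodic3_def)
qed

lemma fourier_coeff_eq: "fourier_coeff f k = (\<integral>x. of_real (f x) * torus_char (- k) x \<partial>cube_measure)"
  by (simp add: fourier_coeff_def torus_char_def set_lebesgue_integral_def integral_restrict_space)

lemma set_integrable_cube_iff:
  fixes f :: "real^3 \<Rightarrow> 'b::{banach,second_countable_topology}"
  shows
  "set_integrable lebesgue unit_cube f \<longleftrightarrow> integrable cube_measure f"
  unfolding set_integrable_def by (subst integrable_restrict_space) auto

lemma integrable_cube_continuous_mult:
  fixes g h :: "real^3 \<Rightarrow> 'b::{real_normed_field,banach,second_countable_topology}"
  assumes "integrable cube_measure g" "continuous_on unit_cube h" "\<And>x. x \<in> unit_cube \<Longrightarrow> norm (h x) \<le> B"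
  shows "integrable cube_measure (\<lambda>x. h x * g x)"
proof (rule Bochner_Integration.integrable_bound)
  show "integrable cube_measure (\<lambda>x. B * norm (g x))"
    using assms(1) by (intro integrable_mult_right integrable_norm)
  have "h \<in> borel_measurable cube_measure"
    by (intro continuous_imp_measurable_on_sets_lebesgue assms) simp
  then show "(\<lambda>x. h x * g x) \<in> borel_measurable cube_measure"
    using borel_measurable_integrable [OF assms(1)] by (intro borel_measurable_times)
  show "AE x in cube_measure. norm (h x * g x) \<le> norm (B * norm (g x))"
  proof (rule AE_I2)
    fix x assume "x \<in> space cube_measure"
    then have "norm (h x) \<le> B" using assms(3) by simp
    then show "norm (h x * g x) \<le> norm (B * norm (g x))"
      by (auto simp: norm_mult abs_mult intro!: mult_right_mono)
  qed
qed

lemma integrable_cube_const: "integrable cube_measure (\<lambda>x. c :: 'b::{banach,second_countable_topology})"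
proof -
  have "finite_measure cube_measure"
    by (rule finite_measureI) (simp add: emeasure_restrict_space emeasure_lborel_cbox_eq)
  then show ?thesis by (rule finite_measure.integrable_const)
qed

lemma integrable_cube_continuous:
  fixes h :: "real^3 \<Rightarrow> 'b::euclidean_space"
  assumes "continuous_on unit_cube h"
  shows "integrable cube_measure h"
  using absolutely_integrable_continuous [OF assms] by (simp add: set_integrable_cube_iff)

lemma integral_exp_period:
  fixes n :: int
  shows "(\<integral>t. indicator {0..1} t *\<^sub>R exp (2 * pi * \<i> * complex_of_real (real_of_int n * t)) \<partial>lborel) = (if n = 0 then 1 else 0)"
proof (cases "n = 0")
  case False
  let ?c = "2 * pi * \<i> * of_int n :: complex"
  have c: "?c \<noteq> 0" using False by simp
  have "((\<lambda>t. exp (?c * of_real t)) has_integral exp (?c * of_real 1) / ?c - exp (?c * of_real 0) / ?c) {0..1}"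
  proof (rule fundamental_theorem_of_calculus)
    fix t :: real
    have "((\<lambda>z. exp (?c * z) / ?c) has_field_derivative exp (?c * of_real t)) (at (of_real t))"
      using c by (auto intro!: derivative_eq_intros)
    from has_vector_derivative_real_field [OF this]
    show "((\<lambda>t. exp (?c * of_real t) / ?c) has_vector_derivative exp (?c * of_real t)) (at t within {0..1})" .
  qed simp
  moreover have "exp ?c = 1" using exp_eq_1 [of ?c] by simp
  ultimately have "((\<lambda>t. exp (?c * of_real t)) has_integral 0) {0..1}" by simp
  then have "integral {0..1} (\<lambda>t. exp (?c * of_real t)) = 0" by (rule integral_unique)
  moreover have "(LINT t:{0..1}|lborel. exp (?c * of_real t)) = integral {0..1} (\<lambda>t. exp (?c * of_real t))"
    by (intro set_borel_integral_eq_integral(2) borel_integrable_atLeastAtMost') (intro continuous_intros)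
  ultimately show ?thesis using False by (simp add: set_lebesgue_integral_def mult_ac)
qed simp

text \<open>Restricted to the unit cube, the character is a product of functions of one coordinate
  each, so Fubini reduces the claim to \<open>integral_exp_period\<close>.\<close>

lemma torus_char_orthogonal: "(\<integral>x. torus_char k x \<partial>cube_measure) = (if k = 0 then 1 else 0)"
proof -
  define g where "g b t = indicator {0..1} t *\<^sub>R exp (2 * pi * \<i> * complex_of_real ((rvec k \<bullet> b) * t))"
    for b :: "real^3" and t :: real
  have ig: "integrable lborel (g b)" for b
  proof -
    have "set_integrable lborel {0..1} (\<lambda>t. exp (2 * pi * \<i> * complex_of_real ((rvec k \<bullet> b) * t)))"
      by (intro borel_integrable_atLeastAtMost') (intro continuous_intros)
    then show ?thesis unfolding set_integrable_def g_def .
  qed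
  have prod: "indicator unit_cube x *\<^sub>R torus_char k x = (\<Prod>b\<in>Basis. g b (x \<bullet> b))" for x
  proof -
    have 1: "indicator unit_cube x = (\<Prod>b\<in>Basis. indicator {0..1} (x \<bullet> b) :: real)"
    proof (cases "x \<in> unit_cube")
      case True
      then have "x \<bullet> b \<in> {0..1}" if "b \<in> Basis" for b
        using that by (auto simp: mem_box Basis_vec_def inner_axis)
      then show ?thesis using True by simp
    next
      case False
      then obtain i where "x $ i \<notin> {0..1}" by (auto simp: mem_box_cart)
      then have b: "(axis i 1 :: real^3) \<in> Basis" "x \<bullet> axis i 1 \<notin> {0..1}"
        by (auto simp: Basis_vec_def inner_axis)
      then show ?thesis using False by (subst prod_zero [of Basis]) (auto intro!: bexI [of _ "axis i 1"])
    qed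
    have "rvec k \<bullet> x = (\<Sum>b\<in>Basis. (rvec k \<bullet> b) * (x \<bullet> b))"
      by (rule euclidean_inner)
    then have "torus_char k x = (\<Prod>b\<in>Basis. exp (2 * pi * \<i> * complex_of_real ((rvec k \<bullet> b) * (x \<bullet> b))))"
      by (simp add: torus_char_def sum_distrib_left exp_sum)
    then show ?thesis
      by (simp add: 1 g_def scaleR_conv_of_real prod.distrib)
  qed
  have mg: "(\<lambda>x. \<Prod>b\<in>Basis. g b (x \<bullet> b)) \<in> borel_measurable borel"
    unfolding g_def by measurable
  interpret product_sigma_finite "\<lambda>b::real^3. lborel :: real measure" ..
  have "(\<integral>x. torus_char k x \<partial>cube_measure) = (\<integral>x. (\<Prod>b\<in>Basis. g b (x \<bullet> b)) \<partial>lebesgue)"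
    by (simp add: integral_restrict_space prod)
  also have "\<dots> = (\<integral>x. (\<Prod>b\<in>Basis. g b (x \<bullet> b)) \<partial>lborel)"
    using mg by (intro integral_completion) simp
  \<comment> \<open>\<open>lborel\<close> is the image of the product measure under the map that
    assembles a vector from its coordinates.\<close>
  also have "\<dots> = (\<integral>f. (\<Prod>b\<in>Basis. g b ((\<Sum>b\<in>Basis. f b *\<^sub>R b) \<bullet> b)) \<partial>(\<Pi>\<^sub>M b\<in>Basis. lborel))"
    unfolding lborel_eq [where 'a = "real^3"] using mg by (intro integral_distr) auto
  also have "\<dots> = (\<integral>f. (\<Prod>b\<in>Basis. g b (f b)) \<partial>(\<Pi>\<^sub>M b\<in>Basis. lborel))"
    by (intro Bochner_Integration.integral_cong prod.cong) (auto simp: inner_sum_left inner_Basis if_distrib cong: if_cong)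
  also have "\<dots> = (\<Prod>b\<in>Basis. \<integral>t. g b t \<partial>lborel)"
    by (intro product_integral_prod ig) simp
  also have "\<dots> = (\<Prod>b\<in>Basis. if rvec k \<bullet> b = 0 then 1 else 0)"
  proof (rule prod.cong)
    fix b :: "real^3" assume "b \<in> Basis"
    then obtain i where "b = axis i 1" by (auto simp: Basis_vec_def)
    then have "rvec k \<bullet> b = real_of_int (k $ i)" by (simp add: inner_axis rvec_def)
    then show "(\<integral>t. g b t \<partial>lborel) = (if rvec k \<bullet> b = 0 then 1 else 0)"
      unfolding g_def using integral_exp_period [of "k $ i"] by simp
  qed simp
  also have "\<dots> = (if k = 0 then 1 else 0)"
  proof (cases "k = 0")
    case False
    then obtain i where "k $ i \<noteq> 0" by (auto simp: vec_eq_iff)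
    then have "rvec k \<bullet> axis i 1 \<noteq> 0" by (simp add: inner_axis rvec_def)
    then show ?thesis using False
      by (subst prod_zero [of Basis]) (auto intro!: bexI [of _ "axis i 1"] simp: Basis_vec_def)
  qed simp
  finally show ?thesis .
qed

subsection \<open>Uniqueness of Fourier coefficients\<close>

text \<open>The test functions against which vanishing Fourier coefficients give a zero integral by
  linearity. They form an algebra, as the polynomial approximation below requires.\<close>

definition trig_poly :: "(real^3 \<Rightarrow> complex) \<Rightarrow> bool" where
  "trig_poly h \<longleftrightarrow> (\<exists>K c. finite K \<and> (\<forall>x. h x = (\<Sum>k\<in>K. c k * torus_char k x)))"

lemma trig_poly_monom: "trig_poly (\<lambda>x. c * torus_char k x)"
  unfolding trig_poly_def by (intro exI [of _ "{k}"] exI [of _ "\<lambda>_. c"]) simp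

lemma trig_poly_const: "trig_poly (\<lambda>x. c)"
  using trig_poly_monom [of c 0] by simp

lemma trig_poly_add:
  assumes "trig_poly f" "trig_poly g" shows "trig_poly (\<lambda>x. f x + g x)"
proof -
  obtain K c L d where K: "finite K" "\<And>x. f x = (\<Sum>k\<in>K. c k * torus_char k x)"
    and L: "finite L" "\<And>x. g x = (\<Sum>k\<in>L. d k * torus_char k x)"
    using assms by (auto simp: trig_poly_def)
  have "f x = (\<Sum>k\<in>K \<union> L. (if k \<in> K then c k else 0) * torus_char k x)" for x
    unfolding K using K L by (intro sum.mono_neutral_cong_left) auto
  moreover have "g x = (\<Sum>k\<in>K \<union> L. (if k \<in> L then d k else 0) * torus_char k x)" for x
    unfolding L using K L by (intro sum.mono_neutral_cong_left) auto
  ultimately have "f x + g x = (\<Sum>k\<in>K \<union> L. ((if k \<in> K then c k else 0) + (if k \<in> L then d k else 0)) * torus_char k x)" for x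
    by (simp only: ring_distribs sum.distrib)
  then show ?thesis
    unfolding trig_poly_def using K L
    by (intro exI [of _ "K \<union> L"] exI [of _ "\<lambda>k. (if k \<in> K then c k else 0) + (if k \<in> L then d k else 0)"]) simp
qed

lemma trig_poly_sum: "(\<And>i. i \<in> I \<Longrightarrow> trig_poly (f i)) \<Longrightarrow> trig_poly (\<lambda>x. \<Sum>i\<in>I. f i x)"
  by (induction I rule: infinite_finite_induct) (auto intro: trig_poly_const trig_poly_add)

lemma trig_poly_mult:
  assumes "trig_poly f" "trig_poly g" shows "trig_poly (\<lambda>x. f x * g x)"
proof -
  obtain K c L d where K: "finite K" "\<And>x. f x = (\<Sum>k\<in>K. c k * torus_char k x)"
    and L: "finite L" "\<And>x. g x = (\<Sum>k\<in>L. d k * torus_char k x)"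
    using assms by (auto simp: trig_poly_def)
  have "f x * g x = (\<Sum>k\<in>K. \<Sum>l\<in>L. (c k * d l) * torus_char (k + l) x)" for x
    unfolding K L sum_product by (simp add: torus_char_add mult_ac)
  then show ?thesis by (simp only:) (intro trig_poly_sum trig_poly_monom)
qed

text \<open>The embedding of the torus into complex 3-space. Its image is compact, it takes equal
  values at opposite faces of the cube, and real polynomials on the image pull back to trigonometric
  polynomials.\<close>

definition torus_map :: "real^3 \<Rightarrow> complex^3" where
  "torus_map x = (\<chi> i. exp (2 * pi * \<i> * complex_of_real (x $ i)))"

lemma continuous_on_torus_map: "continuous_on S torus_map"
  unfolding torus_map_def by (intro continuous_intros)

lemma torus_map_inj:
  assumes "torus_map x = torus_map y" "\<And>i. 0 \<le> x $ i" "\<And>i. x $ i < 1" "\<And>i. 0 \<le> y $ i" "\<And>i. y $ i < 1"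
  shows "x = y"
proof -
  have "x $ i = y $ i" for i
  proof -
    have "exp (2 * pi * \<i> * complex_of_real (x $ i)) = exp (2 * pi * \<i> * complex_of_real (y $ i))"
      using assms(1) by (simp add: torus_map_def vec_eq_iff)
    then obtain n :: int where "2 * pi * \<i> * complex_of_real (x $ i) = 2 * pi * \<i> * complex_of_real (y $ i) + of_int (2 * n) * pi * \<i>"
      unfolding exp_eq by blast
    then have "2 * pi * \<i> * complex_of_real (x $ i) = 2 * pi * \<i> * complex_of_real (y $ i + of_int n)"
      by (simp add: algebra_simps)
    then have "x $ i = y $ i + of_int n" unfolding mult_cancel_left of_real_eq_iff by simp
    moreover from this have "n = 0" using assms(2-5) [of i] by linarith
    ultimately show ?thesis by simp
  qed
  then show ?thesis by (simp add: vec_eq_iff)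
qed

lemma trig_poly_coordinate:
  "trig_poly (\<lambda>x. of_real (Re (torus_map x $ i)))" "trig_poly (\<lambda>x. of_real (Im (torus_map x $ i)))"
proof -
  have 1: "torus_map x $ i = torus_char (axis i 1) x" for x
    by (simp add: torus_map_def torus_char_def rvec_def inner_vec_def axis_def if_distrib if_distribR cong: if_cong)
  have "of_real (Re (torus_map x $ i)) = 1 / 2 * torus_char (axis i 1) x + 1 / 2 * torus_char (- axis i 1) x" for x
    unfolding 1 torus_char_uminus by (simp add: complex_eq_iff)
  then show "trig_poly (\<lambda>x. of_real (Re (torus_map x $ i)))"
    by (simp only:) (intro trig_poly_add trig_poly_monom)
  have "of_real (Im (torus_map x $ i)) = - \<i> / 2 * torus_char (axis i 1) x + \<i> / 2 * torus_char (- axis i 1) x" for x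
    unfolding 1 torus_char_uminus by (simp add: complex_eq_iff)
  then show "trig_poly (\<lambda>x. of_real (Im (torus_map x $ i)))"
    by (simp only:) (intro trig_poly_add trig_poly_monom)
qed

lemma trig_poly_polynomial:
  assumes "real_polynomial_function p"
  shows "trig_poly (\<lambda>x. of_real (p (torus_map x)))"
  using assms
proof (induction rule: real_polynomial_function.induct)
  case (linear f)
  interpret bounded_linear f by (rule linear)
  \<comment> \<open>A real linear functional on complex 3-space is expanded in the real basis
    \<open>axis i 1\<close>, \<open>axis i \<i>\<close>, whose coordinate functions pull back to
    cosines and sines.\<close>
  have lin: "f z = (\<Sum>i\<in>UNIV. Re (z $ i) * f (axis i 1) + Im (z $ i) * f (axis i \<i>))" for z
  proof -
    have "z = (\<Sum>i\<in>UNIV. Re (z $ i) *\<^sub>R axis i 1 + Im (z $ i) *\<^sub>R axis i \<i>)"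
      by (simp add: vec_eq_iff axis_def if_distrib complex_eq_iff if_distribR cong: if_cong)
    then have "f z = f (\<Sum>i\<in>UNIV. Re (z $ i) *\<^sub>R axis i 1 + Im (z $ i) *\<^sub>R axis i \<i>)" by simp
    then show ?thesis by (simp add: sum add scale)
  qed
  have "complex_of_real (f (torus_map x)) = (\<Sum>i\<in>UNIV. of_real (Re (torus_map x $ i)) * of_real (f (axis i 1)) + of_real (Im (torus_map x $ i)) * of_real (f (axis i \<i>)))" for x
    by (subst lin) simp
  then show ?case
    by (simp only:) (intro trig_poly_sum trig_poly_add trig_poly_mult trig_poly_const trig_poly_coordinate)
qed (simp_all add: trig_poly_const trig_poly_add trig_poly_mult)

lemma integral_trig_poly_zero:
  assumes f: "integrable cube_measure f" "\<And>k. fourier_coeff f k = 0" and h: "trig_poly h"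
  shows "(\<integral>x. of_real (f x) * h x \<partial>cube_measure) = 0"
proof -
  obtain K c where K: "finite K" "\<And>x. h x = (\<Sum>k\<in>K. c k * torus_char k x)"
    using h by (auto simp: trig_poly_def)
  have i: "integrable cube_measure (\<lambda>x. torus_char k x * complex_of_real (f x))" for k
    using f(1) by (intro integrable_cube_continuous_mult [where B = 1] continuous_intros integrable_of_real) auto
  have "(\<integral>x. of_real (f x) * h x \<partial>cube_measure) = (\<integral>x. (\<Sum>k\<in>K. c k * (torus_char k x * of_real (f x))) \<partial>cube_measure)"
    by (simp add: K sum_distrib_left mult_ac)
  also have "\<dots> = (\<Sum>k\<in>K. c k * (\<integral>x. torus_char k x * of_real (f x) \<partial>cube_measure))"
    using i by (subst Bochner_Integration.integral_sum) auto
  also have "\<dots> = (\<Sum>k\<in>K. c k * fourier_coeff f (- k))"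
    by (simp add: fourier_coeff_eq mult.commute)
  finally show ?thesis by (simp add: f)
qed

text \<open>By Stone-Weierstrass, G is uniformly approximated by polynomials on the image of the
  cube, at a cost of e times the L^1 norm of f.\<close>

lemma integral_torus_continuous_zero:
  assumes f: "integrable cube_measure f" "\<And>k. fourier_coeff f k = 0"
    and G: "continuous_on UNIV G"
  shows "(\<integral>x. G (torus_map x) * f x \<partial>cube_measure) = 0"
proof -
  let ?Z = "torus_map ` unit_cube"
  have Z: "compact ?Z" by (intro compact_continuous_image continuous_on_torus_map compact_cbox)
  have bdd: "integrable cube_measure (\<lambda>x. g (torus_map x) * f x)" if "continuous_on ?Z g" for g
  proof -
    have "bounded (g ` ?Z)" using Z that compact_continuous_image compact_imp_bounded by blast
    then obtain B where B: "\<And>z. z \<in> ?Z \<Longrightarrow> norm (g z) \<le> B" by (auto simp: bounded_iff)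
    show ?thesis
      using B continuous_on_compose2 [OF that continuous_on_torus_map [of unit_cube]]
      by (intro integrable_cube_continuous_mult [where B = B] f) auto
  qed
  define I where "I = (\<integral>x. \<bar>f x\<bar> \<partial>cube_measure)"
  have I0: "0 \<le> I" unfolding I_def by simp
  have "\<bar>\<integral>x. G (torus_map x) * f x \<partial>cube_measure\<bar> \<le> e * I" if e: "0 < e" for e
  proof -
    obtain p where p: "real_polynomial_function p" "\<And>z. z \<in> ?Z \<Longrightarrow> \<bar>G z - p z\<bar> < e"
      using Stone_Weierstrass_real_polynomial_function [OF Z continuous_on_subset [OF G subset_UNIV] e] by blast
    have "complex_of_real (\<integral>x. f x * p (torus_map x) \<partial>cube_measure) = (\<integral>x. of_real (f x) * of_real (p (torus_map x)) \<partial>cube_measure)"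
      by (simp flip: of_real_mult)
    also have "\<dots> = 0" by (intro integral_trig_poly_zero f trig_poly_polynomial p)
    finally have 0: "(\<integral>x. p (torus_map x) * f x \<partial>cube_measure) = 0" by (simp add: mult.commute)
    have cp: "continuous_on ?Z p"
      using p(1) continuous_on_polymonial_function real_polynomial_function_eq by blast
    have iG: "integrable cube_measure (\<lambda>x. G (torus_map x) * f x)"
      and ip: "integrable cube_measure (\<lambda>x. p (torus_map x) * f x)"
      using bdd [of G] bdd [of p] G cp continuous_on_subset by blast+
    have "(\<integral>x. G (torus_map x) * f x \<partial>cube_measure) = (\<integral>x. G (torus_map x) * f x - p (torus_map x) * f x \<partial>cube_measure)"
      using iG ip 0 by simp
    also have "\<bar>\<dots>\<bar> \<le> (\<integral>x. \<bar>G (torus_map x) * f x - p (torus_map x) * f x\<bar> \<partial>cube_measure)"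
      by (rule integral_abs_bound)
    also have "\<dots> \<le> (\<integral>x. e * \<bar>f x\<bar> \<partial>cube_measure)"
    proof (rule integral_mono)
      show "integrable cube_measure (\<lambda>x. \<bar>G (torus_map x) * f x - p (torus_map x) * f x\<bar>)"
        using iG ip by (intro integrable_abs Bochner_Integration.integrable_diff)
      show "integrable cube_measure (\<lambda>x. e * \<bar>f x\<bar>)" using f(1) by simp
      fix x assume "x \<in> space cube_measure"
      then have "\<bar>G (torus_map x) - p (torus_map x)\<bar> \<le> e" using p(2) [of "torus_map x"] by force
      then show "\<bar>G (torus_map x) * f x - p (torus_map x) * f x\<bar> \<le> e * \<bar>f x\<bar>"
        by (simp add: abs_mult mult_right_mono flip: left_diff_distrib)
    qed
    finally show ?thesis by (simp add: I_def)
  qed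
  note approx = this
  have "\<bar>\<integral>x. G (torus_map x) * f x \<partial>cube_measure\<bar> \<le> 0 + e" if "0 < e" for e
  proof -
    \<comment> \<open>The summand 1 avoids division by zero when f has vanishing L^1 norm.\<close>
    have "\<bar>\<integral>x. G (torus_map x) * f x \<partial>cube_measure\<bar> \<le> e / (I + 1) * I"
      using that I0 by (intro approx) simp
    also have "\<dots> \<le> 0 + e" using that I0 by (simp add: field_simps)
    finally show ?thesis .
  qed
  then have "\<bar>\<integral>x. G (torus_map x) * f x \<partial>cube_measure\<bar> \<le> 0" by (rule field_le_epsilon)
  then show ?thesis by simp
qed

text \<open>Passes from continuous functions to indicators of closed sets by dominated convergence,
  with |f| as majorant.\<close>

lemma integral_torus_closed_zero:
  assumes f: "integrable cube_measure f" "\<And>k. fourier_coeff f k = 0"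
    and C: "closed C" "C \<noteq> {}"
  shows "(\<lambda>x. indicator C (torus_map x) * f x) \<in> borel_measurable cube_measure"
    and "(\<integral>x. indicator C (torus_map x) * f x \<partial>cube_measure) = 0"
proof -
  \<comment> \<open>Continuous cut-offs decreasing to the indicator of C. Off C the distance must be
    positive; for the empty set it would be 0 by convention.\<close>
  define G where "G n z = max 0 (1 - real n * infdist z C)" for n z
  have cG: "continuous_on S (G n)" for S n unfolding G_def by (intro continuous_intros)
  have lim: "(\<lambda>n. G n z) \<longlonglongrightarrow> indicator C z" for z
  proof (cases "z \<in> C")
    case False
    then have pos: "infdist z C > 0" using C infdist_pos_not_in_closed by blast
    then obtain N where "1 < real N * infdist z C" using reals_Archimedean3 by blast
    then have "G n z = 0" if "n \<ge> N" for n
      unfolding G_def using that pos mult_right_mono [of "real N" "real n" "infdist z C"]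
      by (intro max_absorb1) linarith
    then have "eventually (\<lambda>n. G n z = 0) sequentially" by (auto simp: eventually_sequentially)
    then show ?thesis using False by (simp add: tendsto_eventually)
  qed (simp add: G_def)
  have t: "torus_map \<in> borel_measurable cube_measure"
    by (intro continuous_imp_measurable_on_sets_lebesgue continuous_on_torus_map) simp
  have "(indicator C :: _ \<Rightarrow> real) \<in> borel_measurable borel" using C by (intro borel_measurable_indicator) auto
  then have "(\<lambda>x. indicator C (torus_map x) :: real) \<in> borel_measurable cube_measure"
    by (rule measurable_compose [OF t])
  then show m: "(\<lambda>x. indicator C (torus_map x) * f x) \<in> borel_measurable cube_measure"
    using f(1) by (intro borel_measurable_times) auto
  have "(\<lambda>n. \<integral>x. G n (torus_map x) * f x \<partial>cube_measure) \<longlonglongrightarrow> (\<integral>x. indicator C (torus_map x) * f x \<partial>cube_measure)"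
  proof (rule integral_dominated_convergence [where w = "\<lambda>x. \<bar>f x\<bar>"])
    show "integrable cube_measure (\<lambda>x. \<bar>f x\<bar>)" using f by simp
    show "(\<lambda>x. indicator C (torus_map x) * f x) \<in> borel_measurable cube_measure" by (rule m)
    have "(\<lambda>x. G n (torus_map x)) \<in> borel_measurable cube_measure" for n
      by (intro continuous_imp_measurable_on_sets_lebesgue continuous_on_compose2 [OF cG continuous_on_torus_map]) auto
    then show "(\<lambda>x. G n (torus_map x) * f x) \<in> borel_measurable cube_measure" for n
      using f(1) by (intro borel_measurable_times) auto
    show "AE x in cube_measure. (\<lambda>n. G n (torus_map x) * f x) \<longlonglongrightarrow> indicator C (torus_map x) * f x"
      by (intro AE_I2 tendsto_intros lim)
    show "AE x in cube_measure. norm (G n (torus_map x) * f x) \<le> \<bar>f x\<bar>" for n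
    proof (intro AE_I2)
      fix x
      have "0 \<le> real n * infdist (torus_map x) C" by (simp add: infdist_nonneg)
      then have "\<bar>G n (torus_map x)\<bar> \<le> 1" unfolding G_def by linarith
      then show "norm (G n (torus_map x) * f x) \<le> \<bar>f x\<bar>"
        by (simp add: abs_mult mult_left_le_one_le)
    qed
  qed
  moreover have "(\<integral>x. G n (torus_map x) * f x \<partial>cube_measure) = 0" for n
    by (intro integral_torus_continuous_zero f cG)
  ultimately show "(\<integral>x. indicator C (torus_map x) * f x \<partial>cube_measure) = 0"
    by (simp add: LIMSEQ_const_iff)
qed

text \<open>A fundamental domain on which \<open>torus_map\<close> is injective; the faces it omits
  from the closed cube form a null set.\<close>

definition half_cube :: "(real^3) set" where
  "half_cube = {x. \<forall>i. 0 \<le> x $ i \<and> x $ i < 1}"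

lemma half_cube_subset: "half_cube \<subseteq> unit_cube"
  by (auto simp: half_cube_def mem_box_cart less_imp_le)

lemma negligible_cube_minus_half: "negligible (unit_cube - half_cube)"
proof -
  have "unit_cube - half_cube \<subseteq> (\<Union>i. {x. x $ i = 1})"
    by (auto simp: half_cube_def mem_box_cart) (metis antisym not_le)
  moreover have "negligible (\<Union>i::3. {x::real^3. x $ i = 1})"
  proof (intro negligible_Union)
    fix S assume "S \<in> range (\<lambda>i::3. {x::real^3. x $ i = 1})"
    then obtain i where "S = {x. axis i 1 \<bullet> x = 1}" by (auto simp: inner_axis')
    then show "negligible S" using negligible_hyperplane [of "axis i 1 :: real^3" 1] by (simp add: axis_eq_0_iff)
  qed simp
  ultimately show ?thesis using negligible_subset by blast
qed

lemma half_cube_lmeasurable: "half_cube \<in> sets lebesgue"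
proof -
  have "half_cube = unit_cube - (unit_cube - half_cube)" using half_cube_subset by blast
  then show ?thesis
    using negligible_cube_minus_half by (metis negligible_imp_sets sets.Diff lmeasurable_cbox fmeasurableD)
qed

text \<open>Inner regularity supplies a closed subset T of the superlevel set S that fills it up to
  measure d. T is compact, so its image under \<open>torus_map\<close> is closed, and by injectivity
  on the half-open cube f integrates to 0 over T. As f \<ge> e there, T is null, so S has measure
  below every d.\<close>

lemma negligible_superlevel_if_fourier_zero:
  assumes f: "integrable cube_measure f" "\<And>k. fourier_coeff f k = 0" and e: "0 < e"
  shows "negligible {x \<in> half_cube. e \<le> f x}"
proof -
  define S where "S = {x \<in> half_cube. e \<le> f x}"
  have fm: "f \<in> borel_measurable cube_measure" using f(1) by auto
  have "{x \<in> space cube_measure. e \<le> f x} \<in> sets cube_measure"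
    using fm by measurable
  then have "{x \<in> unit_cube. e \<le> f x} \<in> sets lebesgue"
    by (simp add: sets_restrict_space_iff)
  moreover have "S = {x \<in> unit_cube. e \<le> f x} \<inter> half_cube" using half_cube_subset by (auto simp: S_def)
  ultimately have S: "S \<in> sets lebesgue" using half_cube_lmeasurable by simp
  have small: "emeasure lebesgue S < ennreal d" if d: "d > 0" for d
  proof -
    obtain T where T: "closed T" "T \<subseteq> S" "S - T \<in> lmeasurable" "emeasure lebesgue (S - T) < ennreal d"
      using sets_lebesgue_inner_closed [OF S d] by blast
    have Tc: "T \<subseteq> unit_cube" using T half_cube_subset by (auto simp: S_def)
    then have "compact T" using T(1) by (metis bounded_cbox bounded_subset compact_eq_bounded_closed)
    have "emeasure lebesgue T = 0"
    proof (cases "T = {}")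
      case False
      have C: "closed (torus_map ` T)"
        by (intro compact_imp_closed compact_continuous_image continuous_on_torus_map \<open>compact T\<close>)
      have "(\<integral>x. indicator (torus_map ` T) (torus_map x) * f x \<partial>cube_measure) = 0"
        using False by (intro integral_torus_closed_zero(2) f C) simp
      moreover have "AE x in cube_measure. indicator (torus_map ` T) (torus_map x) * f x = indicator T x * f x"
      proof -
        have eq: "indicator (torus_map ` T) (torus_map x) * f x = indicator T x * f x" if "x \<in> half_cube" for x
        proof -
          have "torus_map x \<in> torus_map ` T \<longleftrightarrow> x \<in> T"
            using that T(2) torus_map_inj by (auto simp: S_def half_cube_def) blast
          then show ?thesis by (simp add: indicator_def)
        qed
        have "AE x in lebesgue. x \<notin> unit_cube - half_cube"
          using negligible_cube_minus_half by (intro AE_not_in) (simp add: negligible_iff_null_sets)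
        then show ?thesis
          by (subst AE_restrict_space_iff) (use eq in \<open>auto elim!: eventually_mono\<close>)
      qed
      moreover have iT: "integrable cube_measure (\<lambda>x. indicator T x * f x)"
        using integrable_real_mult_indicator [of T cube_measure f] f(1) T(1) Tc
        by (simp add: sets_restrict_space_iff mult.commute)
      ultimately have "(\<integral>x. indicator T x * f x \<partial>cube_measure) = 0"
        using integral_cong_AE [of "\<lambda>x. indicator (torus_map ` T) (torus_map x) * f x" cube_measure "\<lambda>x. indicator T x * f x"]
          integral_torus_closed_zero(1) [OF f C] False by simp
      moreover have "e * measure lebesgue T \<le> (\<integral>x. indicator T x * f x \<partial>cube_measure)"
      proof -
        have TL: "T \<in> lmeasurable" using \<open>compact T\<close> by (rule lmeasurable_compact)
        have "e * measure lebesgue T = (\<integral>x. e * indicator T x \<partial>cube_measure)"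
          using Tc TL by (simp add: measure_restrict_space inf.absorb1)
        also have "\<dots> \<le> (\<integral>x. indicator T x * f x \<partial>cube_measure)"
        proof (rule integral_mono [OF _ iT])
          have "integrable cube_measure (\<lambda>x. 1 * indicator T x :: real)"
            using Tc TL by (intro integrable_real_mult_indicator integrable_cube_const) (simp add: sets_restrict_space_iff)
          then show "integrable cube_measure (\<lambda>x. e * indicator T x)" by simp
          show "e * indicator T x \<le> indicator T x * f x" for x
            using T(2) by (auto simp: indicator_def S_def)
        qed
        finally show ?thesis .
      qed
      ultimately have "measure lebesgue T \<le> 0" using e by (simp add: mult_le_0_iff)
      then have "measure lebesgue T = 0" by (simp add: measure_le_0_iff)
      then show ?thesis using \<open>compact T\<close> lmeasurable_compact
        by (metis emeasure_eq_measure2 ennreal_0)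
    qed simp
    moreover have "emeasure lebesgue S \<le> emeasure lebesgue T + emeasure lebesgue (S - T)"
      using emeasure_subadditive [of T lebesgue "S - T"] T S
      by (metis Un_Diff_cancel Un_absorb1 fmeasurableD borel_closed sets_completionI_sets sets_lborel)
    ultimately show ?thesis using T(4) by simp
  qed
  have "emeasure lebesgue S < \<infinity>" using small [of 1] by (simp add: order_less_trans)
  then have fin: "emeasure lebesgue S = ennreal (measure lebesgue S)"
    by (intro emeasure_eq_ennreal_measure) auto
  have "measure lebesgue S = 0"
  proof (rule ccontr)
    assume "measure lebesgue S \<noteq> 0"
    then have "measure lebesgue S > 0" by (simp add: zero_less_measure_iff)
    from small [OF this] fin show False by simp
  qed
  then have "emeasure lebesgue S = 0" using fin by simp
  then show ?thesis using S by (simp add: negligible_iff_null_sets null_sets_def S_def)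
qed

text \<open>Where f does not vanish, f or -f exceeds some 1 / (n + 1); countably many null
  superlevel sets cover these points apart from the omitted faces.\<close>

lemma fourier_uniqueness:
  assumes f: "integrable cube_measure f" "\<And>k. fourier_coeff f k = 0"
  shows "AE x in cube_measure. f x = 0"
proof -
  let ?N = "\<lambda>f. \<Union>n. {x \<in> half_cube. 1 / real (Suc n) \<le> f x}"
  have neg: "negligible (?N g)" if "integrable cube_measure g" "\<And>k. fourier_coeff g k = 0" for g
    using that by (intro negligible_countable_Union) (auto intro!: negligible_superlevel_if_fourier_zero)
  have m: "fourier_coeff (\<lambda>x. - f x) k = 0" for k
    using f(2) [of k] by (simp add: fourier_coeff_eq)
  have "{x \<in> unit_cube. f x \<noteq> 0} \<subseteq> (unit_cube - half_cube) \<union> ?N f \<union> ?N (\<lambda>x. - f x)"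
  proof
    fix x assume x: "x \<in> {x \<in> unit_cube. f x \<noteq> 0}"
    then have "0 < \<bar>f x\<bar>" by simp
    then obtain n where "1 / real (Suc n) < \<bar>f x\<bar>"
      using nat_approx_posE by metis
    then have "1 / real (Suc n) \<le> f x \<or> 1 / real (Suc n) \<le> - f x" by linarith
    then show "x \<in> (unit_cube - half_cube) \<union> ?N f \<union> ?N (\<lambda>x. - f x)" using x by blast
  qed
  moreover have "negligible ((unit_cube - half_cube) \<union> ?N f \<union> ?N (\<lambda>x. - f x))"
    using f m by (intro negligible_Un negligible_cube_minus_half neg) auto
  ultimately have "negligible {x \<in> unit_cube. f x \<noteq> 0}" by (rule negligible_subset [rotated])
  then have "AE x in lebesgue. x \<notin> {x \<in> unit_cube. f x \<noteq> 0}"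
    by (intro AE_not_in) (simp add: negligible_iff_null_sets)
  then show ?thesis by (subst AE_restrict_space_iff) auto
qed

section \<open>From the unit cube to the whole space\<close>

lemma periodic3_rvec:
  assumes "periodic3 u" shows "u (x + rvec k) = u x"
proof -
  have nat: "u (x + of_nat n *\<^sub>R axis i 1) = u x" for x i n
  proof (induction n)
    case (Suc n)
    have "u (x + of_nat (Suc n) *\<^sub>R axis i 1) = u ((x + of_nat n *\<^sub>R axis i 1) + axis i 1)"
      by (simp add: algebra_simps)
    also have "\<dots> = u (x + of_nat n *\<^sub>R axis i 1)"
      using assms unfolding periodic3_def by blast
    finally show ?case using Suc by simp
  qed simp
  have int: "u (x + of_int m *\<^sub>R axis i 1) = u x" for x i m
  proof (cases m rule: int_cases2)
    case (nonneg n)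
    then show ?thesis using nat by simp
  next
    case (nonpos n)
    then show ?thesis using nat [of "x + of_int m *\<^sub>R axis i 1" n i] by simp
  qed
  have "u (x + (\<Sum>i\<in>I. of_int (k $ i) *\<^sub>R axis i 1)) = u x" for I :: "3 set"
  proof (induction I rule: infinite_finite_induct)
    case (insert i I)
    then have "u (x + (\<Sum>i\<in>insert i I. of_int (k $ i) *\<^sub>R axis i 1)) = u ((x + (\<Sum>i\<in>I. of_int (k $ i) *\<^sub>R axis i 1)) + of_int (k $ i) *\<^sub>R axis i 1)"
      by (simp add: algebra_simps)
    then show ?case using insert int by simp
  qed simp_all
  moreover have "rvec k = (\<Sum>i\<in>UNIV. of_int (k $ i) *\<^sub>R axis i 1)"
    by (simp add: rvec_def vec_eq_iff axis_def if_distrib if_distribR cong: if_cong)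
  ultimately show ?thesis by simp
qed

lemma countable_int3: "countable (UNIV :: (int^3) set)"
proof -
  have "inj (\<lambda>k :: int^3. (k $ 1, k $ 2, k $ 3))"
    by (auto simp: inj_def vec_eq_iff) (metis exhaust_3)
  then show ?thesis by (rule countable_image_inj_on [rotated, of _ _ ]) auto
qed

text \<open>The exceptional set is covered by countably many integer translates of its part in the
  unit cube.\<close>

lemma ae_eq_if_AE_cube:
  assumes "periodic3 u" "periodic3 w" "AE x in cube_measure. u x = w x"
  shows "ae_eq u w"
proof -
  let ?N = "{x \<in> unit_cube. u x \<noteq> w x}"
  have "AE x in lebesgue. x \<in> unit_cube \<longrightarrow> u x = w x"
    using assms(3) by (subst (asm) AE_restrict_space_iff) auto
  then have "negligible ?N"
    unfolding eventually_ae_filter_negligible using negligible_subset by (auto simp: Collect_conj_eq)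
  have "{x. u x \<noteq> w x} \<subseteq> (\<Union>k. (+) (rvec k) ` ?N)"
  proof
    fix x assume x: "x \<in> {x. u x \<noteq> w x}"
    define k :: "int^3" where "k = (\<chi> i. \<lfloor>x $ i\<rfloor>)"
    have "x - rvec k \<in> unit_cube"
      by (auto simp: mem_box_cart k_def rvec_def) linarith+
    moreover have "u (x - rvec k) = u x" "w (x - rvec k) = w x"
      using periodic3_rvec [OF assms(1), of x "- k"] periodic3_rvec [OF assms(2), of x "- k"] by simp_all
    ultimately have "x - rvec k \<in> ?N" using x by simp
    then have "x \<in> (+) (rvec k) ` ?N" by (intro image_eqI [of _ _ "x - rvec k"]) auto
    then show "x \<in> (\<Union>k. (+) (rvec k) ` ?N)" by blast
  qed
  moreover have "negligible (\<Union>k. (+) (rvec k) ` ?N)"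
  proof -
    have "negligible (\<Union>((\<lambda>k. (+) (rvec k) ` ?N) ` UNIV))"
      using countable_int3 \<open>negligible ?N\<close>
      by (intro negligible_countable_Union) (auto intro!: negligible_translation)
    then show ?thesis by simp
  qed
  ultimately have "negligible {x. u x \<noteq> w x}" by (rule negligible_subset [rotated])
  then have "AE x in lebesgue. x \<notin> {x. u x \<noteq> w x}"
    by (intro AE_not_in) (simp add: negligible_iff_null_sets)
  then show ?thesis by (simp add: ae_eq_def)
qed

subsection \<open>Absolutely convergent Fourier series\<close>

abbreviation abs_summable_coeffs :: "(int^3 \<Rightarrow> complex) \<Rightarrow> bool" where
  "abs_summable_coeffs c \<equiv> (\<lambda>k. norm (c k)) summable_on UNIV"

definition fourier_series :: "(int^3 \<Rightarrow> complex) \<Rightarrow> real^3 \<Rightarrow> complex" where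
  "fourier_series c x = (\<Sum>\<^sub>\<infinity>k. c k * torus_char k x)"

lemma fourier_series_uniform_limit:
  assumes "abs_summable_coeffs c"
  shows "uniform_limit UNIV (\<lambda>K x. \<Sum>k\<in>K. c k * torus_char k x) (fourier_series c) (finite_subsets_at_top UNIV)"
  unfolding fourier_series_def [abs_def] using assms
  by (intro Weierstrass_m_test_general [where M = "\<lambda>k. norm (c k)"]) (auto simp: norm_mult)

lemma continuous_on_fourier_series:
  assumes "abs_summable_coeffs c" shows "continuous_on S (fourier_series c)"
  using assms continuous_on_subset [OF _ subset_UNIV]
  by (intro uniform_limit_theorem [OF _ uniform_limit_on_subset [OF fourier_series_uniform_limit subset_UNIV]])
    (auto intro!: always_eventually continuous_intros)

lemma norm_fourier_series_le:
  assumes "abs_summable_coeffs c" shows "norm (fourier_series c x) \<le> (\<Sum>\<^sub>\<infinity>k. norm (c k))"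
  unfolding fourier_series_def using norm_infsum_bound [of "\<lambda>k. c k * torus_char k x" UNIV] assms by (simp add: norm_mult)

lemma periodic3_fourier_series: "periodic3 (fourier_series c)"
  using periodic3_torus_char by (simp add: periodic3_def fourier_series_def)

text \<open>The series converges uniformly, so its partial sums may be integrated against an
  integrable g and passed to the limit.\<close>

lemma integral_fourier_series_mult:
  assumes c: "abs_summable_coeffs c" and g: "integrable cube_measure g"
  shows "((\<lambda>k. c k * (\<integral>x. torus_char k x * g x \<partial>cube_measure)) has_sum (\<integral>x. fourier_series c x * g x \<partial>cube_measure)) UNIV"
  unfolding has_sum_def
proof (rule tendstoI)
  fix e :: real assume e: "e > 0"
  define I where "I = (\<integral>x. norm (g x) \<partial>cube_measure)"
  have I0: "0 \<le> I" by (simp add: I_def)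
  have ik: "integrable cube_measure (\<lambda>x. torus_char k x * g x)" for k
    by (intro integrable_cube_continuous_mult [where B = 1] g continuous_intros) auto
  have iF: "integrable cube_measure (\<lambda>x. fourier_series c x * g x)"
    by (intro integrable_cube_continuous_mult [OF g continuous_on_fourier_series [OF c] norm_fourier_series_le [OF c]])
  have "eventually (\<lambda>K. \<forall>x\<in>UNIV. dist (\<Sum>k\<in>K. c k * torus_char k x) (fourier_series c x) < e / (I + 1)) (finite_subsets_at_top UNIV)"
    using fourier_series_uniform_limit [OF c] e I0 by (intro uniform_limitD) auto
  moreover have "eventually finite (finite_subsets_at_top (UNIV :: (int^3) set))"
    by (simp add: eventually_finite_subsets_at_top_weakI)
  ultimately show "\<forall>\<^sub>F K in finite_subsets_at_top UNIV.
      dist (\<Sum>k\<in>K. c k * (\<integral>x. torus_char k x * g x \<partial>cube_measure)) (\<integral>x. fourier_series c x * g x \<partial>cube_measure) < e"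
  proof eventually_elim
    case (elim K)
    have iK: "integrable cube_measure (\<lambda>x. (\<Sum>k\<in>K. c k * torus_char k x) * g x)"
      unfolding sum_distrib_right using ik by (intro Bochner_Integration.integrable_sum) (simp add: mult.assoc)
    have "(\<Sum>k\<in>K. c k * (\<integral>x. torus_char k x * g x \<partial>cube_measure)) = (\<Sum>k\<in>K. \<integral>x. c k * (torus_char k x * g x) \<partial>cube_measure)"
      by simp
    also have "\<dots> = (\<integral>x. (\<Sum>k\<in>K. c k * (torus_char k x * g x)) \<partial>cube_measure)"
      using ik by (intro Bochner_Integration.integral_sum [symmetric]) simp
    also have "\<dots> = (\<integral>x. (\<Sum>k\<in>K. c k * torus_char k x) * g x \<partial>cube_measure)"
      by (simp add: sum_distrib_right mult.assoc)
    finally have "dist (\<Sum>k\<in>K. c k * (\<integral>x. torus_char k x * g x \<partial>cube_measure)) (\<integral>x. fourier_series c x * g x \<partial>cube_measure)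
        = norm (\<integral>x. (\<Sum>k\<in>K. c k * torus_char k x) * g x - fourier_series c x * g x \<partial>cube_measure)"
      using iK iF by (simp add: dist_norm)
    also have "\<dots> \<le> (\<integral>x. norm ((\<Sum>k\<in>K. c k * torus_char k x) * g x - fourier_series c x * g x) \<partial>cube_measure)"
      by (rule integral_norm_bound)
    also have "\<dots> \<le> (\<integral>x. e / (I + 1) * norm (g x) \<partial>cube_measure)"
    proof (rule integral_mono)
      show "integrable cube_measure (\<lambda>x. norm ((\<Sum>k\<in>K. c k * torus_char k x) * g x - fourier_series c x * g x))"
        using iK iF by (intro integrable_norm Bochner_Integration.integrable_diff)
      show "integrable cube_measure (\<lambda>x. e / (I + 1) * norm (g x))"
        using g by (intro integrable_mult_right integrable_norm)
      fix x
      have "dist (\<Sum>k\<in>K. c k * torus_char k x) (fourier_series c x) < e / (I + 1)" using elim(1) by simp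
      then have "norm ((\<Sum>k\<in>K. c k * torus_char k x) - fourier_series c x) * norm (g x) \<le> e / (I + 1) * norm (g x)"
        by (intro mult_right_mono) (auto simp: dist_norm)
      then show "norm ((\<Sum>k\<in>K. c k * torus_char k x) * g x - fourier_series c x * g x) \<le> e / (I + 1) * norm (g x)"
        by (simp flip: norm_mult left_diff_distrib)
    qed
    also have "\<dots> = e / (I + 1) * I" by (simp add: I_def)
    also have "\<dots> < e" using I0 e by (simp add: field_simps)
    finally show ?case .
  qed
qed

lemma integral_fourier_series_torus_char:
  assumes c: "abs_summable_coeffs c"
  shows "(\<integral>x. fourier_series c x * torus_char (- k) x \<partial>cube_measure) = c k"
proof -
  have "((\<lambda>l. c l * (\<integral>x. torus_char l x * torus_char (- k) x \<partial>cube_measure)) has_sum (\<integral>x. fourier_series c x * torus_char (- k) x \<partial>cube_measure)) UNIV"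
    by (intro integral_fourier_series_mult c integrable_cube_continuous continuous_intros)
  moreover have "(\<integral>x. torus_char l x * torus_char (- k) x \<partial>cube_measure) = (if l = k then 1 else 0)" for l
    using torus_char_orthogonal [of "l - k"] by (simp flip: torus_char_add)
  ultimately have "((\<lambda>l. c l * (if l = k then 1 else 0)) has_sum (\<integral>x. fourier_series c x * torus_char (- k) x \<partial>cube_measure)) UNIV"
    by simp
  moreover have "((\<lambda>l. c l * (if l = k then 1 else 0)) has_sum c k) UNIV"
    using has_sum_cong_neutral [of "{k}" UNIV "\<lambda>l. c l * (if l = k then 1 else 0)" "\<lambda>l. c l * (if l = k then 1 else 0)" "c k"]
      has_sum_finite [of "{k}" "\<lambda>l. c l * (if l = k then 1 else 0)"] by simp
  ultimately show ?thesis by (rule infsumI [symmetric, THEN trans, OF _ infsumI])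
qed

lemma cnj_fourier_series:
  assumes c: "abs_summable_coeffs c" "\<And>k. c (- k) = cnj (c k)"
  shows "cnj (fourier_series c x) = fourier_series c x"
proof -
  have "((\<lambda>k. c k * torus_char k x) has_sum fourier_series c x) UNIV"
    unfolding fourier_series_def using c(1)
    by (intro has_sum_infsum, intro Infinite_Sum.abs_summable_summable [of "\<lambda>k. c k * torus_char k x" UNIV]) (simp add: norm_mult)
  then have "((\<lambda>k. cnj (c k * torus_char k x)) has_sum cnj (fourier_series c x)) UNIV"
    by (subst has_sum_cnj_iff)
  then have "((\<lambda>k. c (- k) * torus_char (- k) x) has_sum cnj (fourier_series c x)) UNIV"
    by (simp add: c(2) torus_char_uminus)
  then have "infsum (\<lambda>k. c (- k) * torus_char (- k) x) UNIV = cnj (fourier_series c x)" by (rule infsumI)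
  moreover have "infsum (\<lambda>k. c (- k) * torus_char (- k) x) UNIV = infsum (\<lambda>k. c k * torus_char k x) UNIV"
    by (rule infsum_reindex_bij_betw) (rule bij_uminus)
  ultimately show ?thesis by (simp add: fourier_series_def)
qed

lemma fourier_coeff_uminus: "fourier_coeff f (- k) = cnj (fourier_coeff f k)"
  unfolding fourier_coeff_eq Bochner_Integration.integral_cnj [symmetric] by (simp add: torus_char_uminus)

lemma of_real_Re_fourier_series:
  assumes "abs_summable_coeffs c" "\<And>k. c (- k) = cnj (c k)"
  shows "complex_of_real (Re (fourier_series c x)) = fourier_series c x"
  using cnj_fourier_series [OF assms] by (simp add: complex_eq_iff)

lemma fourier_coeff_Re_fourier_series:
  assumes "abs_summable_coeffs c" "\<And>k. c (- k) = cnj (c k)"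
  shows "fourier_coeff (\<lambda>x. Re (fourier_series c x)) k = c k"
  unfolding fourier_coeff_eq of_real_Re_fourier_series [OF assms] by (rule integral_fourier_series_torus_char [OF assms(1)])

lemma fourier_coeff_diff:
  assumes "integrable cube_measure f" "integrable cube_measure g"
  shows "fourier_coeff (\<lambda>x. f x - g x) k = fourier_coeff f k - fourier_coeff g k"
proof -
  have "integrable cube_measure (\<lambda>x. complex_of_real (h x) * torus_char (- k) x)" if "integrable cube_measure h" for h
    using integrable_cube_continuous_mult [of "\<lambda>x. complex_of_real (h x)" "torus_char (- k)" 1] that
    by (simp add: mult.commute continuous_intros integrable_of_real)
  then show ?thesis
    unfolding fourier_coeff_eq using assms by (simp add: left_diff_distrib)
qed

text \<open>The series is a continuous function with the same Fourier coefficients as f, so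
  \<open>fourier_uniqueness\<close> applies to the difference.\<close>

lemma fourier_inversion:
  assumes f: "integrable cube_measure f" and c: "abs_summable_coeffs (fourier_coeff f)"
  shows "AE x in cube_measure. complex_of_real (f x) = fourier_series (fourier_coeff f) x"
proof -
  let ?F = "fourier_series (fourier_coeff f)"
  have ic: "integrable cube_measure (\<lambda>x. Re (?F x))"
    using continuous_on_fourier_series [OF c] by (intro integrable_cube_continuous continuous_intros)
  have "AE x in cube_measure. f x - Re (?F x) = 0"
    using fourier_coeff_Re_fourier_series [OF c fourier_coeff_uminus]
    by (intro fourier_uniqueness Bochner_Integration.integrable_diff f ic)
      (simp add: fourier_coeff_diff [OF f ic])
  then show ?thesis
  proof eventually_elim
    case (elim x)
    then have "f x = Re (?F x)" by simp
    then show ?case using of_real_Re_fourier_series [OF c fourier_coeff_uminus, of x] by simp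
  qed
qed

text \<open>Replacing f by its absolutely convergent series under the integral produces the
  convolution; no summability of the coefficients of g is involved.\<close>

lemma fourier_coeff_product:
  assumes f: "integrable cube_measure f" "abs_summable_coeffs (fourier_coeff f)"
    and g: "integrable cube_measure g" and fg: "integrable cube_measure (\<lambda>x. f x * g x)"
  shows "((\<lambda>l. fourier_coeff f l * fourier_coeff g (k - l)) has_sum fourier_coeff (\<lambda>x. f x * g x) k) UNIV"
proof -
  let ?F = "fourier_series (fourier_coeff f)"
  let ?h = "\<lambda>x. complex_of_real (g x) * torus_char (- k) x"
  have ih: "integrable cube_measure ?h"
    using integrable_cube_continuous_mult [of "\<lambda>x. complex_of_real (g x)" "torus_char (- k)" 1] g
    by (simp add: mult.commute continuous_intros integrable_of_real)
  have ifg: "integrable cube_measure (\<lambda>x. complex_of_real (f x * g x) * torus_char (- k) x)"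
    using integrable_cube_continuous_mult [of "\<lambda>x. complex_of_real (f x * g x)" "torus_char (- k)" 1] fg integrable_of_real [OF fg]
    by (simp add: mult.commute continuous_intros)
  have iF: "integrable cube_measure (\<lambda>x. ?F x * ?h x)"
    by (intro integrable_cube_continuous_mult [OF ih continuous_on_fourier_series [OF f(2)] norm_fourier_series_le [OF f(2)]])
  have "((\<lambda>l. fourier_coeff f l * (\<integral>x. torus_char l x * ?h x \<partial>cube_measure)) has_sum (\<integral>x. ?F x * ?h x \<partial>cube_measure)) UNIV"
    by (intro integral_fourier_series_mult f ih)
  moreover have "(\<integral>x. torus_char l x * ?h x \<partial>cube_measure) = fourier_coeff g (k - l)" for l
    unfolding fourier_coeff_eq using torus_char_add [of l "- k"] by (simp add: mult_ac)
  moreover have "(\<integral>x. ?F x * ?h x \<partial>cube_measure) = fourier_coeff (\<lambda>x. f x * g x) k"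
    unfolding fourier_coeff_eq [of "\<lambda>x. f x * g x"]
  proof (rule integral_cong_AE)
    show "AE x in cube_measure. ?F x * ?h x = complex_of_real (f x * g x) * torus_char (- k) x"
      using fourier_inversion [OF f] by eventually_elim simp
  qed (use iF ifg in auto)
  ultimately show ?thesis by simp
qed

section \<open>Square integrable fields and their coefficients\<close>

lemma L2_field_integrable:
  assumes "L2_field u"
  shows "integrable cube_measure (\<lambda>x. u x $ i)" "integrable cube_measure (\<lambda>x. u x $ i * u x $ j)"
    "integrable cube_measure (\<lambda>x. (norm (u x))\<^sup>2)"
proof -
  have "u \<in> borel_measurable cube_measure"
    using assms by (auto simp: L2_field_def intro: measurable_restrict_space1)
  then have "(\<lambda>x. u x \<bullet> axis i 1) \<in> borel_measurable cube_measure" for i by measurable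
  then have m: "(\<lambda>x. u x $ i) \<in> borel_measurable cube_measure" for i by (simp add: inner_axis)
  show n: "integrable cube_measure (\<lambda>x. (norm (u x))\<^sup>2)"
    using assms by (simp add: L2_field_def set_integrable_cube_iff)
  show "integrable cube_measure (\<lambda>x. u x $ i)"
  proof (rule Bochner_Integration.integrable_bound)
    show "integrable cube_measure (\<lambda>x. 1 + (norm (u x))\<^sup>2)"
      by (intro Bochner_Integration.integrable_add n integrable_cube_const)
    show "AE x in cube_measure. norm (u x $ i) \<le> norm (1 + (norm (u x))\<^sup>2)"
    proof (rule AE_I2)
      fix x
      have "\<bar>u x $ i\<bar> \<le> norm (u x)" by (rule component_le_norm_cart)
      also have "\<dots> \<le> 1 + (norm (u x))\<^sup>2"
        using zero_le_power2 [of "norm (u x) - 1"]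
          by (simp add: power2_eq_square algebra_simps) (use norm_ge_zero [of "u x"] in linarith)
      finally show "norm (u x $ i) \<le> norm (1 + (norm (u x))\<^sup>2)" by simp
    qed
  qed (rule m)
  show "integrable cube_measure (\<lambda>x. u x $ i * u x $ j)"
  proof (rule Bochner_Integration.integrable_bound [OF n])
    show "(\<lambda>x. u x $ i * u x $ j) \<in> borel_measurable cube_measure" by (intro borel_measurable_times m)
    show "AE x in cube_measure. norm (u x $ i * u x $ j) \<le> norm ((norm (u x))\<^sup>2)"
      by (intro AE_I2) (simp add: abs_mult power2_eq_square mult_mono component_le_norm_cart)
  qed
qed

lemma fhat_diff:
  assumes "L2_field u" "L2_field w"
  shows "fhat (\<lambda>x. u x - w x) k = fhat u k - fhat w k"
  using L2_field_integrable(1) [OF assms(1)] L2_field_integrable(1) [OF assms(2)]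
  by (simp add: fhat_def vec_eq_iff fourier_coeff_diff)

lemma ae_eq_if_fhat_eq:
  assumes "L2_field u" "L2_field w" "\<And>k. fhat u k = fhat w k"
  shows "ae_eq u w"
proof (rule ae_eq_if_AE_cube)
  show "periodic3 u" "periodic3 w" using assms by (auto simp: L2_field_def)
  have "AE x in cube_measure. u x $ i - w x $ i = 0" for i
  proof (rule fourier_uniqueness)
    show "integrable cube_measure (\<lambda>x. u x $ i - w x $ i)"
      using assms by (intro Bochner_Integration.integrable_diff L2_field_integrable)
    have "fhat u k $ i = fhat w k $ i" for k using assms(3) by simp
    then show "fourier_coeff (\<lambda>x. u x $ i - w x $ i) k = 0" for k
      using assms(1,2) by (simp add: fourier_coeff_diff L2_field_integrable(1) fhat_def)
  qed
  then have "AE x in cube_measure. \<forall>i. u x $ i - w x $ i = 0" by (simp add: AE_all_countable)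
  then show "AE x in cube_measure. u x = w x" by eventually_elim (simp add: vec_eq_iff)
qed

lemma fhat_cong_ae: "ae_eq u w \<Longrightarrow> u \<in> borel_measurable lebesgue \<Longrightarrow> w \<in> borel_measurable lebesgue \<Longrightarrow> fhat u k = fhat w k"
proof -
  assume ae: "ae_eq u w" and m: "u \<in> borel_measurable lebesgue" "w \<in> borel_measurable lebesgue"
  have mi: "(\<lambda>x. complex_of_real (v x $ i) * torus_char (- k) x) \<in> borel_measurable cube_measure" if "v \<in> borel_measurable lebesgue" for v i
  proof -
    have "v \<in> borel_measurable cube_measure" using that by (rule measurable_restrict_space1)
    then have "(\<lambda>x. v x \<bullet> axis i 1) \<in> borel_measurable cube_measure" by measurable
    then have "(\<lambda>x. v x $ i) \<in> borel_measurable cube_measure" by (simp add: inner_axis)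
    moreover have "torus_char (- k) \<in> borel_measurable cube_measure"
      by (intro continuous_imp_measurable_on_sets_lebesgue) (auto intro!: continuous_intros)
    ultimately show ?thesis by measurable
  qed
  have "fourier_coeff (\<lambda>x. u x $ i) k = fourier_coeff (\<lambda>x. w x $ i) k" for i
    unfolding fourier_coeff_eq
  proof (rule integral_cong_AE)
    show "AE x in cube_measure. complex_of_real (u x $ i) * torus_char (- k) x = complex_of_real (w x $ i) * torus_char (- k) x"
      using ae by (subst AE_restrict_space_iff) (auto simp: ae_eq_def elim!: eventually_mono)
  qed (use m mi in auto)
  then show ?thesis by (simp add: fhat_def)
qed

subsection \<open>Scalar coefficients of constrained fields\<close>

lemma cvec_nth [simp]: "cvec v $ i = complex_of_real (v $ i)"
  by (simp add: cvec_def)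

lemma norm_smult_cvec: "norm (c *s cvec v) = norm c * norm v"
  by (simp add: norm_vec_def L2_set_def norm_mult power_mult_distrib real_sqrt_mult flip: sum_distrib_left)

lemma smult_cvec_diff: "c *s cvec v - d *s cvec v = (c - d) *s cvec v"
  by (simp add: vec_eq_iff algebra_simps)

lemma scaleR_smult_cvec: "r *\<^sub>R (c *s cvec v) = (r *\<^sub>R c) *s cvec v"
  by (simp add: vec_eq_iff)

lemma bounded_linear_smult_cvec: "bounded_linear (\<lambda>c. c *s cvec v)"
  by (rule bounded_linear_intro [where K = "norm v"])
    (simp_all add: norm_smult_cvec scaleR_smult_cvec vec_eq_iff ring_distribs)

text \<open>Since \<open>vdir k\<close> is a real unit vector, contraction without conjugation
  inverts the map from c to c times \<open>vdir k\<close>; for fields of the constraint space this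
  is the coordinate a_k.\<close>

definition scalar_coeff :: "(int^3 \<Rightarrow> complex^3) \<Rightarrow> int^3 \<Rightarrow> complex" where
  "scalar_coeff w k = (\<Sum>i\<in>UNIV. cvec (vdir k) $ i * w k $ i)"

text \<open>The part of the constraint that concerns Fourier coefficients alone, stated for
  coefficient families so that it applies also to differences and to the Duhamel integrand.\<close>

definition adapted :: "(int^3 \<Rightarrow> complex^3) \<Rightarrow> bool" where
  "adapted w \<longleftrightarrow> (\<forall>k. k \<notin> Mfreq \<longrightarrow> w k = 0) \<and> (\<forall>k\<in>Mfreq. \<exists>c. w k = c *s cvec (vdir k))"

lemma proj_M_eq: "proj_M w k = (if k \<in> Mfreq then scalar_coeff w k *s cvec (vdir k) else 0)"
  by (simp add: proj_M_def scalar_coeff_def)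

lemma sum_vdir_squares:
  assumes "k \<in> Mfreq" shows "(\<Sum>i\<in>UNIV. vdir k $ i * vdir k $ i) = 1"
  using norm_vdir [OF assms] by (simp add: norm_eq_1 inner_vec_def)

lemma scalar_coeff_smult:
  assumes "k \<in> Mfreq" "w k = c *s cvec (vdir k)" shows "scalar_coeff w k = c"
proof -
  have "scalar_coeff w k = (\<Sum>i\<in>UNIV. c * of_real (vdir k $ i * vdir k $ i))"
    by (simp add: scalar_coeff_def assms mult_ac)
  also have "\<dots> = c * of_real (\<Sum>i\<in>UNIV. vdir k $ i * vdir k $ i)"
    by (simp add: sum_distrib_left)
  finally show ?thesis by (simp only: sum_vdir_squares [OF assms(1)] of_real_1 mult_1_right)
qed

lemma adapted_eq: "adapted w \<Longrightarrow> k \<in> Mfreq \<Longrightarrow> w k = scalar_coeff w k *s cvec (vdir k)"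
  using scalar_coeff_smult unfolding adapted_def by metis

lemma adapted_norm: "adapted w \<Longrightarrow> k \<in> Mfreq \<Longrightarrow> norm (w k) = norm (scalar_coeff w k)"
  using adapted_eq [of w k] norm_smult_cvec [of "scalar_coeff w k" "vdir k"] norm_vdir [of k] by simp

lemma adapted_diff: "adapted w \<Longrightarrow> adapted w' \<Longrightarrow> adapted (\<lambda>k. w k - w' k)"
  unfolding adapted_def by (metis diff_zero smult_cvec_diff)

lemma scalar_coeff_diff: "scalar_coeff (\<lambda>k. w k - w' k) k = scalar_coeff w k - scalar_coeff w' k"
  by (simp add: scalar_coeff_def right_diff_distrib sum_subtractf)

lemma lap_symbol_eq: "lap_symbol a k = wt k powr (2 * a)"
proof -
  have "4 * pi\<^sup>2 * (norm (rvec k))\<^sup>2 = wt k powr 2"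
    by (simp add: wt_def power_mult_distrib)
  then show ?thesis unfolding lap_symbol_def by (simp only: powr_powr)
qed

lemma adapted_sum:
  assumes "adapted w"
  shows "(\<lambda>k. lap_symbol s k * (norm (w k))\<^sup>2) summable_on {k. k \<noteq> 0} \<longleftrightarrow>
         (\<lambda>k. wt k powr (2 * s) * (norm (scalar_coeff w k))\<^sup>2) summable_on Mfreq"
    and "infsum (\<lambda>k. lap_symbol s k * (norm (w k))\<^sup>2) {k. k \<noteq> 0} =
         infsum (\<lambda>k. wt k powr (2 * s) * (norm (scalar_coeff w k))\<^sup>2) Mfreq"
proof -
  have 1: "w k = 0" if "k \<notin> Mfreq" for k using assms that by (simp add: adapted_def)
  have 2: "k \<noteq> 0" if "k \<in> Mfreq" for k using that zero_notin_Mfreq by blast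
  show "(\<lambda>k. lap_symbol s k * (norm (w k))\<^sup>2) summable_on {k. k \<noteq> 0} \<longleftrightarrow>
         (\<lambda>k. wt k powr (2 * s) * (norm (scalar_coeff w k))\<^sup>2) summable_on Mfreq"
    using 1 2 by (intro summable_on_cong_neutral) (auto simp: lap_symbol_eq adapted_norm [OF assms])
  show "infsum (\<lambda>k. lap_symbol s k * (norm (w k))\<^sup>2) {k. k \<noteq> 0} =
         infsum (\<lambda>k. wt k powr (2 * s) * (norm (scalar_coeff w k))\<^sup>2) Mfreq"
    using 1 2 by (intro infsum_cong_neutral) (auto simp: lap_symbol_eq adapted_norm [OF assms])
qed

lemma coeff_in_Hs_adapted:
  assumes "adapted w"
  shows "coeff_in_Hs s w \<longleftrightarrow> (\<lambda>k. wt k powr (2 * s) * (norm (scalar_coeff w k))\<^sup>2) summable_on Mfreq"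
  using assms adapted_sum(1) [OF assms, of s] by (simp add: coeff_in_Hs_def adapted_def)

lemma coeff_Hs_norm_adapted:
  assumes "adapted w"
  shows "coeff_Hs_norm s w = sqrt (infsum (\<lambda>k. wt k powr (2 * s) * (norm (scalar_coeff w k))\<^sup>2) Mfreq)"
  by (simp add: coeff_Hs_norm_def adapted_sum(2) [OF assms])

lemma HsM_iff: "u \<in> HsM s \<longleftrightarrow> u \<in> Hs s \<and> adapted (fhat u)"
  by (auto simp: HsM_def adapted_def)

lemma HsM_adapted: "u \<in> HsM s \<Longrightarrow> adapted (fhat u)"
  and HsM_L2: "u \<in> HsM s \<Longrightarrow> L2_field u"
  and HsM_summable: "u \<in> HsM s \<Longrightarrow> (\<lambda>k. wt k powr (2 * s) * (norm (scalar_coeff (fhat u) k))\<^sup>2) summable_on Mfreq"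
  using adapted_sum(1) [of "fhat u" s] by (auto simp: HsM_iff Hs_def)

lemma weighted_le_sqrt_infsum:
  assumes "(\<lambda>k. wt k powr (2 * s) * (norm (a k))\<^sup>2) summable_on Mfreq" "k \<in> Mfreq"
  shows "wt k powr s * norm (a k) \<le> sqrt (infsum (\<lambda>k. wt k powr (2 * s) * (norm (a k :: complex))\<^sup>2) Mfreq)"
proof (rule real_le_rsqrt)
  have "(wt k powr s * norm (a k))\<^sup>2 = (\<Sum>k\<in>{k}. wt k powr (2 * s) * (norm (a k))\<^sup>2)"
    by (simp add: power_mult_distrib power2_eq_square flip: powr_add)
  also have "\<dots> \<le> infsum (\<lambda>k. wt k powr (2 * s) * (norm (a k))\<^sup>2) Mfreq"
    using assms by (intro finite_sum_le_infsum) auto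
  finally show "(wt k powr s * norm (a k))\<^sup>2 \<le> infsum (\<lambda>k. wt k powr (2 * s) * (norm (a k))\<^sup>2) Mfreq" .
qed

text \<open>One term of the sum defining the H^s norm controls the supremum norm with constant 1, so
  existence times in terms of the latter carry over to the former.\<close>

lemma HsM_weighted_le:
  assumes "u \<in> HsM s" "k \<in> Mfreq"
  shows "wt k powr s * norm (scalar_coeff (fhat u) k) \<le> Hs_norm s u"
  unfolding Hs_norm_def coeff_Hs_norm_adapted [OF HsM_adapted [OF assms(1)]]
  by (rule weighted_le_sqrt_infsum [OF HsM_summable [OF assms(1)] assms(2)])

lemma abs_summable_coeffs_if_weighted_bounded:
  assumes "0 < d" "\<And>k. k \<notin> Mfreq \<Longrightarrow> c k = 0" "\<And>k. k \<in> Mfreq \<Longrightarrow> wt k powr d * norm (c k) \<le> R"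
  shows "abs_summable_coeffs c"
proof -
  have "(\<lambda>k. norm (c k)) summable_on Mfreq"
  proof (rule Infinite_Sum.abs_summable_on_comparison_test')
    show "(\<lambda>k. R * wt k powr (- d)) summable_on Mfreq"
      by (intro summable_on_cmult_right summable_on_wt_powr assms)
    fix k assume "k \<in> Mfreq"
    then show "norm (c k) \<le> R * wt k powr (- d)"
      using assms(3) [of k] wt_ge_1 [of k] by (simp add: powr_minus field_simps)
  qed
  then show ?thesis
    by (rule summable_on_cong_neutral [THEN iffD1, rotated -1]) (auto simp: assms(2))
qed

lemma fhat_nth: "fhat u k $ i = fourier_coeff (\<lambda>x. u x $ i) k"
  by (simp add: fhat_def)

lemma HsM_abs_summable_coeffs:
  assumes "u \<in> HsM s" "0 < s" shows "abs_summable_coeffs (fourier_coeff (\<lambda>x. u x $ i))"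
proof (rule abs_summable_coeffs_if_weighted_bounded [OF assms(2), where R = "Hs_norm s u"])
  fix k
  show "fourier_coeff (\<lambda>x. u x $ i) k = 0" if "k \<notin> Mfreq"
    using that HsM_adapted [OF assms(1)] unfolding fhat_nth [symmetric] by (simp add: adapted_def)
  show "wt k powr s * norm (fourier_coeff (\<lambda>x. u x $ i) k) \<le> Hs_norm s u" if k: "k \<in> Mfreq"
  proof -
    have "norm (fourier_coeff (\<lambda>x. u x $ i) k) \<le> norm (fhat u k)"
      unfolding fhat_nth [symmetric] by (rule Finite_Cartesian_Product.norm_nth_le)
    also have "\<dots> = norm (scalar_coeff (fhat u) k)" using adapted_norm [OF HsM_adapted [OF assms(1)] k] .
    finally show ?thesis using HsM_weighted_le [OF assms(1) k] by (meson mult_left_mono order_trans powr_ge_zero)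
  qed
qed

lemma scalar_coeff_fhat_uminus: "scalar_coeff (fhat u) (- k) = cnj (scalar_coeff (fhat u) k)"
  by (simp add: scalar_coeff_def fhat_nth fourier_coeff_uminus)

lemma has_sum_sum:
  fixes f :: "'i \<Rightarrow> 'a \<Rightarrow> 'b::topological_comm_monoid_add"
  assumes "\<And>i. i \<in> I \<Longrightarrow> (f i has_sum t i) A"
  shows "((\<lambda>x. \<Sum>i\<in>I. f i x) has_sum (\<Sum>i\<in>I. t i)) A"
  using assms by (induction I rule: infinite_finite_induct) (auto intro: has_sum_add)

lemma HsM_coeff_product:
  assumes "u \<in> HsM s" "0 < s"
  shows "((\<lambda>l. fhat u l $ i * fhat u (k - l) $ j) has_sum fourier_coeff (\<lambda>x. u x $ i * u x $ j) k) UNIV"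
  unfolding fhat_nth
  by (intro fourier_coeff_product L2_field_integrable HsM_L2 [OF assms(1)] HsM_abs_summable_coeffs [OF assms])

text \<open>The coefficients vanish off \<open>Mfreq\<close>, so the convolution for u_j * u_i is
  the finite sum over \<open>partners k\<close>. The divergence contracts k with
  \<open>vdir l\<close>, and the projection contracts \<open>vdir (k - l)\<close> with
  \<open>vdir k\<close>: these are the two factors of \<open>triad\<close>.\<close>

lemma proj_M_advection:
  assumes u: "u \<in> HsM s" "0 < s"
  shows "proj_M (advection_hat u) k = (if k \<in> Mfreq then triad_form (scalar_coeff (fhat u)) (scalar_coeff (fhat u)) k *s cvec (vdir k) else 0)"
proof (cases "k \<in> Mfreq")
  case k: True
  let ?a = "scalar_coeff (fhat u)"
  have z: "fhat u l $ i * fhat u (k - l) $ j = 0" if "l \<notin> partners k" for l i j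
    using that HsM_adapted [OF u(1)] by (auto simp: partners_def adapted_def)
  have f: "fhat u l $ i * fhat u (k - l) $ j = ?a l * ?a (k - l) * of_real (vdir l $ i * vdir (k - l) $ j)" if "l \<in> partners k" for l i j
  proof -
    have "fhat u l = ?a l *s cvec (vdir l)" "fhat u (k - l) = ?a (k - l) *s cvec (vdir (k - l))"
      using that by (auto intro!: adapted_eq HsM_adapted [OF u(1)] simp: partners_def)
    then have "fhat u l $ i = ?a l * of_real (vdir l $ i)" "fhat u (k - l) $ j = ?a (k - l) * of_real (vdir (k - l) $ j)"
      by (metis cvec_nth vector_smult_component)+
    then show ?thesis by simp
  qed
  have c: "fourier_coeff (\<lambda>x. u x $ i * u x $ j) k = (\<Sum>l\<in>partners k. ?a l * ?a (k - l) * of_real (vdir l $ i * vdir (k - l) $ j))" for i j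
  proof -
    have "((\<lambda>l. fhat u l $ i * fhat u (k - l) $ j) has_sum (\<Sum>l\<in>partners k. fhat u l $ i * fhat u (k - l) $ j)) UNIV"
      using has_sum_cong_neutral [of UNIV "partners k" "\<lambda>l. fhat u l $ i * fhat u (k - l) $ j" "\<lambda>l. fhat u l $ i * fhat u (k - l) $ j"]
        has_sum_finite [OF partners_finite_card(1) [OF k]] z by auto
    then have "fourier_coeff (\<lambda>x. u x $ i * u x $ j) k = (\<Sum>l\<in>partners k. fhat u l $ i * fhat u (k - l) $ j)"
      by (rule has_sum_unique [OF HsM_coeff_product [OF u]])
    then show ?thesis using f by simp
  qed
  have "scalar_coeff (advection_hat u) k = (\<Sum>i\<in>UNIV. of_real (vdir k $ i) * (\<Sum>j\<in>UNIV. 2 * pi * \<i> * of_int (k $ j) *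
      (\<Sum>l\<in>partners k. ?a l * ?a (k - l) * of_real (vdir l $ j * vdir (k - l) $ i))))"
    by (simp add: scalar_coeff_def advection_hat_def c)
  also have "\<dots> = (\<Sum>i\<in>UNIV. \<Sum>j\<in>UNIV. \<Sum>l\<in>partners k. 2 * pi * \<i> * ?a l * ?a (k - l) * of_real (vdir l $ j * of_int (k $ j) * (vdir (k - l) $ i * vdir k $ i)))"
    by (simp add: sum_distrib_left mult_ac)
  also have "\<dots> = (\<Sum>l\<in>partners k. \<Sum>i\<in>UNIV. \<Sum>j\<in>UNIV. 2 * pi * \<i> * ?a l * ?a (k - l) * of_real (vdir l $ j * of_int (k $ j) * (vdir (k - l) $ i * vdir k $ i)))"
    by (simp only: sum.swap [of _ UNIV "partners k"])
  also have "\<dots> = triad_form ?a ?a k"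
    unfolding triad_form_def
  proof (rule sum.cong)
    fix l
    have "(\<Sum>i\<in>UNIV. \<Sum>j\<in>UNIV. 2 * pi * \<i> * ?a l * ?a (k - l) * of_real (vdir l $ j * of_int (k $ j) * (vdir (k - l) $ i * vdir k $ i)))
       = 2 * pi * \<i> * ?a l * ?a (k - l) * of_real (\<Sum>i\<in>UNIV. \<Sum>j\<in>UNIV. vdir l $ j * of_int (k $ j) * (vdir (k - l) $ i * vdir k $ i))"
      by (simp add: sum_distrib_left)
    also have "(\<Sum>i\<in>UNIV. \<Sum>j\<in>UNIV. vdir l $ j * of_int (k $ j) * (vdir (k - l) $ i * vdir k $ i)) = (vdir l \<bullet> rvec k) * (vdir (k - l) \<bullet> vdir k)"
      by (subst sum.swap) (simp add: inner_vec_def rvec_def sum_product)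
    finally show "(\<Sum>i\<in>UNIV. \<Sum>j\<in>UNIV. 2 * pi * \<i> * ?a l * ?a (k - l) * of_real (vdir l $ j * of_int (k $ j) * (vdir (k - l) $ i * vdir k $ i))) = triad k l * ?a l * ?a (k - l)"
      by (simp add: triad_def mult_ac)
  qed simp
  finally show ?thesis by (simp add: proj_M_eq)
qed (simp add: proj_M_eq)

text \<open>Parseval's identity, read off from the convolution formula for u_i * u_i at frequency 0,
  since the coefficient at -l is the conjugate of the one at l.\<close>

lemma L2_norm_HsM:
  assumes u: "u \<in> HsM s" "0 < s"
  shows "((\<lambda>k. (norm (scalar_coeff (fhat u) k))\<^sup>2) has_sum (L2_norm u)\<^sup>2) Mfreq"
proof -
  note L = HsM_L2 [OF u(1)]
  have "((\<lambda>l. \<Sum>i\<in>UNIV. fhat u l $ i * fhat u (0 - l) $ i) has_sum (\<Sum>i\<in>UNIV. fourier_coeff (\<lambda>x. u x $ i * u x $ i) 0)) UNIV"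
    by (intro has_sum_sum HsM_coeff_product [OF u])
  moreover have "(\<Sum>i\<in>UNIV. fourier_coeff (\<lambda>x. u x $ i * u x $ i) 0) = of_real ((L2_norm u)\<^sup>2)"
  proof -
    have "(\<Sum>i\<in>UNIV. fourier_coeff (\<lambda>x. u x $ i * u x $ i) 0) = (\<Sum>i\<in>UNIV. complex_of_real (\<integral>x. u x $ i * u x $ i \<partial>cube_measure))"
      unfolding fourier_coeff_eq minus_zero torus_char_0 mult_1_right by (simp del: of_real_mult)
    also have "\<dots> = of_real (\<integral>x. (\<Sum>i\<in>UNIV. u x $ i * u x $ i) \<partial>cube_measure)"
      using L2_field_integrable(2) [OF L] by (subst Bochner_Integration.integral_sum) auto
    also have "(\<integral>x. (\<Sum>i\<in>UNIV. u x $ i * u x $ i) \<partial>cube_measure) = (\<integral>x. (norm (u x))\<^sup>2 \<partial>cube_measure)"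
      by (simp add: power2_norm_eq_inner inner_vec_def)
    also have "\<dots> = (L2_norm u)\<^sup>2"
      by (simp add: L2_norm_def set_lebesgue_integral_def integral_restrict_space)
    finally show ?thesis .
  qed
  moreover have "(\<Sum>i\<in>UNIV. fhat u l $ i * fhat u (0 - l) $ i) = of_real ((norm (fhat u l))\<^sup>2)" for l
  proof -
    have "fhat u l $ i * fhat u (0 - l) $ i = of_real ((norm (fhat u l $ i))\<^sup>2)" for i
      by (simp only: fhat_nth diff_0 fourier_coeff_uminus complex_norm_square)
    moreover have "(norm (fhat u l))\<^sup>2 = (\<Sum>i\<in>UNIV. (norm (fhat u l $ i))\<^sup>2)"
      by (simp add: norm_vec_def L2_set_def sum_nonneg)
    ultimately show ?thesis by simp
  qed
  ultimately have "((\<lambda>l. complex_of_real ((norm (fhat u l))\<^sup>2)) has_sum of_real ((L2_norm u)\<^sup>2)) UNIV" by simp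
  then have "((\<lambda>l. (norm (fhat u l))\<^sup>2) has_sum (L2_norm u)\<^sup>2) UNIV"
    by (simp only: has_sum_of_real_iff)
  moreover have "((\<lambda>l. (norm (fhat u l))\<^sup>2) has_sum (L2_norm u)\<^sup>2) UNIV \<longleftrightarrow> ((\<lambda>k. (norm (scalar_coeff (fhat u) k))\<^sup>2) has_sum (L2_norm u)\<^sup>2) Mfreq"
    using HsM_adapted [OF u(1)] by (intro has_sum_cong_neutral) (auto simp: adapted_norm adapted_def)
  ultimately show ?thesis by simp
qed

lemma L2_field_diff:
  assumes "L2_field u" "L2_field w" shows "L2_field (\<lambda>x. u x - w x)"
  unfolding L2_field_def
proof (intro conjI)
  show "periodic3 (\<lambda>x. u x - w x)" using assms by (simp add: L2_field_def periodic3_def)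
  show m: "(\<lambda>x. u x - w x) \<in> borel_measurable lebesgue"
    using assms by (auto simp: L2_field_def)
  show "set_integrable lebesgue unit_cube (\<lambda>x. (norm (u x - w x))\<^sup>2)"
    unfolding set_integrable_cube_iff
  proof (rule Bochner_Integration.integrable_bound)
    show "integrable cube_measure (\<lambda>x. 2 * (norm (u x))\<^sup>2 + 2 * (norm (w x))\<^sup>2)"
      using L2_field_integrable(3) assms by (intro Bochner_Integration.integrable_add integrable_mult_right)
    have "(\<lambda>x. u x - w x) \<in> borel_measurable cube_measure" using m by (rule measurable_restrict_space1)
    then show "(\<lambda>x. (norm (u x - w x))\<^sup>2) \<in> borel_measurable cube_measure" by measurable
    show "AE x in cube_measure. norm ((norm (u x - w x))\<^sup>2) \<le> norm (2 * (norm (u x))\<^sup>2 + 2 * (norm (w x))\<^sup>2)"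
    proof (rule AE_I2)
      fix x
      have "(norm (u x - w x))\<^sup>2 \<le> (norm (u x) + norm (w x))\<^sup>2" by (intro power_mono norm_triangle_ineq4) simp
      also have "\<dots> \<le> 2 * (norm (u x))\<^sup>2 + 2 * (norm (w x))\<^sup>2"
        using zero_le_power2 [of "norm (u x) - norm (w x)"] by (simp add: power2_eq_square algebra_simps)
      finally show "norm ((norm (u x - w x))\<^sup>2) \<le> norm (2 * (norm (u x))\<^sup>2 + 2 * (norm (w x))\<^sup>2)" by simp
    qed
  qed
qed

lemma fhat_0: "L2_field u \<Longrightarrow> fhat u 0 = cvec (LINT x:unit_cube|lebesgue. u x)"
proof -
  assume L: "L2_field u"
  have "integrable cube_measure u"
  proof (rule Bochner_Integration.integrable_bound)
    show "integrable cube_measure (\<lambda>x. 1 + (norm (u x))\<^sup>2)"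
      by (intro Bochner_Integration.integrable_add L2_field_integrable(3) [OF L] integrable_cube_const)
    show "u \<in> borel_measurable cube_measure" using L by (auto simp: L2_field_def intro: measurable_restrict_space1)
    show "AE x in cube_measure. norm (u x) \<le> norm (1 + (norm (u x))\<^sup>2)"
    proof (rule AE_I2)
      fix x
      show "norm (u x) \<le> norm (1 + (norm (u x))\<^sup>2)"
        using zero_le_power2 [of "norm (u x) - 1"]
          by (simp add: power2_eq_square algebra_simps) (use norm_ge_zero [of "u x"] in linarith)
    qed
  qed
  then have "(\<integral>x. u x \<partial>cube_measure) $ i = (\<integral>x. u x $ i \<partial>cube_measure)" for i
    using integral_bounded_linear [OF bounded_linear_vec_nth, of cube_measure u i] by simp
  then show ?thesis
    unfolding vec_eq_iff fhat_nth fourier_coeff_eq minus_zero torus_char_0 mult_1_right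
    by (simp add: set_lebesgue_integral_def flip: integral_restrict_space)
qed

lemma HsM_diff:
  assumes u: "u \<in> HsM s" and w: "w \<in> HsM s"
  shows "(\<lambda>x. u x - w x) \<in> HsM s"
proof -
  note L = HsM_L2 [OF u] HsM_L2 [OF w]
  have f: "fhat (\<lambda>x. u x - w x) = (\<lambda>k. fhat u k - fhat w k)"
    using fhat_diff [OF L] by auto
  have A: "adapted (fhat (\<lambda>x. u x - w x))"
    unfolding f by (intro adapted_diff HsM_adapted [OF u] HsM_adapted [OF w])
  have "fhat (\<lambda>x. u x - w x) 0 = 0" using A by (simp add: adapted_def)
  then have "(LINT x:unit_cube|lebesgue. u x - w x) = 0"
    unfolding fhat_0 [OF L2_field_diff [OF L]] by (simp add: vec_eq_iff)
  moreover have "(\<lambda>k. wt k powr (2 * s) * (norm (scalar_coeff (fhat (\<lambda>x. u x - w x)) k))\<^sup>2) summable_on Mfreq"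
  proof (rule summable_on_comparison_test)
    show "(\<lambda>k. 2 * (wt k powr (2 * s) * (norm (scalar_coeff (fhat u) k))\<^sup>2) + 2 * (wt k powr (2 * s) * (norm (scalar_coeff (fhat w) k))\<^sup>2)) summable_on Mfreq"
      by (intro summable_on_add summable_on_cmult_right HsM_summable u w)
    fix k
    let ?x = "scalar_coeff (fhat u) k" and ?y = "scalar_coeff (fhat w) k"
    have "(norm (?x - ?y))\<^sup>2 \<le> (norm ?x + norm ?y)\<^sup>2" by (intro power_mono norm_triangle_ineq4) simp
    also have "\<dots> \<le> 2 * (norm ?x)\<^sup>2 + 2 * (norm ?y)\<^sup>2"
      using zero_le_power2 [of "norm ?x - norm ?y"] by (simp add: power2_eq_square algebra_simps)
    finally have "wt k powr (2 * s) * (norm (?x - ?y))\<^sup>2 \<le> wt k powr (2 * s) * (2 * (norm ?x)\<^sup>2 + 2 * (norm ?y)\<^sup>2)"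
      by (intro mult_left_mono) auto
    then show "wt k powr (2 * s) * (norm (scalar_coeff (fhat (\<lambda>x. u x - w x)) k))\<^sup>2
        \<le> 2 * (wt k powr (2 * s) * (norm (scalar_coeff (fhat u) k))\<^sup>2) + 2 * (wt k powr (2 * s) * (norm (scalar_coeff (fhat w) k))\<^sup>2)"
      by (simp add: f scalar_coeff_diff algebra_simps)
  qed auto
  ultimately show ?thesis
    using A L2_field_diff [OF L] by (simp add: HsM_iff Hs_def adapted_sum(1))
qed

subsection \<open>Synthesis of fields from scalar coefficients\<close>

definition component_coeff :: "(int^3 \<Rightarrow> complex) \<Rightarrow> 3 \<Rightarrow> int^3 \<Rightarrow> complex" where
  "component_coeff a i k = (if k \<in> Mfreq then a k * of_real (vdir k $ i) else 0)"

text \<open>The real part makes the definition meaningful for every family \<open>a\<close>; under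
  the symmetry assumed in the locale \<open>synthesis\<close> the series is real and nothing is
  discarded.\<close>

definition synthesize :: "(int^3 \<Rightarrow> complex) \<Rightarrow> real^3 \<Rightarrow> real^3" where
  "synthesize a x = (\<chi> i. Re (fourier_series (component_coeff a i) x))"

locale synthesis =
  fixes a :: "int^3 \<Rightarrow> complex" and d R :: real
  assumes d: "0 < d" and bounded: "\<And>k. k \<in> Mfreq \<Longrightarrow> wt k powr d * norm (a k) \<le> R"
    and sym: "\<And>k. k \<in> Mfreq \<Longrightarrow> a (- k) = cnj (a k)"
begin

lemma abs_summable_coeffs_component_coeff: "abs_summable_coeffs (component_coeff a i)"
proof (rule abs_summable_coeffs_if_weighted_bounded [OF d, where R = R])
  fix k assume k: "k \<in> Mfreq"
  have "norm (component_coeff a i k) = norm (a k) * \<bar>vdir k $ i\<bar>" using k by (simp add: component_coeff_def norm_mult)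
  also have "\<dots> \<le> norm (a k) * 1"
    using norm_vdir [OF k] component_le_norm_cart [of "vdir k" i] by (intro mult_left_mono) auto
  finally show "wt k powr d * norm (component_coeff a i k) \<le> R"
    using bounded [OF k] by (smt (verit) mult_left_mono powr_ge_zero)
qed (simp add: component_coeff_def)

lemma component_coeff_uminus: "component_coeff a i (- k) = cnj (component_coeff a i k)"
  by (simp add: component_coeff_def sym)

lemma fhat_synthesize: "fhat (synthesize a) k = (if k \<in> Mfreq then a k *s cvec (vdir k) else 0)"
  by (simp add: vec_eq_iff fhat_nth synthesize_def fourier_coeff_Re_fourier_series [OF abs_summable_coeffs_component_coeff component_coeff_uminus])
    (simp add: component_coeff_def)

lemma adapted_synthesize: "adapted (fhat (synthesize a))"
  by (auto simp: adapted_def fhat_synthesize)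

lemma scalar_coeff_synthesize: "k \<in> Mfreq \<Longrightarrow> scalar_coeff (fhat (synthesize a)) k = a k"
  by (intro scalar_coeff_smult) (simp_all add: fhat_synthesize)

lemma L2_field_synthesize: "L2_field (synthesize a)"
proof -
  have c: "continuous_on S (synthesize a)" for S
    unfolding synthesize_def by (intro continuous_intros continuous_on_fourier_series abs_summable_coeffs_component_coeff)
  have "synthesize a \<in> borel_measurable borel" using c by (intro borel_measurable_continuous_onI)
  then have "synthesize a \<in> borel_measurable lebesgue"
    by (intro measurable_completion) simp
  moreover have "set_integrable lebesgue unit_cube (\<lambda>x. (norm (synthesize a x))\<^sup>2)"
    by (intro absolutely_integrable_continuous continuous_intros c)
  moreover have "periodic3 (synthesize a)"
    using periodic3_fourier_series by (simp add: periodic3_def synthesize_def vec_eq_iff)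
  ultimately show ?thesis by (simp add: L2_field_def)
qed

lemma synthesize_HsM:
  assumes "(\<lambda>k. wt k powr (2 * s) * (norm (a k))\<^sup>2) summable_on Mfreq"
  shows "synthesize a \<in> HsM s"
proof -
  have "fhat (synthesize a) 0 = 0" by (simp add: fhat_synthesize)
  then have "(LINT x:unit_cube|lebesgue. synthesize a x) = 0"
    unfolding fhat_0 [OF L2_field_synthesize] by (simp add: vec_eq_iff)
  moreover have "(\<lambda>k. wt k powr (2 * s) * (norm (scalar_coeff (fhat (synthesize a)) k))\<^sup>2) summable_on Mfreq"
    using assms by (rule summable_on_cong [THEN iffD1, rotated]) (simp add: scalar_coeff_synthesize)
  ultimately show ?thesis
    by (simp add: HsM_iff Hs_def adapted_synthesize L2_field_synthesize adapted_sum(1))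
qed

end

subsection \<open>Mild solutions and the coefficient system\<close>

text \<open>Derivatives and limits at t only see times near t, so the half-open interval may be
  replaced by a compact one ending beyond t.\<close>

lemma at_within_time_interval:
  assumes "t < T'" "ereal T' < T" shows "at t within time_interval T = at t within {0..T'}"
  using assms by (intro at_within_nhd [of t "{..<T'}"])
    (auto simp: time_interval_def intro: less_trans [of "ereal _" "ereal T'"])

context hypodissipative
begin

lemma semigroup_hat_eq: "semigroup_hat \<nu> \<alpha> t w k = exp (- mu k * t) *\<^sub>R w k"
  by (simp add: semigroup_hat_def lap_symbol_eq mu_def mult_ac)

lemma duhamel_integrand_eq:
  assumes "u \<tau> \<in> HsM s"
  shows "duhamel_integrand \<nu> \<alpha> u t \<tau> k =
    (if k \<in> Mfreq then (exp (- mu k * (t - \<tau>)) *\<^sub>R triad_form (scalar_coeff (fhat (u \<tau>))) (scalar_coeff (fhat (u \<tau>))) k) *s cvec (vdir k) else 0)"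
  unfolding duhamel_integrand_def semigroup_hat_eq proj_M_advection [OF assms s(1)]
  by (simp add: scaleR_smult_cvec)

text \<open>Connects the Lebesgue integral over the open interval in the definition of mild
  solutions with the gauge integral over the closed interval used for the scalar equations.\<close>

lemma open_interval_integral:
  fixes g :: "real \<Rightarrow> complex"
  assumes "continuous_on {0..t} g"
  shows "set_integrable lebesgue {0<..<t} g" "(LINT \<tau>:{0<..<t}|lebesgue. g \<tau> *s cvec v) = integral {0..t} g *s cvec v"
proof -
  have "set_integrable lebesgue {0..t} g"
    using absolutely_integrable_continuous_real [OF assms] .
  then show i: "set_integrable lebesgue {0<..<t} g"
    by (rule set_integrable_subset) auto
  have "(LINT \<tau>:{0<..<t}|lebesgue. g \<tau> *s cvec v) = (LINT \<tau>:{0<..<t}|lebesgue. g \<tau>) *s cvec v"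
    using integral_bounded_linear [OF bounded_linear_smult_cvec [of v] i [unfolded set_integrable_def]]
    by (simp add: set_lebesgue_integral_def scaleR_smult_cvec)
  also have "(LINT \<tau>:{0<..<t}|lebesgue. g \<tau>) = integral {0<..<t} g"
    using i by (rule set_lebesgue_integral_eq_integral)
  also have "\<dots> = integral {0..t} g" by (rule integral_open_interval_real [symmetric])
  finally show "(LINT \<tau>:{0<..<t}|lebesgue. g \<tau> *s cvec v) = integral {0..t} g *s cvec v" .
qed

text \<open>Near each time t the field differs from \<open>u t\<close> by less than 1 in norm.
  Finitely many such neighbourhoods cover [0, t1], and R adds 1 to the sum of the norms at their
  centres.\<close>

lemma continuous_HsM_weighted_bounded:
  assumes c: "continuous_HsM s T u" and t1: "t1 \<in> time_interval T"
  shows "\<exists>R. \<forall>t\<in>{0..t1}. \<forall>k\<in>Mfreq. wt k powr s * norm (scalar_coeff (fhat (u t)) k) \<le> R"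
proof -
  have H: "u t \<in> HsM s" if "t \<in> time_interval T" for t using c that by (simp add: continuous_HsM_def)
  have sub: "{0..t1} \<subseteq> time_interval T" by (rule time_interval_initial [OF t1])
  \<comment> \<open>The limit says nothing about \<tau> = t itself, hence the second
    alternative.\<close>
  have "\<exists>e>0. \<forall>\<tau>\<in>time_interval T. dist \<tau> t < e \<longrightarrow> Hs_norm s (\<lambda>x. u \<tau> x - u t x) < 1 \<or> \<tau> = t" if "t \<in> {0..t1}" for t
  proof -
    have "((\<lambda>\<tau>. Hs_norm s (\<lambda>x. u \<tau> x - u t x)) \<longlongrightarrow> 0) (at t within time_interval T)"
      using c that sub by (auto simp: continuous_HsM_def)
    then have "eventually (\<lambda>\<tau>. Hs_norm s (\<lambda>x. u \<tau> x - u t x) < 1) (at t within time_interval T)"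
      by (rule order_tendstoD) simp
    then show ?thesis unfolding eventually_at by auto
  qed
  then obtain e where e: "\<And>t. t \<in> {0..t1} \<Longrightarrow> e t > 0"
    "\<And>t \<tau>. t \<in> {0..t1} \<Longrightarrow> \<tau> \<in> time_interval T \<Longrightarrow> dist \<tau> t < e t \<Longrightarrow> Hs_norm s (\<lambda>x. u \<tau> x - u t x) < 1 \<or> \<tau> = t"
    by metis
  obtain F where F: "F \<subseteq> {0..t1}" "finite F" "{0..t1} \<subseteq> (\<Union>t\<in>F. ball t (e t))"
  proof (rule compactE_image [of "{0..t1}" "{0..t1}" "\<lambda>t. ball t (e t)"])
    show "{0..t1} \<subseteq> (\<Union>t\<in>{0..t1}. ball t (e t))" using e(1) by force
  qed auto
  define R where "R = 1 + (\<Sum>t\<in>F. Hs_norm s (u t))"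
  have nn: "0 \<le> Hs_norm s (u t)" for t by (simp add: Hs_norm_def coeff_Hs_norm_def infsum_nonneg lap_symbol_eq)
  show ?thesis
  proof (intro exI [of _ R] ballI)
    fix \<tau> k assume \<tau>: "\<tau> \<in> {0..t1}" and k: "k \<in> Mfreq"
    obtain t where t: "t \<in> F" "dist \<tau> t < e t" using F(3) \<tau> by (auto simp: dist_commute)
    have tF: "t \<in> {0..t1}" using t F by auto
    have "Hs_norm s (u t) \<le> (\<Sum>t\<in>F. Hs_norm s (u t))"
      using t(1) F(2) nn by (intro member_le_sum) auto
    then have 1: "wt k powr s * norm (scalar_coeff (fhat (u t)) k) \<le> R - 1"
      using HsM_weighted_le [OF H k, of t] tF sub by (force simp: R_def)
    have H2: "u \<tau> \<in> HsM s" "u t \<in> HsM s" using H \<tau> tF sub by auto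
    have 2: "wt k powr s * norm (scalar_coeff (fhat (u \<tau>)) k - scalar_coeff (fhat (u t)) k) \<le> 1"
    proof (cases "\<tau> = t")
      case False
      have "fhat (\<lambda>x. u \<tau> x - u t x) = (\<lambda>k. fhat (u \<tau>) k - fhat (u t) k)"
        using fhat_diff [OF HsM_L2 [OF H2(1)] HsM_L2 [OF H2(2)]] by auto
      then have "scalar_coeff (fhat (u \<tau>)) k - scalar_coeff (fhat (u t)) k = scalar_coeff (fhat (\<lambda>x. u \<tau> x - u t x)) k"
        by (simp add: scalar_coeff_diff)
      then show ?thesis
        using HsM_weighted_le [OF HsM_diff [OF H2] k] e(2) [OF tF _ t(2)] False \<tau> sub by force
    qed simp
    have "norm (scalar_coeff (fhat (u \<tau>)) k) \<le> norm (scalar_coeff (fhat (u t)) k) + norm (scalar_coeff (fhat (u \<tau>)) k - scalar_coeff (fhat (u t)) k)"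
      by norm
    then have "wt k powr s * norm (scalar_coeff (fhat (u \<tau>)) k) \<le> wt k powr s * (norm (scalar_coeff (fhat (u t)) k) + norm (scalar_coeff (fhat (u \<tau>)) k - scalar_coeff (fhat (u t)) k))"
      by (intro mult_left_mono) auto
    then show "wt k powr s * norm (scalar_coeff (fhat (u \<tau>)) k) \<le> R"
      using 1 2 by (simp add: ring_distribs)
  qed
qed

lemma continuous_HsM_coefficient:
  assumes c: "continuous_HsM s T u" and k: "k \<in> Mfreq"
  shows "continuous_on (time_interval T) (\<lambda>t. scalar_coeff (fhat (u t)) k)"
  unfolding continuous_on_def
proof
  fix t assume t: "t \<in> time_interval T"
  have H: "u t \<in> HsM s" if "t \<in> time_interval T" for t using c that by (simp add: continuous_HsM_def)
  have "((\<lambda>\<tau>. scalar_coeff (fhat (u \<tau>)) k - scalar_coeff (fhat (u t)) k) \<longlongrightarrow> 0) (at t within time_interval T)"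
  proof (rule Lim_null_comparison)
    show "((\<lambda>\<tau>. Hs_norm s (\<lambda>x. u \<tau> x - u t x) / wt k powr s) \<longlongrightarrow> 0) (at t within time_interval T)"
      using c t by (intro tendsto_divide_zero) (auto simp: continuous_HsM_def)
    show "\<forall>\<^sub>F \<tau> in at t within time_interval T. norm (scalar_coeff (fhat (u \<tau>)) k - scalar_coeff (fhat (u t)) k) \<le> Hs_norm s (\<lambda>x. u \<tau> x - u t x) / wt k powr s"
      unfolding eventually_at_filter
    proof (intro always_eventually allI impI)
      fix \<tau> assume \<tau>: "\<tau> \<in> time_interval T"
      have "fhat (\<lambda>x. u \<tau> x - u t x) = (\<lambda>k. fhat (u \<tau>) k - fhat (u t) k)"
        using fhat_diff [OF HsM_L2 [OF H [OF \<tau>]] HsM_L2 [OF H [OF t]]] by auto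
      then have "scalar_coeff (fhat (u \<tau>)) k - scalar_coeff (fhat (u t)) k = scalar_coeff (fhat (\<lambda>x. u \<tau> x - u t x)) k"
        by (simp add: scalar_coeff_diff)
      then show "norm (scalar_coeff (fhat (u \<tau>)) k - scalar_coeff (fhat (u t)) k) \<le> Hs_norm s (\<lambda>x. u \<tau> x - u t x) / wt k powr s"
        using HsM_weighted_le [OF HsM_diff [OF H [OF \<tau>] H [OF t]] k] wt_ge_1 [OF k]
        by (simp add: field_simps)
    qed
  qed
  then show "((\<lambda>\<tau>. scalar_coeff (fhat (u \<tau>)) k) \<longlongrightarrow> scalar_coeff (fhat (u t)) k) (at t within time_interval T)"
    by (rule LIM_zero_cancel)
qed

text \<open>Each Fourier coefficient of the mild formula is a scalar Duhamel formula with continuous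
  forcing and may be differentiated. The initial data agree only almost everywhere, which Fourier
  coefficients do not notice.\<close>

lemma mild_imp_coeff_sol:
  assumes m: "mild_solution \<nu> \<alpha> s u0 T u" and u0: "u0 \<in> HsM s"
  shows "coeff_sol T (scalar_coeff (fhat u0)) (\<lambda>t. scalar_coeff (fhat (u t)))"
  unfolding coeff_sol_def
proof (intro conjI ballI)
  have c: "continuous_HsM s T u" and T: "0 < T" using m by (auto simp: mild_solution_def)
  have H: "u t \<in> HsM s" if "t \<in> time_interval T" for t using c that by (simp add: continuous_HsM_def)
  have 0: "0 \<in> time_interval T" using T by (simp add: time_interval_def zero_ereal_def)
  fix k assume k: "k \<in> Mfreq"
  let ?a = "\<lambda>t. scalar_coeff (fhat (u t))"
  have "fhat (u 0) k = fhat u0 k"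
    using m HsM_L2 [OF H [OF 0]] HsM_L2 [OF u0]
    by (intro fhat_cong_ae) (auto simp: mild_solution_def L2_field_def)
  then show init: "?a 0 k = scalar_coeff (fhat u0) k" by (simp add: scalar_coeff_def)
  have cb: "continuous_on {0..t1} (\<lambda>t. triad_form (?a t) (?a t) k)" if "t1 \<in> time_interval T" for t1
    using k continuous_on_subset [OF continuous_HsM_coefficient [OF c] time_interval_initial [OF that]]
    by (intro continuous_on_triad_form)
  have duh: "?a t k = exp (- mu k * t) *\<^sub>R scalar_coeff (fhat u0) k - integral {0..t} (\<lambda>\<tau>. exp (- mu k * (t - \<tau>)) *\<^sub>R triad_form (?a \<tau>) (?a \<tau>) k)"
    if t: "t \<in> time_interval T" for t
  proof (cases "t = 0")
    case True
    then show ?thesis using init by simp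
  next
    case False
    have "fhat (u t) k = semigroup_hat \<nu> \<alpha> t (fhat u0) k - Hs_Bochner_integral {0<..<t} (duhamel_integrand \<nu> \<alpha> u t) k"
      using m False t by (auto simp: mild_solution_def time_interval_def)
    also have "semigroup_hat \<nu> \<alpha> t (fhat u0) k = (exp (- mu k * t) *\<^sub>R scalar_coeff (fhat u0) k) *s cvec (vdir k)"
      unfolding semigroup_hat_eq by (subst adapted_eq [OF HsM_adapted [OF u0] k]) (rule scaleR_smult_cvec)
    also have "Hs_Bochner_integral {0<..<t} (duhamel_integrand \<nu> \<alpha> u t) k =
       (LINT \<tau>:{0<..<t}|lebesgue. (exp (- mu k * (t - \<tau>)) *\<^sub>R triad_form (?a \<tau>) (?a \<tau>) k) *s cvec (vdir k))"
      unfolding Hs_Bochner_integral_def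
      using H time_interval_initial [OF t] k
      by (intro set_lebesgue_integral_cong) (auto simp: duhamel_integrand_eq subset_iff)
    also have "\<dots> = integral {0..t} (\<lambda>\<tau>. exp (- mu k * (t - \<tau>)) *\<^sub>R triad_form (?a \<tau>) (?a \<tau>) k) *s cvec (vdir k)"
      by (intro open_interval_integral continuous_intros cb t)
    finally show ?thesis
      unfolding smult_cvec_diff by (rule scalar_coeff_smult [OF k])
  qed
  fix t assume t: "t \<in> time_interval T"
  then obtain T' where T': "t < T'" "ereal T' < T"
    using ereal_dense2 [of "ereal t" T] by (auto simp: time_interval_def)
  have T'T: "T' \<in> time_interval T" using t T' by (auto simp: time_interval_def)
  have tT': "t \<in> {0..T'}" using t T' by (auto simp: time_interval_def)
  have "((\<lambda>t. ?a t k) has_vector_derivative - mu k *\<^sub>R ?a t k - triad_form (?a t) (?a t) k) (at t within {0..T'})"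
    unfolding duh [OF t]
  proof (rule has_vector_derivative_transform [OF tT' _ duhamel_has_derivative])
    show "continuous_on {0..T'} (\<lambda>\<tau>. triad_form (?a \<tau>) (?a \<tau>) k)" by (rule cb [OF T'T])
    show "t \<in> {0..T'}" by (rule tT')
    fix \<tau> assume "\<tau> \<in> {0..T'}"
    then show "?a \<tau> k = exp (- mu k * \<tau>) *\<^sub>R scalar_coeff (fhat u0) k - integral {0..\<tau>} (\<lambda>\<sigma>. exp (- mu k * (\<tau> - \<sigma>)) *\<^sub>R triad_form (?a \<sigma>) (?a \<sigma>) k)"
      using duh time_interval_initial [OF T'T] by blast
  qed
  then show "((\<lambda>t. ?a t k) has_vector_derivative - mu k *\<^sub>R ?a t k - triad_form (?a t) (?a t) k) (at t within time_interval T)"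
    unfolding at_within_time_interval [OF T'] .
next
  fix t1 assume "t1 \<in> time_interval T"
  moreover have "continuous_HsM s T u" using m by (simp add: mild_solution_def)
  ultimately show "\<exists>R. \<forall>t\<in>{0..t1}. \<forall>k\<in>Mfreq. wt k powr s * norm (scalar_coeff (fhat (u t)) k) \<le> R"
    by (rule continuous_HsM_weighted_bounded [rotated])
qed

end

subsection \<open>From the coefficient system to mild solutions\<close>

lemma continuous_on_infsum:
  fixes f :: "'k \<Rightarrow> 'a::topological_space \<Rightarrow> 'b::banach"
  assumes "m summable_on A" "\<And>k. k \<in> A \<Longrightarrow> continuous_on S (f k)" "\<And>k x. k \<in> A \<Longrightarrow> x \<in> S \<Longrightarrow> norm (f k x) \<le> m k"
  shows "continuous_on S (\<lambda>x. \<Sum>\<^sub>\<infinity>k\<in>A. f k x)"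
proof (rule uniform_limit_theorem)
  show "uniform_limit S (\<lambda>K x. \<Sum>k\<in>K. f k x) (\<lambda>x. \<Sum>\<^sub>\<infinity>k\<in>A. f k x) (finite_subsets_at_top A)"
    using assms by (intro Weierstrass_m_test_general) auto
  show "\<forall>\<^sub>F K in finite_subsets_at_top A. continuous_on S (\<lambda>x. \<Sum>k\<in>K. f k x)"
    using assms by (intro eventually_finite_subsets_at_top_weakI continuous_on_sum) auto
qed simp

text \<open>Counterpart of \<open>one_minus_exp_le_powr\<close> for the kernel before integration:
  smoothing is bought at the price of a singularity (t - \<tau>) powr (- p), which is integrable for
  p < 1.\<close>

lemma exp_minus_le_powr:
  fixes x :: real
  assumes "0 < x" "0 \<le> r" "r \<le> 1" shows "exp (- x) \<le> x powr (- r)"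
proof -
  have "x powr r \<le> 1 + x"
  proof (cases "x \<le> 1")
    case True
    then have "x powr r \<le> 1" using assms by (simp add: powr_le1)
    then show ?thesis using assms by simp
  next
    case False
    then have "x powr r \<le> x powr 1" using assms by (intro powr_mono) auto
    then show ?thesis using assms by simp
  qed
  also have "\<dots> \<le> exp x" by (rule exp_ge_add_one_self)
  finally show ?thesis using assms by (simp add: exp_minus powr_minus le_imp_inverse_le)
qed

lemma powr_singular_integrable:
  fixes t p :: real assumes "0 \<le> t" "0 \<le> p" "p < 1"
  shows "(\<lambda>\<tau>. (t - \<tau>) powr (- p)) integrable_on {0<..<t}"
proof -
  have "((\<lambda>\<tau>. (t - \<tau>) powr (- p)) has_integral (- ((t - t) powr (1 - p) / (1 - p)) - - ((t - 0) powr (1 - p) / (1 - p)))) {0..t}"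
  proof (rule fundamental_theorem_of_calculus_interior [OF assms(1)])
    show "continuous_on {0..t} (\<lambda>\<tau>. - ((t - \<tau>) powr (1 - p) / (1 - p)))"
      using assms by (intro continuous_intros continuous_on_powr') auto
    fix x assume "x \<in> {0<..<t}"
    then show "((\<lambda>\<tau>. - ((t - \<tau>) powr (1 - p) / (1 - p))) has_vector_derivative (t - x) powr (- p)) (at x)"
      using assms unfolding has_real_derivative_iff_has_vector_derivative [symmetric]
      by (auto intro!: derivative_eq_intros)
  qed
  then show ?thesis
    unfolding has_integral_Icc_iff_Ioo [symmetric] integrable_on_Icc_iff_Ioo [symmetric] by blast
qed

text \<open>A pointwise bound with d > 0 more powers than s dominates the terms of the H^s sum by a
  family that \<open>summable_on_wt_powr\<close> can sum.\<close>

lemma weighted_square_le: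
  assumes "k \<in> Mfreq" "wt k powr (s + d) * norm (x :: complex) \<le> C"
  shows "wt k powr (2 * s) * (norm x)\<^sup>2 \<le> C\<^sup>2 * wt k powr (- (2 * d))"
proof -
  have w: "0 < wt k" using wt_ge_1 [OF assms(1)] by simp
  have "(wt k powr (s + d) * norm x)\<^sup>2 \<le> C\<^sup>2" using assms(2) by (intro power_mono) auto
  moreover have "(wt k powr (s + d))\<^sup>2 = wt k powr (2 * s + 2 * d)"
    by (simp add: power2_eq_square flip: powr_add)
  ultimately have "wt k powr (2 * s + 2 * d) * (norm x)\<^sup>2 \<le> C\<^sup>2"
    by (simp add: power_mult_distrib)
  then show ?thesis using w by (simp add: powr_add powr_minus field_simps)
qed

lemma powr_mult_le_iff: "0 < w \<Longrightarrow> x \<le> C * w powr (- p) \<longleftrightarrow> w powr p * x \<le> C" for w x C p :: real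
  by (simp add: powr_minus field_simps)

lemma norm_add_squared_le: "(norm (x + y))\<^sup>2 \<le> 2 * (norm x)\<^sup>2 + 2 * (norm (y :: 'a::real_normed_vector))\<^sup>2"
proof -
  have "(norm (x + y))\<^sup>2 \<le> (norm x + norm y)\<^sup>2" by (intro power_mono norm_triangle_ineq) simp
  also have "\<dots> \<le> 2 * (norm x)\<^sup>2 + 2 * (norm y)\<^sup>2"
    using zero_le_power2 [of "norm x - norm y"] by (simp add: power2_eq_square algebra_simps)
  finally show ?thesis .
qed

section \<open>Conjugation symmetry and regularity in H^s\<close>

lemma triad_form_cnj:
  assumes "\<And>l. l \<in> Mfreq \<Longrightarrow> d l = cnj (c (- l))"
  shows "triad_form d d k = cnj (triad_form c c (- k))"
proof -
  have t: "triad k l = cnj (triad (- k) (- l))" for l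
  proof -
    have "- k - - l = - (k - l)" by simp
    then show ?thesis unfolding triad_def by (simp only: vdir_uminus) (simp add: inner_minus_right)
  qed
  have "triad_form d d k = (\<Sum>l\<in>partners k. cnj (triad (- k) (- l) * c (- l) * c (- k - - l)))"
    unfolding triad_form_def
  proof (rule sum.cong)
    fix l assume l: "l \<in> partners k"
    have "d l = cnj (c (- l))" "d (k - l) = cnj (c (- k - - l))"
      using l assms [of l] assms [of "k - l"] by (simp_all add: partners_def)
    then show "triad k l * d l * d (k - l) = cnj (triad (- k) (- l) * c (- l) * c (- k - - l))"
      by (simp only: complex_cnj_mult t)
  qed simp
  also have "\<dots> = (\<Sum>l\<in>uminus ` partners k. cnj (triad (- k) l * c l * c (- k - l)))"
    by (subst sum.reindex) (auto simp: inj_on_def)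
  also have "uminus ` partners k = partners (- k)"
    using partners_uminus [of _ k] partners_uminus [of _ "- k"] by (auto intro: image_eqI [of _ uminus "- _"])
  finally show ?thesis by (simp add: triad_form_def)
qed

context hypodissipative
begin

text \<open>The conjugate of the reflected family solves the same system with the same data, so
  uniqueness applies.\<close>

lemma coeff_sol_symmetric:
  assumes a: "coeff_sol T a0 a" and sym: "\<And>k. k \<in> Mfreq \<Longrightarrow> a0 (- k) = cnj (a0 k)"
    and t: "t \<in> time_interval T" and k: "k \<in> Mfreq"
  shows "a t (- k) = cnj (a t k)"
proof -
  have "coeff_sol T a0 (\<lambda>t k. cnj (a t (- k)))"
    unfolding coeff_sol_def
  proof (intro conjI ballI)
    fix k assume k: "k \<in> Mfreq"
    show "cnj (a 0 (- k)) = a0 k" using a sym [OF k] k by (simp add: coeff_sol_def)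
    fix t assume t: "t \<in> time_interval T"
    have "((\<lambda>t. a t (- k)) has_vector_derivative (- mu (- k) *\<^sub>R a t (- k) - triad_form (a t) (a t) (- k))) (at t within time_interval T)"
      using a k t by (simp add: coeff_sol_def)
    then have "((\<lambda>t. cnj (a t (- k))) has_vector_derivative cnj (- mu (- k) *\<^sub>R a t (- k) - triad_form (a t) (a t) (- k))) (at t within time_interval T)"
      by (rule bounded_linear.has_vector_derivative [OF bounded_linear_cnj])
    moreover have "cnj (- mu (- k) *\<^sub>R a t (- k) - triad_form (a t) (a t) (- k)) =
        - mu k *\<^sub>R cnj (a t (- k)) - triad_form (\<lambda>k. cnj (a t (- k))) (\<lambda>k. cnj (a t (- k))) k"
      by (subst triad_form_cnj [of "\<lambda>k. cnj (a t (- k))" "a t"]) (simp_all add: mu_def)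
    ultimately show "((\<lambda>t. cnj (a t (- k))) has_vector_derivative
        - mu k *\<^sub>R cnj (a t (- k)) - triad_form (\<lambda>k. cnj (a t (- k))) (\<lambda>k. cnj (a t (- k))) k) (at t within time_interval T)"
      by simp
  next
    fix t1 assume "t1 \<in> time_interval T"
    then obtain R where R: "\<forall>t\<in>{0..t1}. \<forall>k\<in>Mfreq. wt k powr s * norm (a t k) \<le> R"
      using a unfolding coeff_sol_def by meson
    have "wt (- k) powr s * norm (a t (- k)) \<le> R" if "t \<in> {0..t1}" "k \<in> Mfreq" for t k
      using that R [rule_format, of t "- k"] by simp
    then show "\<exists>R. \<forall>t\<in>{0..t1}. \<forall>k\<in>Mfreq. wt k powr s * norm (cnj (a t (- k))) \<le> R"
      by (intro exI [of _ R]) simp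
  qed
  from coeff_sol_unique [OF a this t k] show ?thesis by simp
qed

text \<open>Using the exponent \<rho> / 2 where \<open>duhamel_bound\<close> uses \<rho> leaves
  \<alpha> * \<rho> powers of \<open>wt k\<close> unspent: crit_exp - 2 * s + 2 * \<alpha> * (\<rho>
  / 2 - 1) = - (s + \<alpha> * \<rho>).\<close>

lemma coeff_sol_correction_bound:
  assumes a: "coeff_sol T a0 a" and t1: "t1 \<in> time_interval T"
    and R: "\<And>t k. t \<in> {0..t1} \<Longrightarrow> k \<in> Mfreq \<Longrightarrow> wt k powr s * norm (a t k) \<le> R"
    and t: "t \<in> {0..t1}" and k: "k \<in> Mfreq"
  shows "wt k powr (s + \<alpha> * \<rho>) * norm (a t k - exp (- mu k * t) *\<^sub>R a0 k) \<le> triad_const * R * R * t1 powr (\<rho> / 2) * \<nu> powr (\<rho> / 2 - 1)"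
proof -
  have w: "0 < wt k" using wt_ge_1 [OF k] by simp
  have m: "0 < mu k" by (rule mu_pos [OF k])
  have R0: "0 \<le> R" using R [OF t k] by (meson mult_nonneg_nonneg norm_ge_zero order_trans powr_ge_zero)
  have tT: "t \<in> time_interval T" using t t1 time_interval_initial by blast
  have cb: "continuous_on {0..t} (\<lambda>\<tau>. triad_form (a \<tau>) (a \<tau>) k)"
    using continuous_on_subset [OF coeff_sol_continuous [OF a] time_interval_initial [OF tT]] k
    by (intro continuous_on_triad_form)
  have B: "norm (triad_form (a \<tau>) (a \<tau>) k) \<le> triad_const * R * R * wt k powr (crit_exp - s - s)" if "\<tau> \<in> {0..t}" for \<tau>
    using that t by (intro norm_triad_form_le_s k R) auto
  have "a t k - exp (- mu k * t) *\<^sub>R a0 k = - integral {0..t} (\<lambda>\<tau>. exp (- mu k * (t - \<tau>)) *\<^sub>R triad_form (a \<tau>) (a \<tau>) k)"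
    using integral_unique [OF coeff_sol_duhamel [OF a k tT]] by simp
  then have "norm (a t k - exp (- mu k * t) *\<^sub>R a0 k) = norm (integral {0..t} (\<lambda>\<tau>. exp (- mu k * (t - \<tau>)) *\<^sub>R triad_form (a \<tau>) (a \<tau>) k))"
    by simp
  also have "\<dots> \<le> triad_const * R * R * wt k powr (crit_exp - s - s) * ((1 - exp (- mu k * t)) / mu k)"
    using t by (intro exp_kernel_integral_le m cb B) auto
  also have "\<dots> \<le> triad_const * R * R * wt k powr (crit_exp - s - s) * ((mu k * t) powr (\<rho> / 2) / mu k)"
  proof (intro mult_left_mono divide_right_mono)
    show "1 - exp (- mu k * t) \<le> (mu k * t) powr (\<rho> / 2)"
      using one_minus_exp_le_powr [of "mu k * t" "\<rho> / 2"] m t rho_bounds by simp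
  qed (use m R0 triad_const_pos in auto)
  also have "(mu k * t) powr (\<rho> / 2) / mu k = t powr (\<rho> / 2) * (\<nu> powr (\<rho> / 2 - 1) * wt k powr (2 * \<alpha> * (\<rho> / 2 - 1)))"
  proof -
    have "(mu k * t) powr (\<rho> / 2) / mu k = t powr (\<rho> / 2) * mu k powr (\<rho> / 2 - 1)"
      using m t by (simp add: powr_mult powr_diff)
    then show ?thesis using nu w by (simp add: mu_def powr_mult powr_powr)
  qed
  also have "\<dots> \<le> t1 powr (\<rho> / 2) * (\<nu> powr (\<rho> / 2 - 1) * wt k powr (2 * \<alpha> * (\<rho> / 2 - 1)))"
    using t rho_bounds by (intro mult_right_mono powr_mono2) auto
  finally have "norm (a t k - exp (- mu k * t) *\<^sub>R a0 k) \<le>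
     triad_const * R * R * wt k powr (crit_exp - s - s) * (t1 powr (\<rho> / 2) * (\<nu> powr (\<rho> / 2 - 1) * wt k powr (2 * \<alpha> * (\<rho> / 2 - 1))))"
    using R0 triad_const_pos by (simp add: mult_left_mono)
  also have "\<dots> = triad_const * R * R * t1 powr (\<rho> / 2) * \<nu> powr (\<rho> / 2 - 1) * wt k powr (crit_exp - s - s + 2 * \<alpha> * (\<rho> / 2 - 1))"
    by (simp add: powr_add)
  also have "crit_exp - s - s + 2 * \<alpha> * (\<rho> / 2 - 1) = - (s + \<alpha> * \<rho>)"
    using rho_exponent by (simp add: algebra_simps)
  finally show ?thesis unfolding powr_mult_le_iff [OF w] .
qed

text \<open>The linear part is dominated by the data in H^s, and the rest decays faster than
  \<open>wt k powr (- s)\<close>. The majorant does not depend on time in [0, t1], so it yields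
  membership in H^s and also, by the M-test, continuity in time.\<close>

lemma coeff_sol_majorant:
  assumes a: "coeff_sol T a0 a" and a0: "(\<lambda>k. wt k powr (2 * s) * (norm (a0 k))\<^sup>2) summable_on Mfreq"
    and t1: "t1 \<in> time_interval T"
  shows "\<exists>m. m summable_on Mfreq \<and> (\<forall>t\<in>{0..t1}. \<forall>k\<in>Mfreq. wt k powr (2 * s) * (norm (a t k))\<^sup>2 \<le> m k)"
proof -
  obtain R where R: "\<And>t k. t \<in> {0..t1} \<Longrightarrow> k \<in> Mfreq \<Longrightarrow> wt k powr s * norm (a t k) \<le> R"
    using a t1 unfolding coeff_sol_def by meson
  define C where "C = triad_const * R * R * t1 powr (\<rho> / 2) * \<nu> powr (\<rho> / 2 - 1)"
  define m where "m k = 2 * (C\<^sup>2 * wt k powr (- (2 * (\<alpha> * \<rho>)))) + 2 * (wt k powr (2 * s) * (norm (a0 k))\<^sup>2)" for k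
  show ?thesis
  proof (intro exI [of _ m] conjI ballI)
    show "m summable_on Mfreq"
      unfolding m_def using alpha rho_bounds
      by (intro summable_on_add summable_on_cmult_right summable_on_wt_powr a0) auto
    fix t k assume t: "t \<in> {0..t1}" and k: "k \<in> Mfreq"
    let ?x = "a t k - exp (- mu k * t) *\<^sub>R a0 k" and ?y = "exp (- mu k * t) *\<^sub>R a0 k"
    have "wt k powr (2 * s) * (norm (a t k))\<^sup>2 = wt k powr (2 * s) * (norm (?x + ?y))\<^sup>2" by simp
    also have "\<dots> \<le> wt k powr (2 * s) * (2 * (norm ?x)\<^sup>2 + 2 * (norm ?y)\<^sup>2)"
      by (intro mult_left_mono norm_add_squared_le) auto
    also have "\<dots> = 2 * (wt k powr (2 * s) * (norm ?x)\<^sup>2) + 2 * (wt k powr (2 * s) * (norm ?y)\<^sup>2)"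
      by (simp add: algebra_simps)
    also have "\<dots> \<le> m k"
      unfolding m_def
    proof (intro add_mono mult_left_mono)
      show "wt k powr (2 * s) * (norm ?x)\<^sup>2 \<le> C\<^sup>2 * wt k powr (- (2 * (\<alpha> * \<rho>)))"
        unfolding C_def by (intro weighted_square_le k coeff_sol_correction_bound [OF a t1 R t k])
      have "norm ?y \<le> norm (a0 k)"
        using t mu_pos [OF k] by (auto intro!: mult_left_le_one_le)
      then show "(norm ?y)\<^sup>2 \<le> (norm (a0 k))\<^sup>2" by (intro power_mono) auto
    qed auto
    finally show "wt k powr (2 * s) * (norm (a t k))\<^sup>2 \<le> m k" .
  qed
qed

lemma coeff_sol_summable:
  assumes a: "coeff_sol T a0 a" and a0: "(\<lambda>k. wt k powr (2 * s) * (norm (a0 k))\<^sup>2) summable_on Mfreq"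
    and t: "t \<in> time_interval T"
  shows "(\<lambda>k. wt k powr (2 * s) * (norm (a t k))\<^sup>2) summable_on Mfreq"
proof -
  obtain m where m: "m summable_on Mfreq" "\<And>\<tau> k. \<tau> \<in> {0..t} \<Longrightarrow> k \<in> Mfreq \<Longrightarrow> wt k powr (2 * s) * (norm (a \<tau> k))\<^sup>2 \<le> m k"
    using coeff_sol_majorant [OF a a0 t] by blast
  have "t \<in> {0..t}" using t by (simp add: time_interval_def)
  then show ?thesis using m by (intro summable_on_comparison_test [OF m(1)]) auto
qed

text \<open>At time 0 the given \<open>u0\<close> itself is used and not the synthesized
  representative, which would agree with it only almost everywhere.\<close>

definition field :: "(real^3 \<Rightarrow> real^3) \<Rightarrow> (real \<Rightarrow> int^3 \<Rightarrow> complex) \<Rightarrow> real \<Rightarrow> real^3 \<Rightarrow> real^3" where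
  "field u0 a t = (if t = 0 then u0 else synthesize (a t))"

lemma coeff_sol_synthesis:
  assumes u0: "u0 \<in> HsM s" and a: "coeff_sol T (scalar_coeff (fhat u0)) a" and t: "t \<in> time_interval T"
  obtains R where "synthesis (a t) s R"
proof -
  obtain R where R: "\<forall>\<tau>\<in>{0..t}. \<forall>k\<in>Mfreq. wt k powr s * norm (a \<tau> k) \<le> R"
    using a t unfolding coeff_sol_def by meson
  moreover have "t \<in> {0..t}" using t by (simp add: time_interval_def)
  moreover have "a t (- k) = cnj (a t k)" if "k \<in> Mfreq" for k
    by (rule coeff_sol_symmetric [OF a scalar_coeff_fhat_uminus t that])
  ultimately have "synthesis (a t) s R" using s by unfold_locales auto
  then show ?thesis by (rule that)
qed

lemma field_HsM:
  assumes u0: "u0 \<in> HsM s" and a: "coeff_sol T (scalar_coeff (fhat u0)) a" and t: "t \<in> time_interval T"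
  shows "field u0 a t \<in> HsM s" "\<And>k. k \<in> Mfreq \<Longrightarrow> scalar_coeff (fhat (field u0 a t)) k = a t k"
proof -
  obtain R where "synthesis (a t) s R" by (rule coeff_sol_synthesis [OF assms])
  then interpret synthesis "a t" s R .
  show "field u0 a t \<in> HsM s"
    using u0 synthesize_HsM [OF coeff_sol_summable [OF a HsM_summable [OF u0] t]] by (simp add: field_def)
  show "scalar_coeff (fhat (field u0 a t)) k = a t k" if "k \<in> Mfreq" for k
    using that a scalar_coeff_synthesize by (simp add: field_def coeff_sol_def)
qed

lemma Hs_norm_field_diff:
  assumes u0: "u0 \<in> HsM s" and a: "coeff_sol T (scalar_coeff (fhat u0)) a" and t: "t \<in> time_interval T" "\<tau> \<in> time_interval T"
  shows "Hs_norm s (\<lambda>x. field u0 a \<tau> x - field u0 a t x) = sqrt (\<Sum>\<^sub>\<infinity>k\<in>Mfreq. wt k powr (2 * s) * (norm (a \<tau> k - a t k))\<^sup>2)"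
proof -
  note H = field_HsM(1) [OF u0 a t(2)] field_HsM(1) [OF u0 a t(1)]
  have f: "fhat (\<lambda>x. field u0 a \<tau> x - field u0 a t x) = (\<lambda>k. fhat (field u0 a \<tau>) k - fhat (field u0 a t) k)"
    using fhat_diff [OF HsM_L2 [OF H(1)] HsM_L2 [OF H(2)]] by auto
  have A: "adapted (\<lambda>k. fhat (field u0 a \<tau>) k - fhat (field u0 a t) k)"
    by (intro adapted_diff HsM_adapted [OF H(1)] HsM_adapted [OF H(2)])
  have "Hs_norm s (\<lambda>x. field u0 a \<tau> x - field u0 a t x) =
     sqrt (\<Sum>\<^sub>\<infinity>k\<in>Mfreq. wt k powr (2 * s) * (norm (scalar_coeff (\<lambda>k. fhat (field u0 a \<tau>) k - fhat (field u0 a t) k) k))\<^sup>2)"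
    unfolding Hs_norm_def f coeff_Hs_norm_adapted [OF A] ..
  also have "(\<Sum>\<^sub>\<infinity>k\<in>Mfreq. wt k powr (2 * s) * (norm (scalar_coeff (\<lambda>k. fhat (field u0 a \<tau>) k - fhat (field u0 a t) k) k))\<^sup>2) =
     (\<Sum>\<^sub>\<infinity>k\<in>Mfreq. wt k powr (2 * s) * (norm (a \<tau> k - a t k))\<^sup>2)"
    by (intro infsum_cong) (simp add: scalar_coeff_diff field_HsM(2) [OF u0 a t(1)] field_HsM(2) [OF u0 a t(2)])
  finally show ?thesis .
qed

lemma field_continuous:
  assumes u0: "u0 \<in> HsM s" and a: "coeff_sol T (scalar_coeff (fhat u0)) a"
  shows "continuous_HsM s T (field u0 a)"
  unfolding continuous_HsM_def
proof (intro conjI ballI)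
  fix t assume t: "t \<in> time_interval T"
  show "field u0 a t \<in> HsM s" by (rule field_HsM [OF u0 a t])
  obtain t1 where t1: "t < t1" "ereal t1 < T"
    using ereal_dense2 [of "ereal t" T] t by (auto simp: time_interval_def)
  have t1T: "t1 \<in> time_interval T" using t t1 by (auto simp: time_interval_def)
  have tt1: "t \<in> {0..t1}" using t t1 by (auto simp: time_interval_def)
  obtain m where m: "m summable_on Mfreq" "\<And>\<tau> k. \<tau> \<in> {0..t1} \<Longrightarrow> k \<in> Mfreq \<Longrightarrow> wt k powr (2 * s) * (norm (a \<tau> k))\<^sup>2 \<le> m k"
    using coeff_sol_majorant [OF a HsM_summable [OF u0] t1T] by blast
  let ?g = "\<lambda>\<tau>. sqrt (\<Sum>\<^sub>\<infinity>k\<in>Mfreq. wt k powr (2 * s) * (norm (a \<tau> k - a t k))\<^sup>2)"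
  have "continuous_on {0..t1} (\<lambda>\<tau>. \<Sum>\<^sub>\<infinity>k\<in>Mfreq. wt k powr (2 * s) * (norm (a \<tau> k - a t k))\<^sup>2)"
  proof (rule continuous_on_infsum)
    \<comment> \<open>The factor 4 comes from |x - y|^2 \<le> 2 * |x|^2 + 2 * |y|^2, with both
      squares below the majorant.\<close>
    show "(\<lambda>k. 4 * m k) summable_on Mfreq" by (intro summable_on_cmult_right m)
    fix k assume k: "k \<in> Mfreq"
    show "continuous_on {0..t1} (\<lambda>\<tau>. wt k powr (2 * s) * (norm (a \<tau> k - a t k))\<^sup>2)"
      using continuous_on_subset [OF coeff_sol_continuous [OF a k] time_interval_initial [OF t1T]]
      by (intro continuous_intros)
    fix \<tau> assume \<tau>: "\<tau> \<in> {0..t1}"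
    have "wt k powr (2 * s) * (norm (a \<tau> k - a t k))\<^sup>2 \<le> wt k powr (2 * s) * (2 * (norm (a \<tau> k))\<^sup>2 + 2 * (norm (a t k))\<^sup>2)"
      using norm_add_squared_le [of "a \<tau> k" "- a t k"] by (intro mult_left_mono) auto
    also have "\<dots> \<le> 4 * m k" using m(2) [OF \<tau> k] m(2) [OF tt1 k] by (simp add: algebra_simps)
    finally show "norm (wt k powr (2 * s) * (norm (a \<tau> k - a t k))\<^sup>2) \<le> 4 * m k" by simp
  qed
  then have "continuous_on {0..t1} ?g" by (intro continuous_intros)
  then have "(?g \<longlongrightarrow> ?g t) (at t within {0..t1})"
    unfolding continuous_on_def using tt1 by (rule bspec)
  then have "(?g \<longlongrightarrow> 0) (at t within time_interval T)"
    unfolding at_within_time_interval [OF t1] by simp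
  then show "((\<lambda>\<tau>. Hs_norm s (\<lambda>x. field u0 a \<tau> x - field u0 a t x)) \<longlongrightarrow> 0) (at t within time_interval T)"
    by (rule Lim_transform_eventually) (auto simp: eventually_at_filter Hs_norm_field_diff [OF u0 a t])
qed

text \<open>The smoothing of the semigroup is used only to the order p = 1 - \<rho> / 2 < 1: this
  keeps the singularity at \<tau> = t integrable and still leaves \<alpha> * \<rho> powers of decay
  beyond s for the sum over k.\<close>

lemma field_Bochner_integrable:
  assumes u0: "u0 \<in> HsM s" and a: "coeff_sol T (scalar_coeff (fhat u0)) a" and t: "t \<in> time_interval T"
  shows "Hs_Bochner_integrable s {0<..<t} (duhamel_integrand \<nu> \<alpha> (field u0 a) t)"
proof -
  obtain R where R: "\<And>\<tau> k. \<tau> \<in> {0..t} \<Longrightarrow> k \<in> Mfreq \<Longrightarrow> wt k powr s * norm (a \<tau> k) \<le> R"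
    using a t unfolding coeff_sol_def by meson
  have t0: "0 \<le> t" using t by (simp add: time_interval_def)
  have sub: "{0..t} \<subseteq> time_interval T" by (rule time_interval_initial [OF t])
  define g where "g \<tau> k = exp (- mu k * (t - \<tau>)) *\<^sub>R triad_form (a \<tau>) (a \<tau>) k" for \<tau> k
  have F: "duhamel_integrand \<nu> \<alpha> (field u0 a) t \<tau> k = (if k \<in> Mfreq then g \<tau> k *s cvec (vdir k) else 0)"
    if "\<tau> \<in> {0..t}" for \<tau> k
    using field_HsM [OF u0 a, of \<tau>] that sub triad_form_cong [of "scalar_coeff (fhat (field u0 a \<tau>))" "a \<tau>" _ _ k]
    by (auto simp: g_def duhamel_integrand_eq)
  have adF: "adapted (duhamel_integrand \<nu> \<alpha> (field u0 a) t \<tau>)" if "\<tau> \<in> {0..t}" for \<tau>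
    using F [OF that] by (auto simp: adapted_def)
  have acF: "scalar_coeff (duhamel_integrand \<nu> \<alpha> (field u0 a) t \<tau>) k = g \<tau> k" if "\<tau> \<in> {0..t}" "k \<in> Mfreq" for \<tau> k
    using F [OF that(1), of k] that(2) by (intro scalar_coeff_smult) auto
  have contg: "continuous_on {0..t} (\<lambda>\<tau>. g \<tau> k)" if "k \<in> Mfreq" for k
    unfolding g_def using continuous_on_subset [OF coeff_sol_continuous [OF a] sub] that
    by (intro continuous_intros)
  define p where "p = 1 - \<rho> / 2"
  have p: "0 \<le> p" "p < 1" "p \<le> 1" using rho_bounds by (auto simp: p_def)
  define D where "D = \<nu> powr (- p) * (triad_const * R * R)"
  have gb: "wt k powr (s + \<alpha> * \<rho>) * norm (g \<tau> k) \<le> (t - \<tau>) powr (- p) * D" if "\<tau> \<in> {0..<t}" "k \<in> Mfreq" for \<tau> k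
  proof -
    have \<tau>: "\<tau> \<in> {0..t}" "\<tau> < t" using that by auto
    have w: "0 < wt k" using wt_ge_1 [OF that(2)] by simp
    have "norm (g \<tau> k) = exp (- (mu k * (t - \<tau>))) * norm (triad_form (a \<tau>) (a \<tau>) k)" by (simp add: g_def)
    also have "\<dots> \<le> (mu k * (t - \<tau>)) powr (- p) * (triad_const * R * R * wt k powr (crit_exp - s - s))"
      using mu_pos [OF that(2)] \<tau> p that(2)
      by (intro mult_mono exp_minus_le_powr norm_triad_form_le_s R) auto
    also have "(mu k * (t - \<tau>)) powr (- p) = (t - \<tau>) powr (- p) * \<nu> powr (- p) * wt k powr (- (2 * \<alpha> * p))"
      using mu_pos [OF that(2)] \<tau> nu w by (simp add: mu_def powr_mult powr_powr)
    also have "\<dots> * (triad_const * R * R * wt k powr (crit_exp - s - s)) = (t - \<tau>) powr (- p) * D * wt k powr (- (2 * \<alpha> * p) + (crit_exp - s - s))"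
      by (simp only: D_def powr_add mult_ac)
    also have "- (2 * \<alpha> * p) + (crit_exp - s - s) = - (s + \<alpha> * \<rho>)"
      using rho_exponent by (simp add: p_def algebra_simps)
    finally show ?thesis unfolding powr_mult_le_iff [OF w] .
  qed
  have gb2: "wt k powr (2 * s) * (norm (g \<tau> k))\<^sup>2 \<le> ((t - \<tau>) powr (- p) * D)\<^sup>2 * wt k powr (- (2 * (\<alpha> * \<rho>)))"
    if "\<tau> \<in> {0..<t}" "k \<in> Mfreq" for \<tau> k
    by (rule weighted_square_le [OF that(2) gb [OF that]])
  have sw: "(\<lambda>k. wt k powr (- (2 * (\<alpha> * \<rho>)))) summable_on Mfreq"
    using alpha rho_bounds by (intro summable_on_wt_powr) auto
  define S where "S = (\<Sum>\<^sub>\<infinity>k\<in>Mfreq. wt k powr (- (2 * (\<alpha> * \<rho>))))"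
  have sg: "(\<lambda>k. wt k powr (2 * s) * (norm (g \<tau> k))\<^sup>2) summable_on Mfreq" if "\<tau> \<in> {0..<t}" for \<tau>
    by (rule summable_on_comparison_test [OF summable_on_cmult_right [OF sw]]) (use gb2 [OF that] in auto)
  have D0: "0 \<le> D" using triad_const_pos by (simp add: D_def mult.assoc)
  let ?G = "\<lambda>\<tau>. \<Sum>\<^sub>\<infinity>k\<in>Mfreq. wt k powr (2 * s) * (norm (g \<tau> k))\<^sup>2"
  have N: "coeff_Hs_norm s (duhamel_integrand \<nu> \<alpha> (field u0 a) t \<tau>) = sqrt (?G \<tau>)" if "\<tau> \<in> {0..<t}" for \<tau>
  proof -
    have \<tau>: "\<tau> \<in> {0..t}" using that by auto
    show ?thesis unfolding coeff_Hs_norm_adapted [OF adF [OF \<tau>]]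
      by (intro arg_cong [of _ _ sqrt] infsum_cong) (simp add: acF [OF \<tau>])
  qed
  have "?G \<tau> \<le> ((t - \<tau>) powr (- p) * D)\<^sup>2 * S" if "\<tau> \<in> {0..<t}" for \<tau>
  proof -
    have "?G \<tau> \<le> (\<Sum>\<^sub>\<infinity>k\<in>Mfreq. ((t - \<tau>) powr (- p) * D)\<^sup>2 * wt k powr (- (2 * (\<alpha> * \<rho>))))"
      by (intro infsum_mono sg that summable_on_cmult_right sw gb2)
    then show ?thesis unfolding S_def by (simp add: infsum_cmult_right')
  qed
  then have sqrtG: "sqrt (?G \<tau>) \<le> (D * sqrt S) * (t - \<tau>) powr (- p)" if "\<tau> \<in> {0..<t}" for \<tau>
    using real_sqrt_le_mono [of "?G \<tau>" "((t - \<tau>) powr (- p) * D)\<^sup>2 * S"] that D0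
    by (simp add: real_sqrt_mult mult_ac)
  \<comment> \<open>Continuity serves measurability. It is proved near each \<tau>, on an interval
    ending at some t' < t, where the singular factor is bounded by its value at t'.\<close>
  have contG: "continuous_on {0<..<t} (\<lambda>\<tau>. sqrt (?G \<tau>))"
  proof (rule continuous_on_real_sqrt, rule continuous_at_imp_continuous_on, rule ballI)
    fix \<tau> assume \<tau>: "\<tau> \<in> {0<..<t}"
    define t' where "t' = (\<tau> + t) / 2"
    have t': "\<tau> < t'" "t' < t" using \<tau> by (auto simp: t'_def)
    have "continuous_on {0<..<t'} ?G"
    proof (rule continuous_on_infsum)
      show "(\<lambda>k. ((t - t') powr (- p) * D)\<^sup>2 * wt k powr (- (2 * (\<alpha> * \<rho>)))) summable_on Mfreq"
        by (intro summable_on_cmult_right sw)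
      fix k assume k: "k \<in> Mfreq"
      show "continuous_on {0<..<t'} (\<lambda>\<tau>. wt k powr (2 * s) * (norm (g \<tau> k))\<^sup>2)"
        using t' by (intro continuous_intros continuous_on_subset [OF contg [OF k]]) auto
      fix \<sigma> assume \<sigma>: "\<sigma> \<in> {0<..<t'}"
      have "wt k powr (2 * s) * (norm (g \<sigma> k))\<^sup>2 \<le> ((t - \<sigma>) powr (- p) * D)\<^sup>2 * wt k powr (- (2 * (\<alpha> * \<rho>)))"
        using \<sigma> t' by (intro gb2 k) auto
      also have "\<dots> \<le> ((t - t') powr (- p) * D)\<^sup>2 * wt k powr (- (2 * (\<alpha> * \<rho>)))"
        using \<sigma> t' p D0 by (intro mult_right_mono power_mono mult_right_mono powr_mono2') auto
      finally show "norm (wt k powr (2 * s) * (norm (g \<sigma> k))\<^sup>2) \<le> ((t - t') powr (- p) * D)\<^sup>2 * wt k powr (- (2 * (\<alpha> * \<rho>)))"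
        by simp
    qed
    then show "isCont ?G \<tau>" using \<tau> t' by (intro continuous_on_interior [of "{0<..<t'}"]) auto
  qed
  have "(\<lambda>\<tau>. sqrt (?G \<tau>)) absolutely_integrable_on {0<..<t}"
  proof (rule measurable_bounded_by_integrable_imp_absolutely_integrable)
    show "(\<lambda>\<tau>. sqrt (?G \<tau>)) \<in> borel_measurable (lebesgue_on {0<..<t})"
      by (intro continuous_imp_measurable_on_sets_lebesgue contG) simp
    show "(\<lambda>\<tau>. (D * sqrt S) * (t - \<tau>) powr (- p)) integrable_on {0<..<t}"
      using integrable_on_cmult_left [OF powr_singular_integrable [OF t0 p(1,2)], of "D * sqrt S"] by simp
    show "norm (sqrt (?G \<tau>)) \<le> (D * sqrt S) * (t - \<tau>) powr (- p)" if "\<tau> \<in> {0<..<t}" for \<tau>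
      using sqrtG [of \<tau>] that by (simp add: infsum_nonneg)
  qed simp
  then have I: "set_integrable lebesgue {0<..<t} (\<lambda>\<tau>. coeff_Hs_norm s (duhamel_integrand \<nu> \<alpha> (field u0 a) t \<tau>))"
    by (rule set_integrable_cong [THEN iffD1, rotated -1]) (auto simp: N)
  have M: "set_borel_measurable lebesgue {0<..<t} (\<lambda>\<tau>. duhamel_integrand \<nu> \<alpha> (field u0 a) t \<tau> k)" for k
  proof -
    have "continuous_on {0<..<t} (\<lambda>\<tau>. if k \<in> Mfreq then g \<tau> k *s cvec (vdir k) else 0)"
    proof (cases "k \<in> Mfreq")
      case True
      have "continuous_on {0<..<t} (\<lambda>\<tau>. g \<tau> k)" by (rule continuous_on_subset [OF contg [OF True]]) auto
      then have "continuous_on {0<..<t} (\<lambda>\<tau>. g \<tau> k *s cvec (vdir k))"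
        by (rule bounded_linear.continuous_on [OF bounded_linear_smult_cvec])
      then show ?thesis using True by simp
    qed simp
    then have "(\<lambda>\<tau>. indicator {0<..<t} \<tau> *\<^sub>R (if k \<in> Mfreq then g \<tau> k *s cvec (vdir k) else 0)) \<in> borel_measurable borel"
      by (intro borel_measurable_continuous_on_indicator) auto
    then have "(\<lambda>\<tau>. indicator {0<..<t} \<tau> *\<^sub>R (if k \<in> Mfreq then g \<tau> k *s cvec (vdir k) else 0)) \<in> borel_measurable lebesgue"
      by (intro measurable_completion) simp
    moreover have "indicator {0<..<t} \<tau> *\<^sub>R (if k \<in> Mfreq then g \<tau> k *s cvec (vdir k) else 0) =
        indicator {0<..<t} \<tau> *\<^sub>R duhamel_integrand \<nu> \<alpha> (field u0 a) t \<tau> k" for \<tau>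
      using F [of \<tau> k] by (auto simp: indicator_def)
    ultimately show ?thesis by (simp add: set_borel_measurable_def)
  qed
  have "coeff_in_Hs s (duhamel_integrand \<nu> \<alpha> (field u0 a) t \<tau>)" if "\<tau> \<in> {0<..<t}" for \<tau>
  proof -
    have \<tau>: "\<tau> \<in> {0..t}" "\<tau> \<in> {0..<t}" using that by auto
    show ?thesis
      unfolding coeff_in_Hs_adapted [OF adF [OF \<tau>(1)]]
      using sg [OF \<tau>(2)] by (rule summable_on_cong [THEN iffD1, rotated]) (simp add: acF [OF \<tau>(1)])
  qed
  then show ?thesis using I M by (simp add: Hs_Bochner_integrable_def)
qed

lemma coeff_sol_imp_mild:
  assumes u0: "u0 \<in> HsM s" and a: "coeff_sol T (scalar_coeff (fhat u0)) a" and T: "0 < T"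
  shows "mild_solution \<nu> \<alpha> s u0 T (field u0 a)"
  unfolding mild_solution_def
proof (intro conjI allI impI)
  show "continuous_HsM s T (field u0 a)" by (rule field_continuous [OF u0 a])
  show "ae_eq (field u0 a 0) u0" by (simp add: ae_eq_def field_def)
  fix t assume t': "0 < t \<and> ereal t < T"
  then have t: "t \<in> time_interval T" by (simp add: time_interval_def)
  show "Hs_Bochner_integrable s {0<..<t} (duhamel_integrand \<nu> \<alpha> (field u0 a) t)"
    by (rule field_Bochner_integrable [OF u0 a t])
  fix k
  show "fhat (field u0 a t) k = semigroup_hat \<nu> \<alpha> t (fhat u0) k - Hs_Bochner_integral {0<..<t} (duhamel_integrand \<nu> \<alpha> (field u0 a) t) k"
  proof (cases "k \<in> Mfreq")
    case k: True
    have sub: "{0..t} \<subseteq> time_interval T" by (rule time_interval_initial [OF t])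
    have "Hs_Bochner_integral {0<..<t} (duhamel_integrand \<nu> \<alpha> (field u0 a) t) k =
       (LINT \<tau>:{0<..<t}|lebesgue. (exp (- mu k * (t - \<tau>)) *\<^sub>R triad_form (a \<tau>) (a \<tau>) k) *s cvec (vdir k))"
      unfolding Hs_Bochner_integral_def
    proof (intro set_lebesgue_integral_cong allI impI)
      fix \<tau> assume "\<tau> \<in> {0<..<t}"
      then have \<tau>: "\<tau> \<in> time_interval T" using sub by auto
      show "duhamel_integrand \<nu> \<alpha> (field u0 a) t \<tau> k = (exp (- mu k * (t - \<tau>)) *\<^sub>R triad_form (a \<tau>) (a \<tau>) k) *s cvec (vdir k)"
        using k triad_form_cong [of "scalar_coeff (fhat (field u0 a \<tau>))" "a \<tau>" "scalar_coeff (fhat (field u0 a \<tau>))" "a \<tau>" k]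
        by (simp add: duhamel_integrand_eq field_HsM [OF u0 a \<tau>])
    qed simp
    also have "\<dots> = integral {0..t} (\<lambda>\<tau>. exp (- mu k * (t - \<tau>)) *\<^sub>R triad_form (a \<tau>) (a \<tau>) k) *s cvec (vdir k)"
      using continuous_on_subset [OF coeff_sol_continuous [OF a] sub] k
      by (intro open_interval_integral continuous_intros)
    also have "\<dots> = (exp (- mu k * t) *\<^sub>R scalar_coeff (fhat u0) k - a t k) *s cvec (vdir k)"
      using integral_unique [OF coeff_sol_duhamel [OF a k t]] by simp
    finally have 1: "Hs_Bochner_integral {0<..<t} (duhamel_integrand \<nu> \<alpha> (field u0 a) t) k = (exp (- mu k * t) *\<^sub>R scalar_coeff (fhat u0) k - a t k) *s cvec (vdir k)" .
    have 2: "semigroup_hat \<nu> \<alpha> t (fhat u0) k = (exp (- mu k * t) *\<^sub>R scalar_coeff (fhat u0) k) *s cvec (vdir k)"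
      unfolding semigroup_hat_eq by (subst adapted_eq [OF HsM_adapted [OF u0] k]) (rule scaleR_smult_cvec)
    have 3: "fhat (field u0 a t) k = a t k *s cvec (vdir k)"
      using adapted_eq [OF HsM_adapted [OF field_HsM(1) [OF u0 a t]] k] field_HsM(2) [OF u0 a t k] by simp
    show ?thesis unfolding 1 2 3 smult_cvec_diff by simp
  next
    case k: False
    have z: "fhat (field u0 a t) k = 0" "fhat u0 k = 0"
      using HsM_adapted [OF field_HsM(1) [OF u0 a t]] HsM_adapted [OF u0] k by (auto simp: adapted_def)
    have "Hs_Bochner_integral {0<..<t} (duhamel_integrand \<nu> \<alpha> (field u0 a) t) k = (LINT \<tau>:{0<..<t}|lebesgue. 0)"
      unfolding Hs_Bochner_integral_def
      using k field_HsM(1) [OF u0 a] time_interval_initial [OF t]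
      by (intro set_lebesgue_integral_cong) (auto simp: duhamel_integrand_eq subset_iff)
    then show ?thesis by (simp add: z semigroup_hat_eq set_lebesgue_integral_def)
  qed
qed (use T in auto)

end

subsection \<open>Smoothing\<close>

text \<open>Enumerating the infinite countable index set turns the claim into termwise
  differentiation of a series, with uniform convergence of the derivatives supplied by the bound
  B.\<close>

lemma has_derivative_infsum:
  fixes f :: "'k \<Rightarrow> 'a::real_normed_vector \<Rightarrow> 'b::banach"
  assumes A: "countable A" and S: "open S" "convex S"
    and f: "\<And>k x. k \<in> A \<Longrightarrow> x \<in> S \<Longrightarrow> (f k has_derivative f' k x) (at x)"
    and B: "\<And>k x h. k \<in> A \<Longrightarrow> x \<in> S \<Longrightarrow> norm (f' k x h) \<le> B k * norm h" "B summable_on A"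
    and summ: "\<And>x. x \<in> S \<Longrightarrow> (\<lambda>k. norm (f k x)) summable_on A" and x: "x \<in> S"
  shows "((\<lambda>x. \<Sum>\<^sub>\<infinity>k\<in>A. f k x) has_derivative (\<lambda>h. \<Sum>\<^sub>\<infinity>k\<in>A. f' k x h)) (at x)"
proof (cases "finite A")
  case True
  then show ?thesis using f x by (auto intro!: has_derivative_sum)
next
  case False
  define e where "e = from_nat_into A"
  have e: "bij_betw e UNIV A" unfolding e_def using A False by (rule bij_betw_from_nat_into)
  have eA: "e n \<in> A" for n using e by (auto simp: bij_betw_def)
  have sums: "(\<lambda>n. g (e n)) sums infsum g A" if "(\<lambda>k. norm (g k)) summable_on A" for g :: "'k \<Rightarrow> 'b"
  proof -
    have "g summable_on A" using that by (rule Infinite_Sum.abs_summable_summable)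
    then have "(\<lambda>n. g (e n)) summable_on UNIV" by (simp add: summable_on_reindex_bij_betw [OF e])
    moreover have "infsum (\<lambda>n. g (e n)) UNIV = infsum g A" by (rule infsum_reindex_bij_betw [OF e])
    ultimately show ?thesis using has_sum_imp_sums [of "\<lambda>n. g (e n)" "infsum g A"] by (simp add: has_sum_iff)
  qed
  have Bs: "summable (\<lambda>n. B (e n))"
    using B(2) by (intro summable_on_imp_summable) (simp add: summable_on_reindex_bij_betw [OF e])
  have fs: "(\<lambda>k. norm (f' k x h)) summable_on A" if "x \<in> S" for x h
  proof (rule summable_on_comparison_test)
    show "(\<lambda>k. B k * norm h) summable_on A" using B(2) by (rule summable_on_cmult_left)
  qed (use B(1) that in auto)
  have unif: "\<forall>\<^sub>F n in sequentially. \<forall>x\<in>S. \<forall>h. norm ((\<Sum>i<n. f' (e i) x h) - (\<Sum>\<^sub>\<infinity>k\<in>A. f' k x h)) \<le> r * norm h"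
    if r: "r > 0" for r
  proof -
    obtain N where N: "\<And>n. n \<ge> N \<Longrightarrow> norm (\<Sum>i. B (e (i + n))) < r"
      using suminf_exist_split [OF r Bs] by blast
    show ?thesis
    proof (rule eventually_sequentiallyI [of N], intro ballI allI)
      fix n x h assume n: "N \<le> n" and x: "x \<in> S"
      have s1: "(\<lambda>n. f' (e n) x h) sums (\<Sum>\<^sub>\<infinity>k\<in>A. f' k x h)" by (rule sums [OF fs [OF x]])
      then have "(\<Sum>\<^sub>\<infinity>k\<in>A. f' k x h) - (\<Sum>i<n. f' (e i) x h) = (\<Sum>i. f' (e (i + n)) x h)"
        using suminf_minus_initial_segment [of "\<lambda>n. f' (e n) x h" n] by (simp add: sums_iff)
      then have "norm ((\<Sum>i<n. f' (e i) x h) - (\<Sum>\<^sub>\<infinity>k\<in>A. f' k x h)) = norm (\<Sum>i. f' (e (i + n)) x h)"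
        by (metis norm_minus_commute)
      also have "\<dots> \<le> (\<Sum>i. B (e (i + n)) * norm h)"
      proof (rule norm_suminf_le)
        show "norm (f' (e (i + n)) x h) \<le> B (e (i + n)) * norm h" for i by (rule B(1) [OF eA x])
        show "summable (\<lambda>i. B (e (i + n)) * norm h)"
          using Bs by (intro summable_mult2) (simp add: summable_iff_shift [of "\<lambda>i. B (e i)"])
      qed
      also have "\<dots> = (\<Sum>i. B (e (i + n))) * norm h"
        using Bs by (intro suminf_mult2 [symmetric]) (simp add: summable_iff_shift [of "\<lambda>i. B (e i)"])
      also have "\<dots> \<le> r * norm h"
        using N [OF n] by (intro mult_right_mono) auto
      finally show "norm ((\<Sum>i<n. f' (e i) x h) - (\<Sum>\<^sub>\<infinity>k\<in>A. f' k x h)) \<le> r * norm h" .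
    qed
  qed
  have "\<exists>g. \<forall>x\<in>S. (\<lambda>n. f (e n) x) sums g x \<and> (g has_derivative (\<lambda>h. \<Sum>\<^sub>\<infinity>k\<in>A. f' k x h)) (at x within S)"
  proof (rule has_derivative_series [where f = "\<lambda>n. f (e n)" and f' = "\<lambda>n. f' (e n)", OF S(2) _ unif x sums [OF summ [OF x]]])
    show "(f (e n) has_derivative f' (e n) x) (at x within S)" if "x \<in> S" for n x
      using f [OF eA that] by (rule has_derivative_at_withinI)
  qed
  then obtain g where g: "\<And>x. x \<in> S \<Longrightarrow> (\<lambda>n. f (e n) x) sums g x"
      "(g has_derivative (\<lambda>h. \<Sum>\<^sub>\<infinity>k\<in>A. f' k x h)) (at x within S)"
    using x by blast
  have eq: "g y = (\<Sum>\<^sub>\<infinity>k\<in>A. f k y)" if "y \<in> S" for y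
    using sums_unique2 [OF g(1) [OF that] sums [OF summ [OF that]]] .
  have "(g has_derivative (\<lambda>h. \<Sum>\<^sub>\<infinity>k\<in>A. f' k x h)) (at x)"
    using g(2) unfolding at_within_open [OF x S(1)] .
  then show ?thesis
    by (rule has_derivative_transform_within_open [where f = g, OF _ S(1) x]) (rule eq)
qed

text \<open>The exponential beats every power: y / N \<le> exp (y / N) is raised to the N-th power,
  with N positive and at least p / b.\<close>

lemma powr_mult_exp_bounded:
  fixes c b p :: real
  assumes "0 < c" "0 < b"
  obtains C where "0 \<le> C" "\<And>w. 1 \<le> w \<Longrightarrow> w powr p * exp (- (c * w powr b)) \<le> C"
proof -
  obtain N :: nat where N0: "p / b < N" using reals_Archimedean2 by blast
  define N' where "N' = Suc N"
  have N: "p \<le> b * N'" "0 < N'" using N0 assms by (auto simp: N'_def field_simps)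
  define C where "C = (N' / c) ^ N'"
  show ?thesis
  proof
    show "0 \<le> C" using assms by (simp add: C_def)
    fix w :: real assume w: "1 \<le> w"
    define y where "y = c * w powr b"
    have y: "0 < y" using assms w by (simp add: y_def)
    have "y / N' \<le> exp (y / N')" using exp_ge_add_one_self [of "y / N'"] by linarith
    then have "(y / N') ^ N' \<le> exp (y / N') ^ N'" using y by (intro power_mono) auto
    also have "\<dots> = exp y" using N by (simp flip: exp_of_nat_mult)
    finally have 1: "(y / N') ^ N' \<le> exp y" .
    have "w powr p \<le> w powr (b * N')" using w N by (intro powr_mono) auto
    also have "\<dots> = (w powr b) ^ N'" using w by (simp add: powr_powr flip: powr_realpow)
    also have "\<dots> = C * (y / N') ^ N'"
      using assms N by (simp add: C_def y_def power_mult_distrib power_divide)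
    also have "\<dots> \<le> C * exp y" using 1 \<open>0 \<le> C\<close> by (intro mult_left_mono)
    finally show "w powr p * exp (- (c * w powr b)) \<le> C"
      by (simp add: y_def [symmetric] exp_minus field_simps)
  qed
qed

subsection \<open>Rapidly decaying families of coefficients\<close>

abbreviation (input) open_times :: "ereal \<Rightarrow> real set" where
  "open_times T \<equiv> {t. 0 < t \<and> ereal t < T}"

lemma open_open_times: "open (open_times T)"
proof -
  have "open {t. ereal t < T}"
  proof (cases T)
    case (real r)
    then show ?thesis by (simp add: open_Collect_less)
  qed auto
  moreover have "open_times T = {0<..} \<inter> {t. ereal t < T}" by auto
  ultimately show ?thesis by (simp only:) (intro open_Int open_greaterThan)
qed

lemma open_times_neighbours:
  assumes "t \<in> open_times T" obtains t0 t1 where "t0 \<in> open_times T" "t1 \<in> open_times T" "t0 < t" "t < t1"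
proof -
  obtain t1 where t1: "t < t1" "ereal t1 < T" using assms ereal_dense2 [of "ereal t" T] by auto
  have "t / 2 \<in> open_times T" using assms by (auto intro: le_less_trans [of "ereal (t / 2)" "ereal t"])
  moreover have "t1 \<in> open_times T" using t1 assms by auto
  ultimately show ?thesis using that [of "t / 2" t1] assms t1 by simp
qed

lemma open_times_between: "t1 \<in> open_times T \<Longrightarrow> 0 < t \<Longrightarrow> t \<le> t1 \<Longrightarrow> t \<in> open_times T"
  by (auto intro: le_less_trans [of "ereal t" "ereal t1"])

text \<open>Uniformity is demanded only between two times of J. With J = \<open>open_times T\<close>
  nothing is claimed as t tends to 0, where the data are merely in H^s.\<close>

definition rapidly_decaying :: "real set \<Rightarrow> (real \<Rightarrow> int^3 \<Rightarrow> complex) \<Rightarrow> bool" where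
  "rapidly_decaying J c \<longleftrightarrow> (\<forall>r. \<forall>t0\<in>J. \<forall>t1\<in>J. \<exists>R. \<forall>t\<in>{t0..t1}. \<forall>k\<in>Mfreq. wt k powr r * norm (c t k) \<le> R)"

text \<open>The existence of n time derivatives, each rapidly decaying. Only time is differentiated
  here, because a derivative in space multiplies coefficients by a symbol of polynomial growth,
  under which the class is stable.\<close>

primrec smooth_family :: "nat \<Rightarrow> real set \<Rightarrow> (real \<Rightarrow> int^3 \<Rightarrow> complex) \<Rightarrow> bool" where
  "smooth_family 0 J c \<longleftrightarrow> rapidly_decaying J c"
| "smooth_family (Suc n) J c \<longleftrightarrow> rapidly_decaying J c \<and>
     (\<exists>c'. (\<forall>k\<in>Mfreq. \<forall>t\<in>J. ((\<lambda>t. c t k) has_vector_derivative c' t k) (at t)) \<and> smooth_family n J c')"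

lemma smooth_family_rapidly_decaying: "smooth_family n J c \<Longrightarrow> rapidly_decaying J c"
  by (cases n) auto

lemma smooth_family_Suc_imp: "smooth_family (Suc n) J c \<Longrightarrow> smooth_family n J c"
proof (induction n arbitrary: c)
  case (Suc n)
  obtain c' where c': "\<forall>k\<in>Mfreq. \<forall>t\<in>J. ((\<lambda>t. c t k) has_vector_derivative c' t k) (at t)" "smooth_family (Suc n) J c'"
    using Suc.prems by auto
  have "smooth_family n J c'" using Suc.IH [OF c'(2)] .
  then show ?case using smooth_family_rapidly_decaying [OF Suc.prems] c'(1) unfolding smooth_family.simps(2) by blast
qed simp

lemma rapidly_decaying_add:
  assumes "rapidly_decaying J c" "rapidly_decaying J d" shows "rapidly_decaying J (\<lambda>t k. c t k + d t k)"
  unfolding rapidly_decaying_def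
proof (intro allI ballI)
  fix r t0 t1 assume t: "t0 \<in> J" "t1 \<in> J"
  obtain R S where R: "\<forall>t\<in>{t0..t1}. \<forall>k\<in>Mfreq. wt k powr r * norm (c t k) \<le> R"
    and S: "\<forall>t\<in>{t0..t1}. \<forall>k\<in>Mfreq. wt k powr r * norm (d t k) \<le> S"
    using assms t unfolding rapidly_decaying_def by meson
  have "wt k powr r * norm (c t k + d t k) \<le> R + S" if "t \<in> {t0..t1}" "k \<in> Mfreq" for t k
  proof -
    have "wt k powr r * norm (c t k + d t k) \<le> wt k powr r * (norm (c t k) + norm (d t k))"
      by (intro mult_left_mono norm_triangle_ineq) auto
    also have "\<dots> \<le> R + S" using R S that by (simp add: ring_distribs add_mono)
    finally show ?thesis .
  qed
  then show "\<exists>R. \<forall>t\<in>{t0..t1}. \<forall>k\<in>Mfreq. wt k powr r * norm (c t k + d t k) \<le> R" by blast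
qed

lemma rapidly_decaying_mult:
  assumes "rapidly_decaying J c" and m: "\<And>k. k \<in> Mfreq \<Longrightarrow> norm (m k) \<le> C * wt k powr p"
  shows "rapidly_decaying J (\<lambda>t k. m k * c t k)"
  unfolding rapidly_decaying_def
proof (intro allI ballI)
  fix r t0 t1 assume t: "t0 \<in> J" "t1 \<in> J"
  obtain R where R: "\<forall>t\<in>{t0..t1}. \<forall>k\<in>Mfreq. wt k powr (r + p) * norm (c t k) \<le> R"
    using assms t unfolding rapidly_decaying_def by meson
  have "wt k powr r * norm (m k * c t k) \<le> \<bar>C\<bar> * R" if "t \<in> {t0..t1}" "k \<in> Mfreq" for t k
  proof -
    have "norm (m k) \<le> \<bar>C\<bar> * wt k powr p"
      using m [OF that(2)] by (meson abs_ge_self mult_right_mono order_trans powr_ge_zero)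
    then have "wt k powr r * norm (m k * c t k) \<le> wt k powr r * (\<bar>C\<bar> * wt k powr p * norm (c t k))"
      unfolding norm_mult by (intro mult_left_mono mult_right_mono) auto
    also have "\<dots> = \<bar>C\<bar> * (wt k powr (r + p) * norm (c t k))" by (simp add: powr_add)
    also have "\<dots> \<le> \<bar>C\<bar> * R" using R that by (intro mult_left_mono) auto
    finally show ?thesis .
  qed
  then show "\<exists>R. \<forall>t\<in>{t0..t1}. \<forall>k\<in>Mfreq. wt k powr r * norm (m k * c t k) \<le> R" by blast
qed

lemma rapidly_decaying_triad_form:
  assumes "rapidly_decaying J c" "rapidly_decaying J d" shows "rapidly_decaying J (\<lambda>t. triad_form (c t) (d t))"
  unfolding rapidly_decaying_def
proof (intro allI ballI)
  fix r t0 t1 assume t: "t0 \<in> J" "t1 \<in> J"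
  \<comment> \<open>Chosen so that r + \<open>crit_exp\<close> - 2 * q \<le> 0, with half of the
    required decay taken from each factor.\<close>
  define q where "q = (\<bar>r\<bar> + crit_exp) / 2"
  have q: "0 \<le> q" "r + (crit_exp - q - q) \<le> 0" using crit_exp_bounds by (auto simp: q_def)
  obtain R S where R: "\<forall>t\<in>{t0..t1}. \<forall>k\<in>Mfreq. wt k powr q * norm (c t k) \<le> R"
    and S: "\<forall>t\<in>{t0..t1}. \<forall>k\<in>Mfreq. wt k powr q * norm (d t k) \<le> S"
    using assms t unfolding rapidly_decaying_def by meson
  have "wt k powr r * norm (triad_form (c t) (d t) k) \<le> 5184 * pi * 2 powr (q + q) * R * S" if "t \<in> {t0..t1}" "k \<in> Mfreq" for t k
  proof -
    have RS: "0 \<le> R" "0 \<le> S"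
      using R S that by (meson mult_nonneg_nonneg norm_ge_zero order_trans powr_ge_zero)+
    have "norm (triad_form (c t) (d t) k) \<le> 5184 * pi * 2 powr (q + q) * R * S * wt k powr (crit_exp - q - q)"
      using R S that q by (intro norm_triad_form_le) auto
    then have "wt k powr r * norm (triad_form (c t) (d t) k) \<le> wt k powr r * (5184 * pi * 2 powr (q + q) * R * S * wt k powr (crit_exp - q - q))"
      by (intro mult_left_mono) auto
    also have "\<dots> = 5184 * pi * 2 powr (q + q) * R * S * wt k powr (r + (crit_exp - q - q))"
      by (simp only: powr_add mult_ac)
    also have "\<dots> \<le> 5184 * pi * 2 powr (q + q) * R * S * wt k powr 0"
      using q wt_ge_1 [OF that(2)] RS by (intro mult_left_mono powr_mono) auto
    finally show ?thesis using wt_ge_1 [OF that(2)] by simp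
  qed
  then show "\<exists>R. \<forall>t\<in>{t0..t1}. \<forall>k\<in>Mfreq. wt k powr r * norm (triad_form (c t) (d t) k) \<le> R" by blast
qed

lemma smooth_family_add: "smooth_family n J c \<Longrightarrow> smooth_family n J d \<Longrightarrow> smooth_family n J (\<lambda>t k. c t k + d t k)"
proof (induction n arbitrary: c d)
  case (Suc n)
  obtain c' where c': "\<And>k t. k \<in> Mfreq \<Longrightarrow> t \<in> J \<Longrightarrow> ((\<lambda>t. c t k) has_vector_derivative c' t k) (at t)" "smooth_family n J c'"
    using Suc.prems(1) by auto
  obtain d' where d': "\<And>k t. k \<in> Mfreq \<Longrightarrow> t \<in> J \<Longrightarrow> ((\<lambda>t. d t k) has_vector_derivative d' t k) (at t)" "smooth_family n J d'"
    using Suc.prems(2) by auto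
  show ?case
    unfolding smooth_family.simps(2)
  proof (intro conjI exI [of _ "\<lambda>t k. c' t k + d' t k"] ballI)
    show "rapidly_decaying J (\<lambda>t k. c t k + d t k)" using Suc.prems by (intro rapidly_decaying_add) auto
    show "smooth_family n J (\<lambda>t k. c' t k + d' t k)" by (rule Suc.IH [OF c'(2) d'(2)])
  qed (auto intro!: has_vector_derivative_add c' d')
qed (simp add: rapidly_decaying_add)

lemma smooth_family_mult:
  assumes m: "\<And>k. k \<in> Mfreq \<Longrightarrow> norm (m k) \<le> C * wt k powr p"
  shows "smooth_family n J c \<Longrightarrow> smooth_family n J (\<lambda>t k. m k * c t k)"
proof (induction n arbitrary: c)
  case (Suc n)
  obtain c' where c': "\<And>k t. k \<in> Mfreq \<Longrightarrow> t \<in> J \<Longrightarrow> ((\<lambda>t. c t k) has_vector_derivative c' t k) (at t)" "smooth_family n J c'"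
    using Suc.prems by auto
  show ?case
    unfolding smooth_family.simps(2)
  proof (intro conjI exI [of _ "\<lambda>t k. m k * c' t k"] ballI)
    show "rapidly_decaying J (\<lambda>t k. m k * c t k)" using Suc.prems m by (intro rapidly_decaying_mult) auto
    show "smooth_family n J (\<lambda>t k. m k * c' t k)" by (rule Suc.IH [OF c'(2)])
  qed (auto intro!: has_vector_derivative_mult_right c')
qed (simp add: rapidly_decaying_mult [OF _ m])

lemma triad_form_has_vector_derivative:
  assumes "\<And>l. l \<in> Mfreq \<Longrightarrow> ((\<lambda>t. c t l) has_vector_derivative c' l) (at t)"
    "\<And>l. l \<in> Mfreq \<Longrightarrow> ((\<lambda>t. d t l) has_vector_derivative d' l) (at t)"
  shows "((\<lambda>t. triad_form (c t) (d t) k) has_vector_derivative triad_form c' (d t) k + triad_form (c t) d' k) (at t)"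
  unfolding triad_form_def sum.distrib [symmetric]
  using assms
  by (auto intro!: has_vector_derivative_sum derivative_eq_intros simp: partners_def algebra_simps)

text \<open>The product rule pairs the derivative of one factor, of order n, with the other factor,
  of order n + 1; hence \<open>smooth_family_Suc_imp\<close>.\<close>

lemma smooth_family_triad_form: "smooth_family n J c \<Longrightarrow> smooth_family n J d \<Longrightarrow> smooth_family n J (\<lambda>t. triad_form (c t) (d t))"
proof (induction n arbitrary: c d)
  case (Suc n)
  obtain c' where c': "\<And>k t. k \<in> Mfreq \<Longrightarrow> t \<in> J \<Longrightarrow> ((\<lambda>t. c t k) has_vector_derivative c' t k) (at t)" "smooth_family n J c'"
    using Suc.prems(1) by auto
  obtain d' where d': "\<And>k t. k \<in> Mfreq \<Longrightarrow> t \<in> J \<Longrightarrow> ((\<lambda>t. d t k) has_vector_derivative d' t k) (at t)" "smooth_family n J d'"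
    using Suc.prems(2) by auto
  show ?case
    unfolding smooth_family.simps(2)
  proof (intro conjI exI [of _ "\<lambda>t k. triad_form (c' t) (d t) k + triad_form (c t) (d' t) k"] ballI)
    show "rapidly_decaying J (\<lambda>t. triad_form (c t) (d t))" using Suc.prems by (intro rapidly_decaying_triad_form) auto
    show "smooth_family n J (\<lambda>t k. triad_form (c' t) (d t) k + triad_form (c t) (d' t) k)"
      by (intro smooth_family_add Suc.IH c' d' smooth_family_Suc_imp [OF Suc.prems(1)] smooth_family_Suc_imp [OF Suc.prems(2)])
  qed (intro triad_form_has_vector_derivative c' d')
qed (simp add: rapidly_decaying_triad_form)

context hypodissipative
begin

text \<open>Restart at h = t0 / 2. For t \<ge> t0 the linear part is damped by exp (- \<nu> * h *
  \<open>wt k powr (2 * \<alpha>)\<close>), which beats every power, while in the Duhamel term the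
  full dissipation gains 2 * \<alpha> over the order \<open>crit_exp - r - r\<close> of the
  quadratic term.\<close>

lemma coeff_sol_smoothing_step:
  assumes a: "coeff_sol T a0 a" and r: "0 \<le> r"
    and bnd: "\<And>t0 t1. t0 \<in> open_times T \<Longrightarrow> t1 \<in> open_times T \<Longrightarrow> \<exists>R. \<forall>t\<in>{t0..t1}. \<forall>k\<in>Mfreq. wt k powr r * norm (a t k) \<le> R"
    and t0: "t0 \<in> open_times T" and t1: "t1 \<in> open_times T"
  shows "\<exists>R. \<forall>t\<in>{t0..t1}. \<forall>k\<in>Mfreq. wt k powr (2 * r - crit_exp + 2 * \<alpha>) * norm (a t k) \<le> R"
proof -
  define q where "q = 2 * r - crit_exp + 2 * \<alpha>"
  define h where "h = t0 / 2"
  have h: "0 < h" "h \<in> open_times T" using t0 open_times_between [OF t0, of h] by (auto simp: h_def)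
  have hT: "h \<in> time_interval T" using h by (simp add: time_interval_def)
  obtain R where R: "\<And>t k. t \<in> {h..t1} \<Longrightarrow> k \<in> Mfreq \<Longrightarrow> wt k powr r * norm (a t k) \<le> R"
    using bnd [OF h(2) t1] by blast
  obtain C where C: "0 \<le> C" "\<And>w. 1 \<le> w \<Longrightarrow> w powr (q - r) * exp (- (\<nu> * h * w powr (2 * \<alpha>))) \<le> C"
    using powr_mult_exp_bounded [of "\<nu> * h" "2 * \<alpha>" "q - r"] nu h alpha by auto
  define F where "F = 5184 * pi * 2 powr (r + r) * R * R"
  have sh: "coeff_sol (T - ereal h) (a h) (\<lambda>t. a (t + h))" by (rule coeff_sol_shift [OF a hT])
  have "wt k powr q * norm (a t k) \<le> C * R + F / \<nu>" if t: "t \<in> {t0..t1}" and k: "k \<in> Mfreq" for t k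
  proof -
    have w: "1 \<le> wt k" by (rule wt_ge_1 [OF k])
    have m: "0 < mu k" by (rule mu_pos [OF k])
    have th: "h \<le> t - h" "h \<le> t" using t h by (auto simp: h_def)
    have R0: "0 \<le> R" using R [of t k] t th k by (meson atLeastAtMost_iff mult_nonneg_nonneg norm_ge_zero order_trans powr_ge_zero)
    have \<tau>T: "t - h \<in> time_interval (T - ereal h)"
      using th h(1) open_times_between [OF t1, of t] t by (cases T) (auto simp: time_interval_def)
    let ?I = "integral {0..t - h} (\<lambda>\<tau>. exp (- mu k * (t - h - \<tau>)) *\<^sub>R triad_form (a (\<tau> + h)) (a (\<tau> + h)) k)"
    have "a t k = exp (- mu k * (t - h)) *\<^sub>R a h k - ?I"
      using integral_unique [OF coeff_sol_duhamel [OF sh k \<tau>T]] by simp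
    then have "norm (a t k) \<le> exp (- (mu k * (t - h))) * norm (a h k) + norm ?I"
      using norm_triangle_ineq4 [of "exp (- mu k * (t - h)) *\<^sub>R a h k" ?I] by simp
    moreover have "norm ?I \<le> F * wt k powr (crit_exp - r - r) * ((1 - exp (- mu k * (t - h))) / mu k)"
    proof (rule exp_kernel_integral_le [OF m])
      show "0 \<le> t - h" using th h by simp
      show "continuous_on {0..t - h} (\<lambda>\<tau>. triad_form (a (\<tau> + h)) (a (\<tau> + h)) k)"
        using continuous_on_subset [OF coeff_sol_continuous [OF sh] time_interval_initial [OF \<tau>T]] k
        by (intro continuous_on_triad_form)
      fix \<tau> assume "\<tau> \<in> {0..t - h}"
      then show "norm (triad_form (a (\<tau> + h)) (a (\<tau> + h)) k) \<le> F * wt k powr (crit_exp - r - r)"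
        unfolding F_def using R t by (intro norm_triad_form_le k r) auto
    qed
    moreover have "F * wt k powr (crit_exp - r - r) * ((1 - exp (- mu k * (t - h))) / mu k) \<le> F * wt k powr (crit_exp - r - r) * (1 / mu k)"
      using m R0 by (intro mult_left_mono divide_right_mono) (auto simp: F_def)
    ultimately have "wt k powr q * norm (a t k) \<le> wt k powr q * (exp (- (mu k * (t - h))) * norm (a h k) + F * wt k powr (crit_exp - r - r) * (1 / mu k))"
      by (intro mult_left_mono) auto
    also have "\<dots> = wt k powr (q - r) * exp (- (mu k * (t - h))) * (wt k powr r * norm (a h k)) + F * (wt k powr q * wt k powr (crit_exp - r - r)) / mu k"
      using w by (simp add: ring_distribs powr_diff)
    also have "F * (wt k powr q * wt k powr (crit_exp - r - r)) / mu k = F / \<nu>"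
      using w nu by (simp add: mu_def q_def flip: powr_add)
    also have "wt k powr (q - r) * exp (- (mu k * (t - h))) * (wt k powr r * norm (a h k)) \<le> C * R"
    proof (intro mult_mono)
      have "exp (- (mu k * (t - h))) \<le> exp (- (\<nu> * h * wt k powr (2 * \<alpha>)))"
        using mult_left_mono [OF th(1), of "mu k"] m by (simp add: mu_def mult_ac)
      then have "wt k powr (q - r) * exp (- (mu k * (t - h))) \<le> wt k powr (q - r) * exp (- (\<nu> * h * wt k powr (2 * \<alpha>)))"
        by (intro mult_left_mono) auto
      also have "\<dots> \<le> C" by (rule C(2) [OF w])
      finally show "wt k powr (q - r) * exp (- (mu k * (t - h))) \<le> C" .
      show "wt k powr r * norm (a h k) \<le> R" using R [OF _ k, of h] t th by auto
    qed (use C in auto)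
    finally show ?thesis by simp
  qed
  then show ?thesis unfolding q_def by blast
qed

text \<open>The smoothing step takes the power s + n * d to at least s + (n + 1) * d, where d = s -
  crit_exp + 2 * \<alpha> is positive by the lower bound on s. Iteration reaches every
  power.\<close>

lemma coeff_sol_rapidly_decaying:
  assumes a: "coeff_sol T a0 a" shows "rapidly_decaying (open_times T) a"
proof -
  define d where "d = s - crit_exp + 2 * \<alpha>"
  have d: "0 < d" using s by (simp add: d_def)
  have mono: "wt k powr r * x \<le> R" if "wt k powr r' * x \<le> R" "r \<le> r'" "k \<in> Mfreq" "0 \<le> x" for k r r' x R
  proof -
    have "wt k powr r * x \<le> wt k powr r' * x"
      using that wt_ge_1 [OF that(3)] by (intro mult_right_mono powr_mono) auto
    then show ?thesis using that(1) by linarith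
  qed
  have bnd: "\<exists>R. \<forall>t\<in>{t0..t1}. \<forall>k\<in>Mfreq. wt k powr (s + n * d) * norm (a t k) \<le> R"
    if "t0 \<in> open_times T" "t1 \<in> open_times T" for n :: nat and t0 t1
    using that
  proof (induction n arbitrary: t0 t1)
    case 0
    then have "t1 \<in> time_interval T" by (simp add: time_interval_def)
    then obtain R where R: "\<forall>t\<in>{0..t1}. \<forall>k\<in>Mfreq. wt k powr s * norm (a t k) \<le> R"
      using a unfolding coeff_sol_def by meson
    then show ?case using 0 by (intro exI [of _ R]) auto
  next
    case (Suc n)
    have "\<exists>R. \<forall>t\<in>{t0..t1}. \<forall>k\<in>Mfreq. wt k powr (2 * (s + n * d) - crit_exp + 2 * \<alpha>) * norm (a t k) \<le> R"
      using s d Suc.prems by (intro coeff_sol_smoothing_step [OF a _ Suc.IH]) auto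
    then obtain R where R: "\<forall>t\<in>{t0..t1}. \<forall>k\<in>Mfreq. wt k powr (2 * (s + n * d) - crit_exp + 2 * \<alpha>) * norm (a t k) \<le> R"
      by blast
    have "s + Suc n * d \<le> 2 * (s + n * d) - crit_exp + 2 * \<alpha>"
    proof -
      have "2 * (s + n * d) - crit_exp + 2 * \<alpha> = s + Suc n * d + n * d" by (simp add: d_def algebra_simps)
      moreover have "0 \<le> n * d" using d by simp
      ultimately show ?thesis by linarith
    qed
    then show ?case using R mono by (intro exI [of _ R]) (meson norm_ge_zero)
  qed
  show ?thesis
    unfolding rapidly_decaying_def
  proof (intro allI ballI)
    fix r t0 t1 assume t: "t0 \<in> open_times T" "t1 \<in> open_times T"
    obtain n :: nat where "r / d < n" using reals_Archimedean2 by blast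
    then have "r \<le> s + n * d" using d s by (simp add: field_simps)
    then show "\<exists>R. \<forall>t\<in>{t0..t1}. \<forall>k\<in>Mfreq. wt k powr r * norm (a t k) \<le> R"
      using bnd [OF t, of n] mono by (meson norm_ge_zero)
  qed
qed

lemma coeff_sol_derivative:
  assumes a: "coeff_sol T a0 a" and "k \<in> Mfreq" "t \<in> open_times T"
  shows "((\<lambda>t. a t k) has_vector_derivative - mu k *\<^sub>R a t k - triad_form (a t) (a t) k) (at t)"
proof -
  have "((\<lambda>t. a t k) has_vector_derivative - mu k *\<^sub>R a t k - triad_form (a t) (a t) k) (at t within time_interval T)"
    using assms by (auto simp: coeff_sol_def time_interval_def)
  then have "((\<lambda>t. a t k) has_vector_derivative - mu k *\<^sub>R a t k - triad_form (a t) (a t) k) (at t within open_times T)"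
    by (rule has_vector_derivative_within_subset) (auto simp: time_interval_def)
  then show ?thesis using assms(3) by (simp only: at_within_open [OF _ open_open_times])
qed

text \<open>Bootstrap: the system expresses the time derivative through a multiplier of polynomial
  growth and the bilinear form, both of which preserve the class.\<close>

lemma coeff_sol_smooth_family:
  assumes a: "coeff_sol T a0 a" shows "smooth_family n (open_times T) a"
proof (induction n)
  case 0
  then show ?case using coeff_sol_rapidly_decaying [OF a] by simp
next
  case (Suc n)
  show ?case
    unfolding smooth_family.simps(2)
  proof (intro conjI exI [of _ "\<lambda>t k. of_real (- mu k) * a t k + (- 1) * triad_form (a t) (a t) k"] ballI)
    show "rapidly_decaying (open_times T) a" by (rule coeff_sol_rapidly_decaying [OF a])
    have 1: "smooth_family n (open_times T) (\<lambda>t k. of_real (- mu k) * a t k)"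
      using nu by (intro smooth_family_mult [where C = \<nu> and p = "2 * \<alpha>", OF _ Suc.IH]) (simp add: mu_def norm_mult)
    have 2: "smooth_family n (open_times T) (\<lambda>t k. (- 1) * triad_form (a t) (a t) k)"
      using wt_ge_1 by (intro smooth_family_mult [where C = 1 and p = 0, OF _ smooth_family_triad_form [OF Suc.IH Suc.IH]]) force
    show "smooth_family n (open_times T) (\<lambda>t k. of_real (- mu k) * a t k + (- 1) * triad_form (a t) (a t) k)"
      by (rule smooth_family_add [OF 1 2])
    fix k t assume "k \<in> Mfreq" "t \<in> open_times T"
    from coeff_sol_derivative [OF a this]
    show "((\<lambda>t. a t k) has_vector_derivative of_real (- mu k) * a t k + (- 1) * triad_form (a t) (a t) k) (at t)"
      by (simp add: scaleR_conv_of_real)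
  qed
qed

end

subsection \<open>Joint smoothness of synthesized fields\<close>

lemma fourier_series_component_coeff: "fourier_series (component_coeff a i) x = (\<Sum>\<^sub>\<infinity>k\<in>Mfreq. a k * of_real (vdir k $ i) * torus_char k x)"
  unfolding fourier_series_def by (intro infsum_cong_neutral) (auto simp: component_coeff_def)

lemma has_derivative_torus_char: "(torus_char k has_derivative (\<lambda>y. 2 * pi * \<i> * of_real (rvec k \<bullet> y) * torus_char k x)) (at x)"
proof -
  have "((\<lambda>x. 2 * pi * \<i> * complex_of_real (rvec k \<bullet> x)) has_derivative (\<lambda>y. 2 * pi * \<i> * of_real (rvec k \<bullet> y))) (at x)"
    by (auto intro!: derivative_eq_intros)
  then have "((\<lambda>x. exp (2 * pi * \<i> * complex_of_real (rvec k \<bullet> x))) has_derivative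
      (\<lambda>y. 2 * pi * \<i> * of_real (rvec k \<bullet> y) * exp (2 * pi * \<i> * complex_of_real (rvec k \<bullet> x)))) (at x)"
    by (subst mult.commute) (rule has_derivative_compose [OF _ DERIV_exp [unfolded has_field_derivative_def]])
  then show ?thesis by (simp add: torus_char_def [abs_def])
qed

text \<open>Coefficients of the derivative of the synthesized field in the space-time direction v.
  The derivative is again a synthesized field, which allows induction on the order of
  differentiability.\<close>

definition deriv_family :: "(real \<Rightarrow> int^3 \<Rightarrow> complex) \<Rightarrow> (real \<Rightarrow> int^3 \<Rightarrow> complex) \<Rightarrow> real \<times> (real^3) \<Rightarrow> real \<Rightarrow> int^3 \<Rightarrow> complex" where
  "deriv_family c c' v t k = of_real (fst v) * c' t k + 2 * pi * \<i> * of_real (rvec k \<bullet> snd v) * c t k"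

text \<open>Termwise differentiation on a slab around t. Two powers of decay for \<open>c\<close>
  and one for \<open>c'\<close> leave, after the factor \<open>wt k\<close> of a space derivative,
  the summable majorant \<open>wt k powr (- 1)\<close>.\<close>

lemma synthesize_has_derivative:
  assumes c: "rapidly_decaying (open_times T) c" and c': "rapidly_decaying (open_times T) c'"
    and d: "\<And>k t. k \<in> Mfreq \<Longrightarrow> t \<in> open_times T \<Longrightarrow> ((\<lambda>t. c t k) has_vector_derivative c' t k) (at t)"
    and t: "t \<in> open_times T"
  shows "((\<lambda>(t, x). synthesize (c t) x) has_derivative (\<lambda>v. synthesize (deriv_family c c' v t) x)) (at (t, x))"
proof -
  obtain t0 t1 where tt: "t0 \<in> open_times T" "t1 \<in> open_times T" "t0 < t" "t < t1"
    using open_times_neighbours [OF t] .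
  have sub: "\<tau> \<in> open_times T" if "\<tau> \<in> {t0..t1}" for \<tau>
    using that tt open_times_between [OF tt(2), of \<tau>] by auto
  obtain R1 where R1: "\<And>\<tau> k. \<tau> \<in> {t0..t1} \<Longrightarrow> k \<in> Mfreq \<Longrightarrow> wt k powr 1 * norm (c' \<tau> k) \<le> R1"
    using c' tt unfolding rapidly_decaying_def by meson
  obtain R2 where R2: "\<And>\<tau> k. \<tau> \<in> {t0..t1} \<Longrightarrow> k \<in> Mfreq \<Longrightarrow> wt k powr 2 * norm (c \<tau> k) \<le> R2"
    using c tt unfolding rapidly_decaying_def by meson
  let ?S = "{t0<..<t1} \<times> (UNIV :: (real^3) set)"
  define f where "f i k p = c (fst p) k * of_real (vdir k $ i) * torus_char k (snd p)" for i k and p :: "real \<times> (real^3)"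
  define f' where "f' i k p v = deriv_family c c' v (fst p) k * of_real (vdir k $ i) * torus_char k (snd p)" for i k and p v :: "real \<times> (real^3)"
  have vd: "\<bar>vdir k $ i\<bar> \<le> 1" if "k \<in> Mfreq" for k i
    using norm_vdir [OF that] component_le_norm_cart [of "vdir k" i] by simp
  have fourier_series: "((\<lambda>p. \<Sum>\<^sub>\<infinity>k\<in>Mfreq. f i k p) has_derivative (\<lambda>v. \<Sum>\<^sub>\<infinity>k\<in>Mfreq. f' i k (t, x) v)) (at (t, x))" for i
  proof (rule has_derivative_infsum [where S = ?S and B = "\<lambda>k. (R1 + R2) * wt k powr (- 1)"])
    show "open ?S" by (intro open_Times) auto
    show "convex ?S" by (intro convex_Times) auto
    show "(\<lambda>k. (R1 + R2) * wt k powr (- 1)) summable_on Mfreq"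
      by (intro summable_on_cmult_right summable_on_wt_powr) simp
    show "(t, x) \<in> ?S" using tt by simp
    fix k p assume k: "k \<in> Mfreq" and p: "p \<in> ?S"
    then have fp: "fst p \<in> {t0..t1}" by auto
    have "((\<lambda>t. c t k) has_derivative (\<lambda>h. h *\<^sub>R c' (fst p) k)) (at (fst p))"
      using d [OF k sub [OF fp]] by (simp add: has_vector_derivative_def)
    then have "((\<lambda>p. c (fst p) k) has_derivative (\<lambda>v. fst v *\<^sub>R c' (fst p) k)) (at p)"
      by (rule has_derivative_compose [OF has_derivative_fst [OF has_derivative_ident], of "\<lambda>t. c t k"])
    moreover have "((\<lambda>p. torus_char k (snd p)) has_derivative (\<lambda>v. 2 * pi * \<i> * of_real (rvec k \<bullet> snd v) * torus_char k (snd p))) (at p)"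
      by (rule has_derivative_compose [OF has_derivative_snd [OF has_derivative_ident] has_derivative_torus_char])
    ultimately show "(f i k has_derivative f' i k p) (at p)"
      unfolding f_def [abs_def] f'_def [abs_def] deriv_family_def
      by (auto intro!: derivative_eq_intros simp: scaleR_conv_of_real algebra_simps)
  next
    fix k p v assume k: "k \<in> Mfreq" and p: "p \<in> ?S"
    then have fp: "fst p \<in> {t0..t1}" by auto
    have w: "1 \<le> wt k" by (rule wt_ge_1 [OF k])
    have "norm (f' i k p v) \<le> norm (deriv_family c c' v (fst p) k) * 1"
      using vd [OF k, of i] by (simp add: f'_def norm_mult mult_left_le)
    also have "\<dots> \<le> \<bar>fst v\<bar> * norm (c' (fst p) k) + 2 * pi * \<bar>rvec k \<bullet> snd v\<bar> * norm (c (fst p) k)"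
      unfolding deriv_family_def
      by (rule order_trans [OF eq_refl [OF mult_1_right] norm_triangle_le]) (simp add: norm_mult)
    also have "\<dots> \<le> norm v * norm (c' (fst p) k) + (wt k * norm v) * norm (c (fst p) k)"
    proof (intro add_mono mult_right_mono)
      show "\<bar>fst v\<bar> \<le> norm v" using norm_fst_le [of "fst v" "snd v"] by simp
      have "\<bar>rvec k \<bullet> snd v\<bar> \<le> norm (rvec k) * norm (snd v)" by (rule Cauchy_Schwarz_ineq2)
      also have "\<dots> \<le> norm (rvec k) * norm v" using norm_snd_le [of "snd v" "fst v"] by (intro mult_left_mono) auto
      finally show "2 * pi * \<bar>rvec k \<bullet> snd v\<bar> \<le> wt k * norm v" by (simp add: wt_def)
    qed auto
    also have "\<dots> = (wt k powr 1 * norm (c' (fst p) k) + wt k powr 2 * norm (c (fst p) k)) * wt k powr (- 1) * norm v"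
      using w by (simp add: powr_minus field_simps power2_eq_square)
    also have "\<dots> \<le> (R1 + R2) * wt k powr (- 1) * norm v"
      using R1 [OF fp k] R2 [OF fp k] by (intro mult_right_mono add_mono) auto
    finally show "norm (f' i k p v) \<le> (R1 + R2) * wt k powr (- 1) * norm v" .
  next
    fix p assume p: "p \<in> ?S"
    then have fp: "fst p \<in> {t0..t1}" by auto
    show "(\<lambda>k. norm (f i k p)) summable_on Mfreq"
    proof (rule summable_on_comparison_test)
      show "(\<lambda>k. R2 * wt k powr (- 2)) summable_on Mfreq"
        by (intro summable_on_cmult_right summable_on_wt_powr) simp
      fix k assume k: "k \<in> Mfreq"
      have w: "0 < wt k" using wt_ge_1 [OF k] by simp
      have "norm (f i k p) \<le> norm (c (fst p) k) * 1"
        using vd [OF k, of i] by (simp add: f_def norm_mult mult_left_le)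
      also have "\<dots> \<le> R2 * wt k powr (- 2)"
        unfolding powr_mult_le_iff [OF w] using R2 [OF fp k] by simp
      finally show "norm (f i k p) \<le> R2 * wt k powr (- 2)" .
    qed simp
  qed (rule countable_Mfreq)
  have "((\<lambda>p. Re (\<Sum>\<^sub>\<infinity>k\<in>Mfreq. f i k p)) has_derivative (\<lambda>v. Re (\<Sum>\<^sub>\<infinity>k\<in>Mfreq. f' i k (t, x) v))) (at (t, x))" for i
    by (rule bounded_linear.has_derivative [OF bounded_linear_Re fourier_series])
  then have "((\<lambda>p. synthesize (c (fst p)) (snd p) $ i) has_derivative (\<lambda>v. synthesize (deriv_family c c' v t) x $ i)) (at (t, x))" for i
    by (simp add: synthesize_def fourier_series_component_coeff f_def f'_def)
  then have "((\<lambda>p. synthesize (c (fst p)) (snd p)) has_derivative (\<lambda>v. synthesize (deriv_family c c' v t) x)) (at (t, x))"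
    unfolding has_derivative_componentwise_within [of "\<lambda>p. synthesize (c (fst p)) (snd p)"]
    by (auto simp: Basis_vec_def inner_axis)
  then show ?thesis by (simp add: case_prod_beta')
qed

lemma smooth_family_deriv_family:
  assumes "smooth_family n J c" "smooth_family n J c'" shows "smooth_family n J (deriv_family c c' v)"
proof -
  have 1: "smooth_family n J (\<lambda>t k. of_real (fst v) * c' t k)"
    using wt_ge_1 by (intro smooth_family_mult [where C = "\<bar>fst v\<bar>" and p = 0, OF _ assms(2)]) force
  have 2: "smooth_family n J (\<lambda>t k. (2 * pi * \<i> * of_real (rvec k \<bullet> snd v)) * c t k)"
  proof (rule smooth_family_mult [where C = "norm (snd v)" and p = 1, OF _ assms(1)])
    fix k assume k: "k \<in> Mfreq"
    have "norm (2 * pi * \<i> * of_real (rvec k \<bullet> snd v)) = 2 * pi * \<bar>rvec k \<bullet> snd v\<bar>" by (simp add: norm_mult)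
    also have "\<dots> \<le> 2 * pi * (norm (rvec k) * norm (snd v))"
      by (intro mult_left_mono Cauchy_Schwarz_ineq2) auto
    finally show "norm (2 * pi * \<i> * of_real (rvec k \<bullet> snd v)) \<le> norm (snd v) * wt k powr 1"
      by (simp add: wt_def mult_ac)
  qed
  from smooth_family_add [OF 1 2] show ?thesis by (simp add: deriv_family_def [abs_def])
qed

section \<open>Differentiability of every order\<close>

lemma Ck_on_cong:
  assumes "open S" "\<And>x. x \<in> S \<Longrightarrow> f x = g x"
  shows "Ck_on n f S \<Longrightarrow> Ck_on n g S"
  using assms(2)
proof (induction n arbitrary: f g)
  case 0
  then show ?case by (metis Ck_on.simps(1) continuous_on_cong)
next
  case (Suc n)
  have hd: "(g has_derivative D) (at x)" if "x \<in> S" "(f has_derivative D) (at x)" for D x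
    by (rule has_derivative_transform_within_open [OF that(2) assms(1) that(1)]) (rule Suc.prems(2))
  have diff: "g differentiable at x" if "x \<in> S" for x
    using Suc.prems(1) that hd unfolding Ck_on.simps differentiable_def by blast
  have fd: "frechet_derivative f (at x) v = frechet_derivative g (at x) v" if "x \<in> S" for x v
  proof -
    have "(f has_derivative frechet_derivative f (at x)) (at x)"
      using Suc.prems(1) that by (simp add: frechet_derivative_works [symmetric])
    then have "(g has_derivative frechet_derivative f (at x)) (at x)" by (rule hd [OF that])
    then show ?thesis by (metis frechet_derivative_at)
  qed
  show ?case
    unfolding Ck_on.simps
  proof (intro conjI ballI allI diff)
    fix v
    have "Ck_on n (\<lambda>x. frechet_derivative f (at x) v) S" using Suc.prems(1) by simp
    then show "Ck_on n (\<lambda>x. frechet_derivative g (at x) v) S"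
      by (rule Suc.IH) (simp add: fd)
  qed
qed

text \<open>The index is \<open>Suc n\<close> because in the base case continuity is obtained from
  differentiability, which takes one time derivative.\<close>

lemma synthesize_Ck_on:
  assumes "smooth_family (Suc n) (open_times T) c"
  shows "Ck_on n (\<lambda>(t, x). synthesize (c t) x) (open_times T \<times> UNIV)"
  using assms
proof (induction n arbitrary: c)
  case 0
  then obtain c' where c': "\<And>k t. k \<in> Mfreq \<Longrightarrow> t \<in> open_times T \<Longrightarrow> ((\<lambda>t. c t k) has_vector_derivative c' t k) (at t)" "rapidly_decaying (open_times T) c'"
    by auto
  have "isCont (\<lambda>(t, x). synthesize (c t) x) p" if "p \<in> open_times T \<times> UNIV" for p
  proof -
    have "fst p \<in> open_times T" using that by auto
    from has_derivative_continuous [OF synthesize_has_derivative [OF smooth_family_rapidly_decaying [OF 0] c'(2) c'(1) this], of "snd p"]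
    show ?thesis by simp
  qed
  then show ?case by (auto intro: continuous_at_imp_continuous_on)
next
  case (Suc n)
  then obtain c' where c': "\<And>k t. k \<in> Mfreq \<Longrightarrow> t \<in> open_times T \<Longrightarrow> ((\<lambda>t. c t k) has_vector_derivative c' t k) (at t)" "smooth_family (Suc n) (open_times T) c'"
    by auto
  have D: "((\<lambda>(t, x). synthesize (c t) x) has_derivative (\<lambda>v. synthesize (deriv_family c c' v (fst p)) (snd p))) (at p)"
    if "p \<in> open_times T \<times> UNIV" for p
    using synthesize_has_derivative [OF smooth_family_rapidly_decaying [OF Suc.prems] smooth_family_rapidly_decaying [OF c'(2)] c'(1), of "fst p" "snd p"] that
    by auto
  show ?case
    unfolding Ck_on.simps
  proof (intro conjI ballI allI)
    show "(\<lambda>(t, x). synthesize (c t) x) differentiable at p" if "p \<in> open_times T \<times> UNIV" for p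
      using D [OF that] by (auto simp: differentiable_def)
    fix v
    have "Ck_on n (\<lambda>(t, x). synthesize (deriv_family c c' v t) x) (open_times T \<times> UNIV)"
      by (intro Suc.IH smooth_family_deriv_family smooth_family_Suc_imp [OF Suc.prems] c'(2))
    then show "Ck_on n (\<lambda>p. frechet_derivative (\<lambda>(t, x). synthesize (c t) x) (at p) v) (open_times T \<times> UNIV)"
    proof (rule Ck_on_cong [rotated 2])
      show "open (open_times T \<times> (UNIV :: (real^3) set))" by (intro open_Times open_open_times) auto
      fix p assume p: "p \<in> open_times T \<times> (UNIV :: (real^3) set)"
      show "(case p of (t, x) \<Rightarrow> synthesize (deriv_family c c' v t) x) = frechet_derivative (\<lambda>(t, x). synthesize (c t) x) (at p) v"
        unfolding frechet_derivative_at [OF D [OF p], symmetric] by (simp add: case_prod_beta)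
    qed
  qed
qed

lemma (in hypodissipative) field_smooth:
  assumes "coeff_sol T a0 a" shows "smooth_on (\<lambda>(t, x). field u0 a t x) (open_times T \<times> UNIV)"
  unfolding smooth_on_def
proof
  fix n
  have "Ck_on n (\<lambda>(t, x). synthesize (a t) x) (open_times T \<times> UNIV)"
    by (intro synthesize_Ck_on coeff_sol_smooth_family [OF assms])
  then show "Ck_on n (\<lambda>(t, x). field u0 a t x) (open_times T \<times> UNIV)"
    by (rule Ck_on_cong [rotated 2]) (auto simp: field_def intro!: open_Times open_open_times)
qed

subsection \<open>Energy balance\<close>

text \<open>One power of decay per factor and \<open>crit_exp\<close> \<le> 1 make the double sum
  over pairs absolutely convergent, so it may be reordered. An involution of the pairs that reverses
  the sign of each term then shows that the sum is its own negative.\<close>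

lemma energy_flux_zero:
  assumes sym: "\<And>k. k \<in> Mfreq \<Longrightarrow> c (- k) = cnj (c k)"
    and R: "\<And>k. k \<in> Mfreq \<Longrightarrow> wt k powr 1 * norm (c k) \<le> R"
  shows "(\<Sum>\<^sub>\<infinity>k\<in>Mfreq. cnj (c k) * triad_form c c k) = 0"
proof -
  define f where "f = (\<lambda>(k, l). cnj (c k) * (triad k l * c l * c (k - l)))"
  let ?P = "Sigma Mfreq partners"
  define C where "C = R * (16 * pi * (2 * R) * (2 * R))"
  have fb: "norm (f (k, l)) \<le> C * wt k powr (- 1)" if k: "k \<in> Mfreq" and l: "l \<in> partners k" for k l
  proof -
    have w: "1 \<le> wt k" by (rule wt_ge_1 [OF k])
    have R0: "0 \<le> R" using R [OF k] by (meson mult_nonneg_nonneg norm_ge_zero order_trans powr_ge_zero)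
    have 1: "norm (c l) \<le> 2 powr 1 * wt k powr (- 1) * R"
      by (intro powr_partners_le [OF k l] R partners_subset_Mfreq [OF l]) auto
    have 2: "norm (c (k - l)) \<le> 2 powr 1 * wt k powr (- 1) * R"
      by (intro powr_partners_le [OF k partners_swap [OF l]] R partners_subset_Mfreq [OF partners_swap [OF l]]) auto
    have 3: "norm (c k) \<le> R * wt k powr (- 1)"
      unfolding powr_mult_le_iff [OF less_le_trans [OF zero_less_one w]] by (rule R [OF k])
    have "norm (f (k, l)) = norm (c k) * (norm (triad k l) * norm (c l) * norm (c (k - l)))"
      by (simp add: f_def norm_mult)
    also have "\<dots> \<le> (R * wt k powr (- 1)) * ((16 * pi * wt k powr crit_exp) * (2 powr 1 * wt k powr (- 1) * R) * (2 powr 1 * wt k powr (- 1) * R))"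
      using 1 2 3 norm_triad_le [OF k l] R0 by (intro mult_mono) auto
    also have "\<dots> = C * wt k powr (crit_exp + (- 1) + (- 1) + (- 1))"
      by (simp only: powr_add C_def powr_one mult_ac)
    also have "\<dots> \<le> C * wt k powr (- 1)"
      using w crit_exp_bounds R0 by (intro mult_left_mono powr_mono) (auto simp: C_def)
    finally show ?thesis .
  qed
  have nsum: "(\<lambda>x. norm (f x)) summable_on ?P"
    unfolding Infinite_Sum.abs_summable_on_Sigma_iff
  proof (intro conjI ballI)
    fix k assume "k \<in> Mfreq"
    then show "(\<lambda>l. norm (f (k, l))) summable_on partners k" by (simp add: partners_finite_card)
  next
    show "(\<lambda>k. norm (\<Sum>\<^sub>\<infinity>l\<in>partners k. norm (f (k, l)))) summable_on Mfreq"
    proof (rule summable_on_comparison_test)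
      show "(\<lambda>k. (324 * C) * wt k powr (- 1)) summable_on Mfreq"
        by (intro summable_on_cmult_right summable_on_wt_powr) simp
      fix k assume k: "k \<in> Mfreq"
      have C0: "0 \<le> C * wt k powr (- 1)"
      proof -
        have "0 \<le> R" using R [OF k] by (meson mult_nonneg_nonneg norm_ge_zero order_trans powr_ge_zero)
        then show ?thesis by (simp add: C_def)
      qed
      have "norm (\<Sum>\<^sub>\<infinity>l\<in>partners k. norm (f (k, l))) = (\<Sum>l\<in>partners k. norm (f (k, l)))"
        using k by (simp add: partners_finite_card sum_nonneg)
      also have "\<dots> \<le> of_nat (card (partners k)) * (C * wt k powr (- 1))"
        by (intro sum_bounded_above fb k)
      also have "\<dots> \<le> 324 * (C * wt k powr (- 1))"
        using partners_finite_card(2) [OF k] C0 by (intro mult_right_mono) auto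
      finally show "norm (\<Sum>\<^sub>\<infinity>l\<in>partners k. norm (f (k, l))) \<le> (324 * C) * wt k powr (- 1)" by simp
    qed simp
  qed
  then have fsum: "f summable_on ?P" by (rule Infinite_Sum.abs_summable_summable)
  \<comment> \<open>Exchanges the modes k and k - l up to sign and keeps the advecting mode
    l.\<close>
  define j where "j = (\<lambda>(k :: int^3, l). (l - k, l))"
  have jP: "j x \<in> ?P" if xP: "x \<in> ?P" for x
  proof -
    obtain k l where x: "x = (k, l)" "k \<in> Mfreq" "l \<in> Mfreq" "k - l \<in> Mfreq"
      using xP by (auto simp: partners_def)
    have "l - k \<in> Mfreq" using x(4) uminus_Mfreq_iff [of "k - l"] by simp
    then show ?thesis using x by (simp add: j_def partners_def)
  qed
  have img: "j ` ?P \<subseteq> ?P" by (rule image_subsetI) (rule jP)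
  have bij: "bij_betw j ?P ?P"
  proof (rule bij_betw_byWitness [where f' = j])
    show "\<forall>x\<in>?P. j (j x) = x" "\<forall>x\<in>?P. j (j x) = x" by (auto simp: j_def)
    show "j ` ?P \<subseteq> ?P" "j ` ?P \<subseteq> ?P" by (rule img)+
  qed
  \<comment> \<open>The two terms of the triad \<open>l + (k - l) + (-k) = 0\<close> with advecting mode \<open>l\<close> cancel,
    because \<open>vdir l\<close> is orthogonal to \<open>l\<close>.\<close>
  have fj: "f (j x) = - f x" if xP: "x \<in> ?P" for x
  proof -
    obtain k l where x: "x = (k, l)" "k \<in> Mfreq" "l \<in> Mfreq" "k - l \<in> Mfreq"
      using xP by (auto simp: partners_def)
    have v: "vdir (l - k) = vdir (k - l)" using vdir_uminus [of "k - l"] by simp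
    have t: "triad (l - k) l = - triad k l"
      using vdir_orthogonal [OF x(3)] by (simp add: triad_def v inner_diff_right inner_commute [of "vdir k"])
    have "c (l - k) = cnj (c (k - l))" using sym [OF x(4)] by simp
    then show ?thesis using sym [OF x(2)] by (simp add: f_def j_def x(1) t mult_ac)
  qed
  have "infsum f ?P = infsum (\<lambda>x. f (j x)) ?P" by (rule infsum_reindex_bij_betw [OF bij, symmetric])
  also have "\<dots> = infsum (\<lambda>x. - f x) ?P" by (intro infsum_cong fj)
  also have "\<dots> = - infsum f ?P" by (rule infsum_uminus)
  finally have z: "infsum f ?P = 0" by simp
  have "(\<Sum>\<^sub>\<infinity>k\<in>Mfreq. cnj (c k) * triad_form c c k) = (\<Sum>\<^sub>\<infinity>k\<in>Mfreq. \<Sum>\<^sub>\<infinity>l\<in>partners k. f (k, l))"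
    by (intro infsum_cong) (simp add: partners_finite_card f_def triad_form_def sum_distrib_left)
  also have "\<dots> = infsum f ?P" by (rule infsum_Sigma_banach [OF fsum])
  finally show ?thesis using z by simp
qed

context hypodissipative
begin

text \<open>The derivative of |a_k|^2 is -2 * \<open>mu k\<close> * |a_k|^2 minus twice the real
  part Y of the flux, and the flux sums to zero by \<open>energy_flux_zero\<close>. Rapid decay on a
  compact interval around t justifies differentiating under the sum.\<close>

lemma energy_derivative:
  assumes a: "coeff_sol T a0 a" and sym: "\<And>k. k \<in> Mfreq \<Longrightarrow> a0 (- k) = cnj (a0 k)" and t: "t \<in> open_times T"
  shows "((\<lambda>t. \<Sum>\<^sub>\<infinity>k\<in>Mfreq. (norm (a t k))\<^sup>2) has_vector_derivative
    - (2 * \<nu>) * (\<Sum>\<^sub>\<infinity>k\<in>Mfreq. wt k powr (2 * \<alpha>) * (norm (a t k))\<^sup>2)) (at t)"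
proof -
  obtain t0 t1 where tt: "t0 \<in> open_times T" "t1 \<in> open_times T" "t0 < t" "t < t1"
    using open_times_neighbours [OF t] .
  have sub: "\<tau> \<in> open_times T" if "\<tau> \<in> {t0..t1}" for \<tau>
    using that tt open_times_between [OF tt(2), of \<tau>] by auto
  note rd = coeff_sol_rapidly_decaying [OF a]
  obtain R0 where R0: "\<And>\<tau> k. \<tau> \<in> {t0..t1} \<Longrightarrow> k \<in> Mfreq \<Longrightarrow> wt k powr 1 * norm (a \<tau> k) \<le> R0"
    using rd tt unfolding rapidly_decaying_def by meson
  obtain R1 where R1: "\<And>\<tau> k. \<tau> \<in> {t0..t1} \<Longrightarrow> k \<in> Mfreq \<Longrightarrow> wt k powr (2 * \<alpha>) * norm (a \<tau> k) \<le> R1"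
    using rd tt unfolding rapidly_decaying_def by meson
  obtain R2 where R2: "\<And>\<tau> k. \<tau> \<in> {t0..t1} \<Longrightarrow> k \<in> Mfreq \<Longrightarrow> wt k powr 0 * norm (triad_form (a \<tau>) (a \<tau>) k) \<le> R2"
    using rapidly_decaying_triad_form [OF rd rd] tt unfolding rapidly_decaying_def by meson
  have tin: "t \<in> {t0..t1}" using tt by auto
  define X where "X \<tau> k = wt k powr (2 * \<alpha>) * (norm (a \<tau> k))\<^sup>2" for \<tau> k
  define Y where "Y \<tau> k = Re (cnj (a \<tau> k) * triad_form (a \<tau>) (a \<tau>) k)" for \<tau> k
  have a0b: "norm (a \<tau> k) \<le> R0 * wt k powr (- 1)" if "\<tau> \<in> {t0..t1}" "k \<in> Mfreq" for \<tau> k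
    unfolding powr_mult_le_iff [OF less_le_trans [OF zero_less_one wt_ge_1 [OF that(2)]]] by (rule R0 [OF that])
  have Xb: "\<bar>X \<tau> k\<bar> \<le> R1 * (R0 * wt k powr (- 1))" if "\<tau> \<in> {t0..t1}" "k \<in> Mfreq" for \<tau> k
  proof -
    have "\<bar>X \<tau> k\<bar> = (wt k powr (2 * \<alpha>) * norm (a \<tau> k)) * norm (a \<tau> k)"
      by (simp add: X_def power2_eq_square)
    also have "\<dots> \<le> R1 * (R0 * wt k powr (- 1))"
      using R1 [OF that] a0b [OF that] by (intro mult_mono) (auto intro: order_trans [OF _ R1 [OF that]])
    finally show ?thesis .
  qed
  have Yb: "\<bar>Y \<tau> k\<bar> \<le> R2 * (R0 * wt k powr (- 1))" if "\<tau> \<in> {t0..t1}" "k \<in> Mfreq" for \<tau> k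
  proof -
    have B: "norm (triad_form (a \<tau>) (a \<tau>) k) \<le> R2" using R2 [OF that] wt_ge_1 [OF that(2)] by simp
    have "\<bar>Y \<tau> k\<bar> \<le> norm (cnj (a \<tau> k) * triad_form (a \<tau>) (a \<tau>) k)" unfolding Y_def by (rule abs_Re_le_cmod)
    also have "\<dots> = norm (triad_form (a \<tau>) (a \<tau>) k) * norm (a \<tau> k)" by (simp add: norm_mult)
    also have "\<dots> \<le> R2 * (R0 * wt k powr (- 1))"
      using B a0b [OF that] by (intro mult_mono) (auto intro: order_trans [OF _ B])
    finally show ?thesis .
  qed
  have sw: "(\<lambda>k. wt k powr (- 1)) summable_on Mfreq" by (intro summable_on_wt_powr) simp
  have sX: "(\<lambda>k. X t k) summable_on Mfreq"
  proof (rule Infinite_Sum.abs_summable_summable, rule summable_on_comparison_test)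
    show "(\<lambda>k. R1 * (R0 * wt k powr (- 1))) summable_on Mfreq" by (intro summable_on_cmult_right sw)
  qed (use Xb tin in auto)
  have sY: "(\<lambda>k. cnj (a t k) * triad_form (a t) (a t) k) summable_on Mfreq"
  proof (rule Infinite_Sum.abs_summable_summable, rule summable_on_comparison_test)
    show "(\<lambda>k. R2 * (R0 * wt k powr (- 1))) summable_on Mfreq" by (intro summable_on_cmult_right sw)
    fix k assume k: "k \<in> Mfreq"
    have B: "norm (triad_form (a t) (a t) k) \<le> R2" using R2 [OF tin k] wt_ge_1 [OF k] by simp
    have "norm (cnj (a t k) * triad_form (a t) (a t) k) = norm (triad_form (a t) (a t) k) * norm (a t k)" by (simp add: norm_mult)
    also have "\<dots> \<le> R2 * (R0 * wt k powr (- 1))"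
      using B a0b [OF tin k] by (intro mult_mono) (auto intro: order_trans [OF _ B])
    finally show "norm (cnj (a t k) * triad_form (a t) (a t) k) \<le> R2 * (R0 * wt k powr (- 1))" .
  qed simp
  have "((\<lambda>t. \<Sum>\<^sub>\<infinity>k\<in>Mfreq. (norm (a t k))\<^sup>2) has_derivative (\<lambda>h. \<Sum>\<^sub>\<infinity>k\<in>Mfreq. h * (- (2 * \<nu>) * X t k - 2 * Y t k))) (at t)"
  proof (rule has_derivative_infsum [where S = "{t0<..<t1}" and B = "\<lambda>k. (2 * \<nu> * R1 * R0 + 2 * R2 * R0) * wt k powr (- 1)" and f' = "\<lambda>k t h. h * (- (2 * \<nu>) * X t k - 2 * Y t k)"])
    show "(\<lambda>k. (2 * \<nu> * R1 * R0 + 2 * R2 * R0) * wt k powr (- 1)) summable_on Mfreq"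
      by (intro summable_on_cmult_right sw)
    show "t \<in> {t0<..<t1}" using tt by simp
    fix k \<tau> assume k: "k \<in> Mfreq" and \<tau>: "\<tau> \<in> {t0<..<t1}"
    then have \<tau>J: "\<tau> \<in> open_times T" using sub by auto
    note d = coeff_sol_derivative [OF a k \<tau>J]
    let ?d = "- mu k *\<^sub>R a \<tau> k - triad_form (a \<tau>) (a \<tau>) k"
    have "((\<lambda>t. Re (a t k)) has_vector_derivative Re ?d) (at \<tau>)" "((\<lambda>t. Im (a t k)) has_vector_derivative Im ?d) (at \<tau>)"
      using bounded_linear.has_vector_derivative [OF bounded_linear_Re d] bounded_linear.has_vector_derivative [OF bounded_linear_Im d]
      by auto
    moreover have "((\<lambda>t. (x t)\<^sup>2 + (y t)\<^sup>2) has_real_derivative (2 * x \<tau> * p + 2 * y \<tau> * q)) (at \<tau>)"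
      if "(x has_vector_derivative p) (at \<tau>)" "(y has_vector_derivative q) (at \<tau>)" for x y :: "real \<Rightarrow> real" and p q
      using that unfolding has_real_derivative_iff_has_vector_derivative [symmetric]
      by (auto intro!: derivative_eq_intros)
    ultimately have "((\<lambda>t. (Re (a t k))\<^sup>2 + (Im (a t k))\<^sup>2) has_real_derivative (2 * Re (a \<tau> k) * Re ?d + 2 * Im (a \<tau> k) * Im ?d)) (at \<tau>)"
      by blast
    moreover have "2 * Re (a \<tau> k) * Re ?d + 2 * Im (a \<tau> k) * Im ?d = - (2 * \<nu>) * X \<tau> k - 2 * Y \<tau> k"
      by (simp add: X_def Y_def mu_def cmod_power2) (simp add: power2_eq_square algebra_simps)
    ultimately show "((\<lambda>t. (norm (a t k))\<^sup>2) has_derivative (\<lambda>h. h * (- (2 * \<nu>) * X \<tau> k - 2 * Y \<tau> k))) (at \<tau>)"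
      by (simp add: cmod_power2 has_field_derivative_def mult_commute_abs)
  next
    fix k \<tau> h assume k: "k \<in> Mfreq" and \<tau>: "\<tau> \<in> {t0<..<t1}"
    then have \<tau>': "\<tau> \<in> {t0..t1}" by auto
    have "\<bar>- (2 * \<nu>) * X \<tau> k - 2 * Y \<tau> k\<bar> \<le> 2 * \<nu> * \<bar>X \<tau> k\<bar> + 2 * \<bar>Y \<tau> k\<bar>"
      using abs_triangle_ineq4 [of "- (2 * \<nu>) * X \<tau> k" "2 * Y \<tau> k"] nu by (simp add: abs_mult)
    also have "\<dots> \<le> 2 * \<nu> * (R1 * (R0 * wt k powr (- 1))) + 2 * (R2 * (R0 * wt k powr (- 1)))"
      using Xb [OF \<tau>' k] Yb [OF \<tau>' k] nu by (intro add_mono mult_left_mono) auto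
    also have "\<dots> = (2 * \<nu> * R1 * R0 + 2 * R2 * R0) * wt k powr (- 1)" by (simp only: ring_distribs mult.assoc)
    finally have "\<bar>- (2 * \<nu>) * X \<tau> k - 2 * Y \<tau> k\<bar> * \<bar>h\<bar> \<le> (2 * \<nu> * R1 * R0 + 2 * R2 * R0) * wt k powr (- 1) * \<bar>h\<bar>"
      by (rule mult_right_mono) simp
    then show "norm (h * (- (2 * \<nu>) * X \<tau> k - 2 * Y \<tau> k)) \<le> (2 * \<nu> * R1 * R0 + 2 * R2 * R0) * wt k powr (- 1) * norm h"
      unfolding real_norm_def abs_mult by (subst mult.commute)
  next
    fix \<tau> assume \<tau>: "\<tau> \<in> {t0<..<t1}"
    then have \<tau>': "\<tau> \<in> {t0..t1}" by auto
    show "(\<lambda>k. norm ((norm (a \<tau> k))\<^sup>2)) summable_on Mfreq"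
    proof (rule summable_on_comparison_test)
      show "(\<lambda>k. R0\<^sup>2 * wt k powr (- 2)) summable_on Mfreq" by (intro summable_on_cmult_right summable_on_wt_powr) simp
      fix k assume k: "k \<in> Mfreq"
      have "wt k powr (2 * 0) * (norm (a \<tau> k))\<^sup>2 \<le> R0\<^sup>2 * wt k powr (- (2 * 1))"
        using R0 [OF \<tau>' k] by (intro weighted_square_le k) simp
      then show "norm ((norm (a \<tau> k))\<^sup>2) \<le> R0\<^sup>2 * wt k powr (- 2)" using wt_ge_1 [OF k] by simp
    qed simp
  qed (auto simp: countable_Mfreq)
  moreover have "(\<Sum>\<^sub>\<infinity>k\<in>Mfreq. h * (- (2 * \<nu>) * X t k - 2 * Y t k)) = h * (- (2 * \<nu>) * (\<Sum>\<^sub>\<infinity>k\<in>Mfreq. X t k))" for h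
  proof -
    have sym': "a t (- k) = cnj (a t k)" if "k \<in> Mfreq" for k
      using t by (intro coeff_sol_symmetric [OF a sym _ that]) (auto simp: time_interval_def)
    have "(\<Sum>\<^sub>\<infinity>k\<in>Mfreq. cnj (a t k) * triad_form (a t) (a t) k) = 0"
      by (rule energy_flux_zero [OF sym' R0 [OF tin]])
    then have "((\<lambda>k. cnj (a t k) * triad_form (a t) (a t) k) has_sum 0) Mfreq" using has_sum_infsum [OF sY] by simp
    from has_sum_Re [OF this] have "((\<lambda>k. Y t k) has_sum 0) Mfreq" by (simp add: Y_def)
    then have "((\<lambda>k. - (2 * \<nu>) * X t k + (- 2) * Y t k) has_sum (- (2 * \<nu>) * (\<Sum>\<^sub>\<infinity>k\<in>Mfreq. X t k) + (- 2) * 0)) Mfreq"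
      by (intro has_sum_add has_sum_cmult_right has_sum_infsum sX)
    then have "((\<lambda>k. h * (- (2 * \<nu>) * X t k + (- 2) * Y t k)) has_sum h * (- (2 * \<nu>) * (\<Sum>\<^sub>\<infinity>k\<in>Mfreq. X t k) + (- 2) * 0)) Mfreq"
      by (rule has_sum_cmult_right)
    from infsumI [OF this] show ?thesis by simp
  qed
  ultimately show ?thesis by (simp add: has_vector_derivative_def X_def)
qed

lemma field_Hs_alpha:
  assumes u0: "u0 \<in> HsM s" and a: "coeff_sol T (scalar_coeff (fhat u0)) a" and t: "t \<in> open_times T"
  shows "field u0 a t \<in> Hs \<alpha>"
    and "(Hs_norm \<alpha> (field u0 a t))\<^sup>2 = (\<Sum>\<^sub>\<infinity>k\<in>Mfreq. wt k powr (2 * \<alpha>) * (norm (a t k))\<^sup>2)"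
proof -
  have tT: "t \<in> time_interval T" using t by (simp add: time_interval_def)
  note H = field_HsM [OF u0 a tT]
  obtain R where R: "\<And>k. k \<in> Mfreq \<Longrightarrow> wt k powr (\<alpha> + 1) * norm (a t k) \<le> R"
    using coeff_sol_rapidly_decaying [OF a] t unfolding rapidly_decaying_def by (meson atLeastAtMost_iff order_refl)
  have "(\<lambda>k. wt k powr (2 * \<alpha>) * (norm (a t k))\<^sup>2) summable_on Mfreq"
  proof (rule summable_on_comparison_test)
    show "(\<lambda>k. R\<^sup>2 * wt k powr (- (2 * 1))) summable_on Mfreq"
      by (intro summable_on_cmult_right summable_on_wt_powr) simp
    show "wt k powr (2 * \<alpha>) * (norm (a t k))\<^sup>2 \<le> R\<^sup>2 * wt k powr (- (2 * 1))" if "k \<in> Mfreq" for k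
      by (rule weighted_square_le [OF that R [OF that]])
  qed simp
  then have "(\<lambda>k. wt k powr (2 * \<alpha>) * (norm (scalar_coeff (fhat (field u0 a t)) k))\<^sup>2) summable_on Mfreq"
    by (rule summable_on_cong [THEN iffD1, rotated]) (simp add: H(2))
  then show "field u0 a t \<in> Hs \<alpha>"
    using H(1) by (simp add: HsM_iff Hs_def adapted_sum(1))
  have "(Hs_norm \<alpha> (field u0 a t))\<^sup>2 = (\<Sum>\<^sub>\<infinity>k\<in>Mfreq. wt k powr (2 * \<alpha>) * (norm (scalar_coeff (fhat (field u0 a t)) k))\<^sup>2)"
    unfolding Hs_norm_def coeff_Hs_norm_adapted [OF HsM_adapted [OF H(1)]] by (simp add: infsum_nonneg)
  also have "\<dots> = (\<Sum>\<^sub>\<infinity>k\<in>Mfreq. wt k powr (2 * \<alpha>) * (norm (a t k))\<^sup>2)"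
    by (intro infsum_cong) (simp add: H(2))
  finally show "(Hs_norm \<alpha> (field u0 a t))\<^sup>2 = (\<Sum>\<^sub>\<infinity>k\<in>Mfreq. wt k powr (2 * \<alpha>) * (norm (a t k))\<^sup>2)" .
qed

lemma field_L2_norm:
  assumes u0: "u0 \<in> HsM s" and a: "coeff_sol T (scalar_coeff (fhat u0)) a" and t: "t \<in> time_interval T"
  shows "(L2_norm (field u0 a t))\<^sup>2 = (\<Sum>\<^sub>\<infinity>k\<in>Mfreq. (norm (a t k))\<^sup>2)"
proof -
  note H = field_HsM [OF u0 a t]
  have "(\<Sum>\<^sub>\<infinity>k\<in>Mfreq. (norm (scalar_coeff (fhat (field u0 a t)) k))\<^sup>2) = (L2_norm (field u0 a t))\<^sup>2"
    by (rule infsumI [OF L2_norm_HsM [OF H(1) s(1)]])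
  moreover have "(\<Sum>\<^sub>\<infinity>k\<in>Mfreq. (norm (scalar_coeff (fhat (field u0 a t)) k))\<^sup>2) = (\<Sum>\<^sub>\<infinity>k\<in>Mfreq. (norm (a t k))\<^sup>2)"
    by (intro infsum_cong) (simp add: H(2))
  ultimately show ?thesis by simp
qed

text \<open>The energy is continuous up to time 0, but its derivative is known only for positive
  times, and \<open>u0\<close> need not lie in H^\<alpha>. The fundamental theorem with interior
  derivatives yields integrability of the dissipation near 0 together with its integral.\<close>

lemma field_energy:
  assumes u0: "u0 \<in> HsM s" and a: "coeff_sol T (scalar_coeff (fhat u0)) a" and t: "t \<in> time_interval T"
  shows "set_integrable lebesgue {0<..<t} (\<lambda>\<tau>. (Hs_norm \<alpha> (field u0 a \<tau>))\<^sup>2)"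
    and "1/2 * (L2_norm (field u0 a t))\<^sup>2 + \<nu> * (LINT \<tau>:{0<..<t}|lebesgue. (Hs_norm \<alpha> (field u0 a \<tau>))\<^sup>2) = 1/2 * (L2_norm u0)\<^sup>2"
proof -
  let ?E = "\<lambda>t. \<Sum>\<^sub>\<infinity>k\<in>Mfreq. (norm (a t k))\<^sup>2"
  let ?D = "\<lambda>t. \<Sum>\<^sub>\<infinity>k\<in>Mfreq. wt k powr (2 * \<alpha>) * (norm (a t k))\<^sup>2"
  have t0: "0 \<le> t" using t by (simp add: time_interval_def)
  have sub: "{0..t} \<subseteq> time_interval T" by (rule time_interval_initial [OF t])
  obtain m where m: "m summable_on Mfreq" "\<And>\<tau> k. \<tau> \<in> {0..t} \<Longrightarrow> k \<in> Mfreq \<Longrightarrow> wt k powr (2 * s) * (norm (a \<tau> k))\<^sup>2 \<le> m k"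
    using coeff_sol_majorant [OF a HsM_summable [OF u0] t] by blast
  have cE: "continuous_on {0..t} ?E"
  proof (rule continuous_on_infsum [OF m(1)])
    fix k assume k: "k \<in> Mfreq"
    show "continuous_on {0..t} (\<lambda>\<tau>. (norm (a \<tau> k))\<^sup>2)"
      by (intro continuous_intros continuous_on_subset [OF coeff_sol_continuous [OF a k] sub])
    fix \<tau> assume \<tau>: "\<tau> \<in> {0..t}"
    have "1 * (norm (a \<tau> k))\<^sup>2 \<le> wt k powr (2 * s) * (norm (a \<tau> k))\<^sup>2"
      using wt_ge_1 [OF k] s by (intro mult_right_mono ge_one_powr_ge_zero) auto
    then show "norm ((norm (a \<tau> k))\<^sup>2) \<le> m k" using m(2) [OF \<tau> k] by simp
  qed
  have "((\<lambda>\<tau>. - (2 * \<nu>) * ?D \<tau>) has_integral (?E t - ?E 0)) {0..t}"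
  proof (rule fundamental_theorem_of_calculus_interior [OF t0 cE])
    fix \<tau> assume "\<tau> \<in> {0<..<t}"
    then have "\<tau> \<in> open_times T" using sub by (auto simp: time_interval_def subset_iff)
    then show "(?E has_vector_derivative - (2 * \<nu>) * ?D \<tau>) (at \<tau>)"
      by (rule energy_derivative [OF a scalar_coeff_fhat_uminus])
  qed
  then have "((\<lambda>\<tau>. - 1 / (2 * \<nu>) * (- (2 * \<nu>) * ?D \<tau>)) has_integral - 1 / (2 * \<nu>) * (?E t - ?E 0)) {0..t}"
    by (rule has_integral_mult_right)
  moreover have "- 1 / (2 * \<nu>) * (x - y) = (y - x) / (2 * \<nu>)" "- 1 / (2 * \<nu>) * (- (2 * \<nu>) * x) = x" for x y
    using nu by (simp_all add: field_simps)
  ultimately have I: "(?D has_integral (?E 0 - ?E t) / (2 * \<nu>)) {0..t}" by (simp only:)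
  have nn: "0 \<le> ?D \<tau>" for \<tau> by (simp add: infsum_nonneg)
  have "?D absolutely_integrable_on {0..t}"
    using I nn by (intro nonnegative_absolutely_integrable_1) (auto simp: integrable_on_def)
  then have S: "set_integrable lebesgue {0<..<t} ?D" by (rule set_integrable_subset) auto
  have eq: "(Hs_norm \<alpha> (field u0 a \<tau>))\<^sup>2 = ?D \<tau>" if "\<tau> \<in> {0<..<t}" for \<tau>
  proof -
    have "\<tau> \<in> open_times T" using sub that by (auto simp: time_interval_def subset_iff)
    then show ?thesis by (rule field_Hs_alpha [OF u0 a])
  qed
  show "set_integrable lebesgue {0<..<t} (\<lambda>\<tau>. (Hs_norm \<alpha> (field u0 a \<tau>))\<^sup>2)"
    using S by (rule set_integrable_cong [THEN iffD1, rotated -1]) (auto simp: eq)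
  have "(LINT \<tau>:{0<..<t}|lebesgue. (Hs_norm \<alpha> (field u0 a \<tau>))\<^sup>2) = (LINT \<tau>:{0<..<t}|lebesgue. ?D \<tau>)"
    by (intro set_lebesgue_integral_cong) (auto simp: eq)
  also have "\<dots> = integral {0<..<t} ?D" using S by (rule set_lebesgue_integral_eq_integral)
  also have "\<dots> = integral {0..t} ?D" by (rule integral_open_interval_real [symmetric])
  also have "\<dots> = (?E 0 - ?E t) / (2 * \<nu>)" using I by (rule integral_unique)
  finally have J: "(LINT \<tau>:{0<..<t}|lebesgue. (Hs_norm \<alpha> (field u0 a \<tau>))\<^sup>2) = (?E 0 - ?E t) / (2 * \<nu>)" .
  have "0 \<in> time_interval T" using sub t0 by auto
  from field_L2_norm [OF u0 a this] have E0: "?E 0 = (L2_norm u0)\<^sup>2" by (simp add: field_def)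
  show "1/2 * (L2_norm (field u0 a t))\<^sup>2 + \<nu> * (LINT \<tau>:{0<..<t}|lebesgue. (Hs_norm \<alpha> (field u0 a \<tau>))\<^sup>2) = 1/2 * (L2_norm u0)\<^sup>2"
    unfolding J E0 field_L2_norm [OF u0 a t] using nu by (simp add: field_simps)
qed

subsection \<open>The maximal solution\<close>

text \<open>Solutions on different intervals agree by uniqueness, so the value at t may be taken
  from any solution that reaches beyond t.\<close>

lemma coeff_sol_Sup:
  assumes ex: "\<And>t. t \<in> time_interval T \<Longrightarrow> \<exists>T' a. t \<in> time_interval T' \<and> T' \<le> T \<and> coeff_sol T' a0 a" and T: "0 < T"
  obtains a where "coeff_sol T a0 a"
proof -
  obtain Tf af where f: "\<And>t. t \<in> time_interval T \<Longrightarrow> t \<in> time_interval (Tf t)" "\<And>t. t \<in> time_interval T \<Longrightarrow> Tf t \<le> T"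
    "\<And>t. t \<in> time_interval T \<Longrightarrow> coeff_sol (Tf t) a0 (af t)"
    using ex by metis
  define a where "a t = af t t" for t
  have loc: "coeff_sol (Tf t) a0 a" if t: "t \<in> time_interval T" for t
  proof (rule coeff_sol_cong [OF f(3) [OF t]])
    show "0 < Tf t" using f(1) [OF t] by (auto simp: time_interval_def zero_ereal_def intro: le_less_trans [of "ereal 0" "ereal t"])
    fix \<tau> k assume \<tau>: "\<tau> \<in> time_interval (Tf t)" and k: "k \<in> Mfreq"
    have \<tau>T: "\<tau> \<in> time_interval T" using \<tau> f(2) [OF t] by (auto simp: time_interval_def)
    have "\<tau> \<in> time_interval (min (Tf \<tau>) (Tf t))" using \<tau> f(1) [OF \<tau>T] by (auto simp: time_interval_def)
    then show "a \<tau> k = af t \<tau> k"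
      unfolding a_def
      by (intro coeff_sol_unique [OF coeff_sol_restrict [OF f(3) [OF \<tau>T]] coeff_sol_restrict [OF f(3) [OF t]] _ k]) auto
  qed
  have 0: "0 \<in> time_interval T" using T by (simp add: time_interval_def zero_ereal_def)
  have "coeff_sol T a0 a"
    unfolding coeff_sol_def
  proof (intro conjI ballI)
    fix k assume k: "k \<in> Mfreq"
    show "a 0 k = a0 k" using loc [OF 0] k by (simp add: coeff_sol_def)
    fix t assume t: "t \<in> time_interval T"
    obtain t' where t': "t < t'" "ereal t' < Tf t"
      using f(1) [OF t] ereal_dense2 [of "ereal t" "Tf t"] by (auto simp: time_interval_def)
    have "((\<lambda>t. a t k) has_vector_derivative - mu k *\<^sub>R a t k - triad_form (a t) (a t) k) (at t within time_interval (Tf t))"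
      using loc [OF t] f(1) [OF t] k by (simp add: coeff_sol_def)
    then show "((\<lambda>t. a t k) has_vector_derivative - mu k *\<^sub>R a t k - triad_form (a t) (a t) k) (at t within time_interval T)"
      unfolding at_within_time_interval [OF t'] at_within_time_interval [OF t'(1) less_le_trans [OF t'(2) f(2) [OF t]]] .
  next
    fix t assume "t \<in> time_interval T"
    then show "\<exists>R. \<forall>t\<in>{0..t}. \<forall>k\<in>Mfreq. wt k powr s * norm (a t k) \<le> R"
      using loc f(1) unfolding coeff_sol_def by meson
  qed
  then show ?thesis by (rule that)
qed

text \<open>The largest T that \<open>local_existence\<close> admits for data of size A > 0,
  obtained by solving 8 * \<open>triad_const\<close> * A * T powr \<rho> = \<nu> powr (1 -
  \<rho>).\<close>

definition local_time :: "real \<Rightarrow> real" where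
  "local_time A = \<nu> powr (1 / \<rho> - 1) / (8 * triad_const * A) powr (1 / \<rho>)"

lemma local_time_props:
  assumes "0 < A" shows "0 < local_time A" "8 * triad_const * A * local_time A powr \<rho> = \<nu> powr (1 - \<rho>)"
proof -
  have P: "0 < 8 * triad_const * A" using assms triad_const_pos by simp
  show "0 < local_time A" unfolding local_time_def using nu P by (intro divide_pos_pos) auto
  have "local_time A powr \<rho> = (\<nu> powr (1 / \<rho> - 1)) powr \<rho> / ((8 * triad_const * A) powr (1 / \<rho>)) powr \<rho>"
    unfolding local_time_def by (rule powr_divide)
  also have "\<dots> = \<nu> powr (1 - \<rho>) / (8 * triad_const * A)"
  proof -
    have "(1 / \<rho> - 1) * \<rho> = 1 - \<rho>" using rho_bounds by (simp add: field_simps)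
    then show ?thesis using P rho_bounds by (simp add: powr_powr)
  qed
  finally show "8 * triad_const * A * local_time A powr \<rho> = \<nu> powr (1 - \<rho>)" using assms triad_const_pos by simp
qed

lemma Hs_norm_nonneg: "0 \<le> Hs_norm s u"
  by (simp add: Hs_norm_def coeff_Hs_norm_def infsum_nonneg lap_symbol_eq)

text \<open>The maximal time is a supremum over mild solutions, so both directions of the
  equivalence with \<open>coeff_sol\<close> enter: local existence makes the supremum positive, and
  mild solutions reaching beyond each earlier time are pieced together by
  \<open>coeff_sol_Sup\<close>.\<close>

lemma exists_maximal_solution:
  assumes u0: "u0 \<in> HsM s"
  defines "Tmax \<equiv> max_existence_time \<nu> \<alpha> s u0"
  obtains a where "coeff_sol Tmax (scalar_coeff (fhat u0)) a" "0 < Tmax"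
    "\<And>T. \<exists>b. coeff_sol T (scalar_coeff (fhat u0)) b \<Longrightarrow> 0 < T \<Longrightarrow> T \<le> Tmax"
    "\<And>T w. mild_solution \<nu> \<alpha> s u0 T w \<Longrightarrow> T \<le> Tmax"
proof -
  let ?a0 = "scalar_coeff (fhat u0)"
  have le: "T \<le> Tmax" if "\<exists>b. coeff_sol T ?a0 b" "0 < T" for T
    unfolding Tmax_def max_existence_time_def using that coeff_sol_imp_mild [OF u0] by (intro Sup_upper) blast
  have mle: "T \<le> Tmax" if "mild_solution \<nu> \<alpha> s u0 T w" for T w
    unfolding Tmax_def max_existence_time_def using that by (intro Sup_upper) blast
  \<comment> \<open>Adding 1 keeps A positive for data of norm zero.\<close>
  define A where "A = Hs_norm s u0 + 1"
  have A: "0 < A" using Hs_norm_nonneg [of u0] by (simp add: A_def)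
  have "wt k powr s * norm (?a0 k) \<le> A" if "k \<in> Mfreq" for k
    using HsM_weighted_le [OF u0 that] by (simp add: A_def)
  then obtain b where "coeff_sol (ereal (local_time A)) ?a0 b"
    using local_existence [of ?a0 A "local_time A"] A local_time_props [OF A] by auto
  then have "ereal (local_time A) \<le> Tmax" using local_time_props(1) [OF A] by (intro le) auto
  then have pos: "0 < Tmax" using local_time_props(1) [OF A] by (meson ereal_less(2) less_le_trans)
  obtain a where "coeff_sol Tmax ?a0 a"
  proof (rule coeff_sol_Sup [OF _ pos])
    fix t assume t: "t \<in> time_interval Tmax"
    then have "ereal t < Sup {T. \<exists>u. mild_solution \<nu> \<alpha> s u0 T u}"
      by (simp add: time_interval_def Tmax_def max_existence_time_def)
    then obtain T w where "ereal t < T" "mild_solution \<nu> \<alpha> s u0 T w"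
      unfolding less_Sup_iff by blast
    then show "\<exists>T' a. t \<in> time_interval T' \<and> T' \<le> Tmax \<and> coeff_sol T' ?a0 a"
      using t mild_imp_coeff_sol [OF _ u0] mle by (intro exI [of _ T]) (auto simp: time_interval_def)
  qed
  then show ?thesis using pos le mle by (rule that)
qed

text \<open>A solution restarted at time t and glued on competes in the supremum that defines the
  maximal time, so it cannot outlive it.\<close>

lemma restart_time_le:
  assumes u0: "u0 \<in> HsM s" and a: "coeff_sol Tmax (scalar_coeff (fhat u0)) a"
    and max: "\<And>T. \<exists>b. coeff_sol T (scalar_coeff (fhat u0)) b \<Longrightarrow> 0 < T \<Longrightarrow> T \<le> Tmax"
    and t: "t \<in> time_interval Tmax" and T': "0 < T'" "8 * triad_const * Hs_norm s (field u0 a t) * T' powr \<rho> \<le> \<nu> powr (1 - \<rho>)"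
  shows "ereal (t + T') \<le> Tmax"
proof -
  note H = field_HsM [OF u0 a t]
  have "wt k powr s * norm (a t k) \<le> Hs_norm s (field u0 a t)" if "k \<in> Mfreq" for k
    using HsM_weighted_le [OF H(1) that] H(2) [OF that] by simp
  then obtain b where "coeff_sol (ereal T') (a t) b"
    using local_existence [of "a t" "Hs_norm s (field u0 a t)" T'] Hs_norm_nonneg T' by blast
  then obtain c where c: "coeff_sol (ereal t + ereal T') (scalar_coeff (fhat u0)) c"
    using coeff_sol_glue [OF a t, of "ereal T'" b] T' by (auto simp: zero_ereal_def)
  have "0 \<le> t" using t by (simp add: time_interval_def)
  then have "0 < ereal (t + T')" using T' by (simp add: zero_ereal_def)
  then show ?thesis using c by (intro max) auto
qed

text \<open>By \<open>restart_time_le\<close> the local time belonging to the field at t is at most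
  Tmax - t; raising this to the power \<rho> gives the rate.\<close>

lemma blowup_rate:
  assumes u0: "u0 \<in> HsM s" and a: "coeff_sol Tmax (scalar_coeff (fhat u0)) a"
    and max: "\<And>T. \<exists>b. coeff_sol T (scalar_coeff (fhat u0)) b \<Longrightarrow> 0 < T \<Longrightarrow> T \<le> Tmax"
    and fin: "Tmax < \<infinity>" and t: "t \<in> time_interval Tmax"
  shows "\<nu> powr (1 - \<rho>) / (8 * triad_const * (real_of_ereal Tmax - t) powr \<rho>) \<le> Hs_norm s (field u0 a t)"
proof -
  let ?A = "Hs_norm s (field u0 a t)"
  obtain r where r: "Tmax = ereal r" using fin t by (cases Tmax) (auto simp: time_interval_def)
  have tr: "t < r" using t r by (simp add: time_interval_def)
  have "?A \<noteq> 0"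
  proof
    assume "?A = 0"
    \<comment> \<open>A field of norm zero could be continued for any length of time, here one unit
      past r.\<close>
    then have "ereal (t + (r - t + 1)) \<le> Tmax"
      using tr by (intro restart_time_le [OF u0 a max t]) auto
    then show False by (simp add: r)
  qed
  then have A: "0 < ?A" using Hs_norm_nonneg [of "field u0 a t"] by simp
  have "ereal (t + local_time ?A) \<le> Tmax"
    using local_time_props [OF A] by (intro restart_time_le [OF u0 a max t]) auto
  then have "local_time ?A \<le> r - t" by (simp add: r)
  then have "local_time ?A powr \<rho> \<le> (r - t) powr \<rho>"
    using local_time_props(1) [OF A] rho_bounds by (intro powr_mono2) auto
  then have "\<nu> powr (1 - \<rho>) \<le> 8 * triad_const * ?A * (r - t) powr \<rho>"
    unfolding local_time_props(2) [OF A, symmetric] using A triad_const_pos by (intro mult_left_mono) auto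
  then show ?thesis using tr triad_const_pos by (simp add: r field_simps)
qed

text \<open>For data of norm zero the quotient is \<infinity> in the extended reals, so the claim
  becomes global existence, which follows by restarting at time 0 with arbitrary T'.\<close>

lemma existence_time_lower_bound:
  assumes u0: "u0 \<in> HsM s" and a: "coeff_sol Tmax (scalar_coeff (fhat u0)) a" and T: "0 < Tmax"
    and max: "\<And>T. \<exists>b. coeff_sol T (scalar_coeff (fhat u0)) b \<Longrightarrow> 0 < T \<Longrightarrow> T \<le> Tmax"
  shows "ereal (\<nu> powr (1 / \<rho> - 1)) / ereal ((8 * triad_const * Hs_norm s u0) powr (1 / \<rho>)) \<le> Tmax"
proof -
  have 0: "0 \<in> time_interval Tmax" using T by (simp add: time_interval_def zero_ereal_def)
  have f: "field u0 a 0 = u0" by (simp add: field_def)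
  show ?thesis
  proof (cases "Hs_norm s u0 = 0")
    case True
    have "ereal T' \<le> Tmax" if "0 < T'" for T'
      using restart_time_le [OF u0 a max 0 that] True by (simp add: f)
    from this [of "\<bar>real_of_ereal Tmax\<bar> + 1"] have "Tmax = \<infinity>"
      using T by (cases Tmax) auto
    then show ?thesis by simp
  next
    case False
    then have A: "0 < Hs_norm s u0" using Hs_norm_nonneg [of u0] by simp
    have "ereal (local_time (Hs_norm s u0)) \<le> Tmax"
      using restart_time_le [OF u0 a max 0 local_time_props(1) [OF A]] local_time_props(2) [OF A] by (simp add: f)
    then show ?thesis using A triad_const_pos by (simp add: local_time_def)
  qed
qed

text \<open>The coefficients of both fields solve the same system, and equal Fourier coefficients
  determine a field almost everywhere.\<close>

lemma solution_unique_ae: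
  assumes u0: "u0 \<in> HsM s" and a: "coeff_sol Tmax (scalar_coeff (fhat u0)) a"
    and w: "mild_solution \<nu> \<alpha> s u0 T w" and T: "T \<le> Tmax" and t: "t \<in> time_interval T"
  shows "ae_eq (w t) (field u0 a t)"
proof -
  have tT: "t \<in> time_interval Tmax" using t T by (auto simp: time_interval_def)
  note H = field_HsM [OF u0 a tT]
  have W: "w t \<in> HsM s" using w t by (auto simp: mild_solution_def continuous_HsM_def)
  have c: "scalar_coeff (fhat (w t)) k = a t k" if "k \<in> Mfreq" for k
    using coeff_sol_unique [OF mild_imp_coeff_sol [OF w u0] coeff_sol_restrict [OF a T] t that] .
  have "fhat (w t) k = fhat (field u0 a t) k" for k
  proof (cases "k \<in> Mfreq")
    case True
    then show ?thesis
      using adapted_eq [OF HsM_adapted [OF W] True] adapted_eq [OF HsM_adapted [OF H(1)] True] c H(2) by simp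
  next
    case False
    then show ?thesis using HsM_adapted [OF W] HsM_adapted [OF H(1)] by (simp add: adapted_def)
  qed
  then show ?thesis by (intro ae_eq_if_fhat_eq HsM_L2 [OF W] HsM_L2 [OF H(1)])
qed

end

theorem theorem1p8:
  shows "\<exists>Cstar::real. Cstar > 0 \<and>
    (\<forall>\<alpha>::real. 0 < \<alpha> \<and> \<alpha> < ln 3 / (4 * ln 2) \<longrightarrow>
     (\<forall>s::real. crit_exp - 2 * \<alpha> < s \<and> s \<le> crit_exp \<longrightarrow>
      (\<exists>C::real. C > 0 \<and>
       (\<forall>\<nu>::real. \<nu> > 0 \<longrightarrow>
        (\<forall>u0\<in>HsM s.
         (let Tmax = max_existence_time \<nu> \<alpha> s u0; \<rho> = rho \<alpha> s in
          \<exists>u. mild_solution \<nu> \<alpha> s u0 Tmax u \<and>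
              (\<forall>T w. mild_solution \<nu> \<alpha> s u0 T w \<longrightarrow> (\<forall>t\<in>time_interval T. ae_eq (w t) (u t))) \<and>
              ereal (\<nu> powr (1 / \<rho> - 1)) / ereal ((C * Hs_norm s u0) powr (1 / \<rho>)) \<le> Tmax \<and>
              (Tmax < \<infinity> \<longrightarrow>
                 (\<forall>t\<in>time_interval Tmax.
                    Hs_norm s (u t) \<ge> \<nu> powr (1 - \<rho>) / (C * (real_of_ereal Tmax - t) powr \<rho>))) \<and>
              (s = crit_exp \<longrightarrow>
                 1 / ereal (Cstar * Hs_norm s u0) \<le> Tmax \<and>
                 (Tmax < \<infinity> \<longrightarrow>
                    (\<forall>t\<in>time_interval Tmax.
                       Hs_norm s (u t) \<ge> 1 / (Cstar * (real_of_ereal Tmax - t))))) \<and>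
              (\<forall>t. 0 < t \<and> ereal t < Tmax \<longrightarrow> u t \<in> Hs \<alpha>) \<and>
              (\<forall>t\<in>time_interval Tmax.
                 set_integrable lebesgue {0<..<t} (\<lambda>\<tau>. (Hs_norm \<alpha> (u \<tau>))\<^sup>2) \<and>
                 1/2 * (L2_norm (u t))\<^sup>2 + \<nu> * (LINT \<tau>:{0<..<t}|lebesgue. (Hs_norm \<alpha> (u \<tau>))\<^sup>2)
                   = 1/2 * (L2_norm u0)\<^sup>2) \<and>
              smooth_on (\<lambda>(t, x). u t x) ({t. 0 < t \<and> ereal t < Tmax} \<times> UNIV)))))))"
\<comment> \<open>One number serves as both constants, because \<open>triad_const\<close> is
  independent of \<alpha> and s.\<close>
proof (intro exI [of _ "8 * triad_const"] conjI allI impI ballI, goal_cases)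
  case (3 \<alpha> s \<nu> u0)
  then have \<alpha>: "0 < \<alpha> \<and> \<alpha> < ln 3 / (4 * ln 2)" and s: "crit_exp - 2 * \<alpha> < s \<and> s \<le> crit_exp"
    and \<nu>: "\<nu> > 0" and u0: "u0 \<in> HsM s" by auto
  \<comment> \<open>The upper bound on \<alpha> enters here and gives 0 < s.\<close>
  have "2 * \<alpha> < crit_exp" using \<alpha> by (simp add: crit_exp_def field_simps)
  then interpret hypodissipative \<nu> \<alpha> s using \<alpha> s \<nu> by unfold_locales auto
  define Tmax where "Tmax = max_existence_time \<nu> \<alpha> s u0"
  obtain a where a: "coeff_sol Tmax (scalar_coeff (fhat u0)) a" and T: "0 < Tmax"
    and max: "\<And>T. \<exists>b. coeff_sol T (scalar_coeff (fhat u0)) b \<Longrightarrow> 0 < T \<Longrightarrow> T \<le> Tmax"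
    and mmax: "\<And>T w. mild_solution \<nu> \<alpha> s u0 T w \<Longrightarrow> T \<le> Tmax"
    unfolding Tmax_def using exists_maximal_solution [OF u0] by blast
  have lower: "ereal (\<nu> powr (1 / \<rho> - 1)) / ereal ((8 * triad_const * Hs_norm s u0) powr (1 / \<rho>)) \<le> Tmax"
    by (rule existence_time_lower_bound [OF u0 a T max])
  have rate: "\<nu> powr (1 - \<rho>) / (8 * triad_const * (real_of_ereal Tmax - t) powr \<rho>) \<le> Hs_norm s (field u0 a t)"
    if "Tmax < \<infinity>" "t \<in> time_interval Tmax" for t
    by (rule blowup_rate [OF u0 a max that])
  have crit: "1 / ereal (8 * triad_const * Hs_norm s u0) \<le> Tmax \<and> (Tmax < \<infinity> \<longrightarrow>
      (\<forall>t\<in>time_interval Tmax. 1 / (8 * triad_const * (real_of_ereal Tmax - t)) \<le> Hs_norm s (field u0 a t)))"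
    if "s = crit_exp"
  proof -
    \<comment> \<open>With \<rho> = 1 all powers of \<nu> become 1 and drop out of the
      bounds.\<close>
    have rho1: "\<rho> = 1" using that by (simp add: rho_def)
    have "0 \<le> 8 * triad_const * Hs_norm s u0" using triad_const_pos Hs_norm_nonneg by simp
    then have "1 / ereal (8 * triad_const * Hs_norm s u0) \<le> Tmax"
      using lower nu by (simp add: rho1 one_ereal_def)
    moreover have "1 / (8 * triad_const * (real_of_ereal Tmax - t)) \<le> Hs_norm s (field u0 a t)"
      if fin: "Tmax < \<infinity>" and t: "t \<in> time_interval Tmax" for t
    proof -
      \<comment> \<open>The identity \<open>x powr 1 = x\<close> requires x to be
        nonnegative.\<close>
      have "0 \<le> real_of_ereal Tmax - t" using fin t by (cases Tmax) (auto simp: time_interval_def)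
      then show ?thesis using rate [OF fin t] nu by (simp add: rho1)
    qed
    ultimately show ?thesis by blast
  qed
  show ?case
    unfolding Let_def Tmax_def [symmetric]
  proof (intro exI [of _ "field u0 a"] conjI allI impI ballI)
    show "mild_solution \<nu> \<alpha> s u0 Tmax (field u0 a)" by (rule coeff_sol_imp_mild [OF u0 a T])
    show "ae_eq (w t) (field u0 a t)" if "mild_solution \<nu> \<alpha> s u0 T w" "t \<in> time_interval T" for T w t
      by (rule solution_unique_ae [OF u0 a that(1) mmax [OF that(1)] that(2)])
    show "field u0 a t \<in> Hs \<alpha>" if "0 < t \<and> ereal t < Tmax" for t
      using that by (intro field_Hs_alpha [OF u0 a]) auto
    show "smooth_on (\<lambda>(t, x). field u0 a t x) (open_times Tmax \<times> UNIV)" by (rule field_smooth [OF a])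
  qed (use lower rate crit field_energy [OF u0 a] in auto)
qed (use triad_const_pos in simp_all)

end
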